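(* Let $X$ be a Banach space, $K\subset X$ a nonempty compact subset, $F:K\to K$ a homeomorphism, and $\mathcal{T}:K\to L(X)$, $x\mapsto T_x$, a continuous map such that $T_x$ is a compact operator for every $x\in K$. Let $N\ge 1$ be an integer, $I=\{0,1,\dots,N\}$, let $0<k_0<k_1<\cdots<k_N$ be integers, and put $j_0=k_0$, $j_{i+1}=k_{i+1}-k_i$ for $i\in I\setminus\{N\}$, and $J=\{j_i: i\in I\}$. Let $\mathcal{C}=\{C_i\}_{i\in I}$ be a set of cones in $X$ such that $C_i$ is a complemented and $k_i$-solid cone for each $i\in I$, and assume that $\mathcal{C}$ is strongly invariant with respect to the linear cocycle $(F,\mathcal{T})$ on $K\times X$, i.e. $T_x(C_i\setminus\{0\})\subset \mathrm{Int}\,C_i$ for all $(x,i)\in K\times I$. Then $(F,\mathcal{T})$ on $K\times X$ admits a decomposition of quasi-all invariant bundles with the index set $J$, whose positive invariant bundles, the $j_i$-dimensional continuous bundles $K\times(P_{i,x})$ ($i\in I$) and the $k_N$-codimensional continuous bundle $K\times(Q_x)$, satisfy: (i) $X=P_{0,x}\oplus\cdots\oplus P_{N,x}\oplus Q_x$ for any $x\in K$; (ii) $T_xP_{i,x}=P_{i,F(x)}$ and $T_xQ_x\subset Q_{F(x)}$ for any $x\in K$ and $i\in I$; (iii) $P_{0,x}\setminus\{0\}\subset \mathrm{Int}\,C_0$ and $P_{i+1,x}\setminus\{0\}\subset \mathrm{Int}\,C_{i+1}\setminus C_i$ for any $x\in K$ and $i\in I\setminus\{N\}$; (iv) $Q_x\setminus\{0\}\subset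 X\setminus C_N$ for any $x\in K$; (v) for each $i\in I\setminus\{N\}$ there exists $\gamma_i\in(0,1)$ such that $c_{\mathcal{T},ix}+\log(\gamma_i)\ge c_{\mathcal{T},i+1\,x}$ for any $x\in K$.
   Context: $L(X)$ is the space of bounded linear operators on $X$ with the operator norm; $X^*$ is the dual of $X$; $S=\{v\in X:\|v\|=1\}$. Cones. A closed subset $C\subset X$ is a cone of rank $k$ ($k$-cone) if $\mathbb{R}\cdot C\subset C$ and $\max\{\dim H: H\subset C \text{ a linear subspace}\}=k$. A $k$-cone $C$ is $k$-solid if there is a $k$-dimensional subspace $H$ with $H\setminus\{0\}\subset \mathrm{Int}\,C$; it is complemented if there is a closed $k$-codimensional linear subspace $H^c$ with $H^c\setminus\{0\}\subset X\setminus C$. Bundles. $G(k,X)$ is the set of $k$-dimensional linear subspaces of $X$, with the gap metric $d(L_1,L_2)=\max\{\sup_{v\in L_1\cap S}\inf_{u\in L_2\cap S}\|v-u\|,\ \sup_{v\in L_2\cap S}\inf_{u\in L_1\cap S}\|v-u\|\}$ (similarly $G(k,X^* )$). For a family $\{P_x\}_{x\in K}$ of $k$-dimensional subspaces of $X$, $K\times(P_x)$ is a $k$-dimensional continuous bundle if $x\mapsto P_x\in G(k,X)$ is continuous. For a family $\{Q_x\}_{x\in K}$ of closed $k$-codimensional subspaces, $K\times(Q_x)$ is a $k$-codimensional continuous bundle if there is a $k$-dimensional continuous bundle $K\times(L_x)\subset K\times X^*$ with $\mathrm{Ker}(L_x)=\{v\in X:\ell(v)=0\ \forall \ell\in L_x\}=Q_x$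 for each $x\in K$. Cocycle. The linear cocycle $(F,\mathcal{T})$ on $K\times X$ is the map $(x,v)\mapsto(F(x),T_xv)$. Write $T_x^0=\mathrm{Id}$ and $T_x^n=T_{F^{n-1}(x)}\circ T_x^{n-1}$ for $n\ge1$. Decomposition of quasi-all invariant bundles with index set $J=\{j_i:i\in I\}$, with $k_N=\sum_{l=0}^N j_l$: there are $j_i$-dimensional continuous bundles $K\times(P_{i,x})$, $i\in I$, and a $k_N$-codimensional continuous bundle $K\times(Q_x)$ such that $X=P_{0,x}\oplus\cdots\oplus P_{N,x}\oplus Q_x$, $T_xP_{i,x}=P_{i,F(x)}$ and $T_xQ_x\subset Q_{F(x)}$ for all $x\in K$, $i\in I$. ($J$ is regarded as indexed by $i\in I$.) Characteristic exponents. For such a decomposition, the $j_i$-characteristic exponent is $c_{\mathcal{T},ix}=\limsup_{n\to+\infty}\frac{1}{n}\log m(T_x^n|_{P_{i,x}})$, where $m(T_x^n|_{P_{i,x}})=\inf_{v\in P_{i,x}\cap S}\|T_x^nv\|$; it takes values in $[-\infty,+\infty)$.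
   Formalization: The formal theorem adds: if C_N = X (possible only when dim X = k_N), each T_x is injective. Without this the claim fails, e.g. a projection of R^2 onto the x-axis with C_0={|y|≤|x|}, C_1=R^2; when C_N = X the conclusion itself forces injectivity. *)

theory Defs
  imports "HOL-Analysis.Analysis"
begin

(* The library's dim is 0 on infinite-dimensional spaces, so finite-dimensionality
   is made part of the notion. *)
definition k_dimensional :: "nat \<Rightarrow> 'a::real_vector set \<Rightarrow> bool" where
  "k_dimensional k H \<longleftrightarrow>
     (\<exists>B. finite B \<and> card B = k \<and> independent B \<and> span B = H)"

definition k_codimensional :: "nat \<Rightarrow> 'a::real_vector set \<Rightarrow> bool" where
  "k_codimensional k H \<longleftrightarrow>
     subspace H \<and>
     (\<exists>L. k_dimensional k L \<and> L \<inter> H = {0} \<and> {u + v |u v. u \<in> L \<and> v \<in> H} = UNIV)"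

definition compact_operator :: "('a::real_normed_vector \<Rightarrow>\<^sub>L 'b::real_normed_vector) \<Rightarrow> bool" where
  "compact_operator A \<longleftrightarrow> compact (closure (blinfun_apply A ` cball 0 1))"


(* The last conjunct says that the maximal dimension is at most k, and in
   particular that C contains no infinite-dimensional subspace. *)
definition k_cone :: "nat \<Rightarrow> 'a::real_normed_vector set \<Rightarrow> bool" where
  "k_cone k C \<longleftrightarrow>
     closed C \<and>
     (\<forall>r. \<forall>v\<in>C. r *\<^sub>R v \<in> C) \<and>
     (\<exists>H. k_dimensional k H \<and> H \<subseteq> C) \<and>
     (\<forall>H. subspace H \<and> H \<subseteq> C \<longrightarrow> (\<exists>m\<le>k. k_dimensional m H))"

definition k_solid_cone :: "nat \<Rightarrow> 'a::real_normed_vector set \<Rightarrow> bool" where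
  "k_solid_cone k C \<longleftrightarrow>
     k_cone k C \<and> (\<exists>H. k_dimensional k H \<and> H - {0} \<subseteq> interior C)"

definition complemented_cone :: "nat \<Rightarrow> 'a::real_normed_vector set \<Rightarrow> bool" where
  "complemented_cone k C \<longleftrightarrow>
     k_cone k C \<and>
     (\<exists>H. closed H \<and> k_codimensional k H \<and> H - {0} \<subseteq> - C)"


(* Meaningful for nonzero finite-dimensional subspaces only: Sup and Inf on the reals
   are unspecified on the empty set. *)
definition gap :: "'a::real_normed_vector set \<Rightarrow> 'a set \<Rightarrow> real" where
  "gap L M = max (SUP v\<in>L \<inter> sphere 0 1. INF u\<in>M \<inter> sphere 0 1. norm (v - u))
                 (SUP v\<in>M \<inter> sphere 0 1. INF u\<in>L \<inter> sphere 0 1. norm (v - u))"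

definition continuous_bundle ::
  "'x::topological_space set \<Rightarrow> nat \<Rightarrow> ('x \<Rightarrow> 'a::real_normed_vector set) \<Rightarrow> bool" where
  "continuous_bundle K k P \<longleftrightarrow>
     (\<forall>x\<in>K. k_dimensional k (P x)) \<and>
     (\<forall>x\<in>K. ((\<lambda>y. gap (P y) (P x)) \<longlongrightarrow> 0) (at x within K))"

definition codim_continuous_bundle ::
  "'x::topological_space set \<Rightarrow> nat \<Rightarrow> ('x \<Rightarrow> 'a::real_normed_vector set) \<Rightarrow> bool" where
  "codim_continuous_bundle K k Q \<longleftrightarrow>
     (\<forall>x\<in>K. closed (Q x) \<and> k_codimensional k (Q x)) \<and>
     (\<exists>L :: 'x \<Rightarrow> ('a \<Rightarrow>\<^sub>L real) set.
        continuous_bundle K k L \<and>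
        (\<forall>x\<in>K. {v. \<forall>l\<in>L x. blinfun_apply l v = 0} = Q x))"


primrec cocycle_iter ::
  "('x \<Rightarrow> 'x) \<Rightarrow> ('x \<Rightarrow> 'a \<Rightarrow>\<^sub>L 'a) \<Rightarrow> nat \<Rightarrow> 'x \<Rightarrow> ('a::real_normed_vector \<Rightarrow>\<^sub>L 'a)" where
  "cocycle_iter F T 0 x = id_blinfun"
| "cocycle_iter F T (Suc n) x = T ((F ^^ n) x) o\<^sub>L cocycle_iter F T n x"

definition strongly_invariant ::
  "'x set \<Rightarrow> ('x \<Rightarrow> 'a \<Rightarrow>\<^sub>L 'a) \<Rightarrow> nat \<Rightarrow> (nat \<Rightarrow> 'a::real_normed_vector set) \<Rightarrow> bool" where
  "strongly_invariant K T N C \<longleftrightarrow>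
     (\<forall>x\<in>K. \<forall>i\<le>N. blinfun_apply (T x) ` (C i - {0}) \<subseteq> interior (C i))"


(* Every vector is uniquely p 0 + ... + p N + q with p i in P i and q in Q. *)
definition direct_sum_decomp ::
  "nat \<Rightarrow> (nat \<Rightarrow> 'a::real_vector set) \<Rightarrow> 'a set \<Rightarrow> bool" where
  "direct_sum_decomp N P Q \<longleftrightarrow>
     bij_betw (\<lambda>(p, q). (\<Sum>i\<le>N. p i) + q) ((\<Pi>\<^sub>E i\<in>{..N}. P i) \<times> Q) UNIV"

definition bundles_invariant ::
  "'x set \<Rightarrow> ('x \<Rightarrow> 'x) \<Rightarrow> ('x \<Rightarrow> 'a \<Rightarrow>\<^sub>L 'a) \<Rightarrow> nat \<Rightarrow>
   (nat \<Rightarrow> 'x \<Rightarrow> 'a::real_normed_vector set) \<Rightarrow> ('x \<Rightarrow> 'a set) \<Rightarrow> bool" where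
  "bundles_invariant K F T N P Q \<longleftrightarrow>
     (\<forall>x\<in>K. (\<forall>i\<le>N. blinfun_apply (T x) ` P i x = P i (F x)) \<and>
             blinfun_apply (T x) ` Q x \<subseteq> Q (F x))"

definition quasi_all_invariant_decomposition ::
  "'x::topological_space set \<Rightarrow> ('x \<Rightarrow> 'x) \<Rightarrow> ('x \<Rightarrow> 'a \<Rightarrow>\<^sub>L 'a) \<Rightarrow> nat \<Rightarrow> (nat \<Rightarrow> nat) \<Rightarrow>
   (nat \<Rightarrow> 'x \<Rightarrow> 'a::real_normed_vector set) \<Rightarrow> ('x \<Rightarrow> 'a set) \<Rightarrow> bool" where
  "quasi_all_invariant_decomposition K F T N j P Q \<longleftrightarrow>
     (\<forall>i\<le>N. continuous_bundle K (j i) (P i)) \<and>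
     codim_continuous_bundle K (\<Sum>l\<le>N. j l) Q \<and>
     (\<forall>x\<in>K. direct_sum_decomp N (\<lambda>i. P i x) (Q x)) \<and>
     bundles_invariant K F T N P Q"


definition log_ext :: "real \<Rightarrow> ereal" where
  "log_ext r = (if r \<le> 0 then -\<infinity> else ereal (ln r))"

definition min_expansion ::
  "('a::real_normed_vector \<Rightarrow>\<^sub>L 'b::real_normed_vector) \<Rightarrow> 'a set \<Rightarrow> real" where
  "min_expansion A P = (INF v\<in>P \<inter> sphere 0 1. norm (blinfun_apply A v))"

definition char_exponent ::
  "('x \<Rightarrow> 'x) \<Rightarrow> ('x \<Rightarrow> 'a \<Rightarrow>\<^sub>L 'a) \<Rightarrow> ('x \<Rightarrow> 'a::real_normed_vector set) \<Rightarrow> 'x \<Rightarrow> ereal" where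
  "char_exponent F T P x =
     limsup (\<lambda>n. ereal (1 / real n) * log_ext (min_expansion (cocycle_iter F T n x) (P x)))"

end

theory Submission
  imports Defs
begin

text \<open>For a single cone \<open>C\<close> of rank \<open>k\<close>, fix a \<open>k\<close>-dimensional \<open>H\<close> with \<open>H - {0}\<close> inside
  \<open>interior C\<close>. Subspaces that complement \<open>H\<close> and meet \<open>C\<close> only in \<open>0\<close> are encoded by their
  projections onto \<open>H\<close>; they are uniformly transverse to \<open>H\<close> and are pulled back by the
  cocycle. Compactness of the operators gives an exponential domination of the pulled-back
  complements by the images of \<open>H\<close>. Hence the pulled-back complements and the pushed-forward
  images of \<open>H\<close> converge uniformly, which yields an invariant dominated splitting into
  continuous bundles. Two dominated splittings of different dimensions are nested, by comparing
  growth rates forwards for the kernels and backwards for the ranges; no inclusion between the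
  cones is needed. The bundles of the theorem are the ranges of the differences of consecutive
  projections.\<close>

subsection \<open>Finite-dimensional subspaces\<close>

text \<open>Two difficulties shape the argument. The unit sphere of a cone is not compact, so
  mapping \<open>C - {0}\<close> into \<open>interior C\<close> gives no uniform margin; a margin
  exists only on the compact unit sphere of \<open>H\<close> and on images \<open>T y u\<close> of
  bounded vectors that stay away from \<open>0\<close>. Hence the estimates observe a vector one or
  two steps late and compare it with its component in \<open>H\<close>, not with its own norm.
  Second, neither bundle is given in advance. Encoding a complement of \<open>H\<close> by the
  projection onto \<open>H\<close> along it turns convergence of subspaces into convergence in a
  Banach space of operators, and everything to be inverted is a map on the finite-dimensional
  \<open>H\<close> with a lower bound. The kernels come first, because they depend only on the
  future; the ranges are then built from the past along the limit kernels, so that all approximating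
  projections already have the right kernel and differ only in their range. The constant \<gamma> of
  (v) for index \<open>i\<close> is the domination rate of the splitting obtained from
  \<open>C i\<close>.\<close>

lemma closed_if_bounded_seq_subconverges:
  fixes S :: "'a::real_normed_vector set"
  assumes "\<And>u c. (\<And>n::nat. u n \<in> S) \<Longrightarrow> (\<And>n. norm (u n) \<le> c) \<Longrightarrow>
    \<exists>l r. l \<in> S \<and> strict_mono r \<and> (u \<circ> r) \<longlonglongrightarrow> l"
  shows "closed S"
proof (subst closed_sequential_limits, intro allI impI, elim conjE)
  fix x l assume x: "\<forall>n. x n \<in> S" and l: "x \<longlonglongrightarrow> l"
  obtain c where "\<And>n. norm (x n) \<le> c"
    using convergent_imp_Bseq[of x] l unfolding Bseq_def convergent_def by blast
  with x assms[of x c] obtain l' r where "l' \<in> S" "strict_mono r" "(x \<circ> r) \<longlonglongrightarrow> l'"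
    by blast
  with LIMSEQ_subseq_LIMSEQ[OF l] LIMSEQ_unique show "l \<in> S" by blast
qed

text \<open>Induction on the spanning set. The induction hypothesis already makes
  \<open>span B\<close> closed, so a new vector \<open>b\<close> outside it has a positive distance
  \<open>d\<close> to it; this bounds the coefficients of \<open>b\<close> by \<open>c / d\<close>,
  and a convergent subsequence of them can be split off.\<close>

lemma bounded_seq_in_finite_span:
  fixes B :: "'a::real_normed_vector set"
  assumes "finite B" and "\<And>n::nat. u n \<in> span B" and "\<And>n. norm (u n) \<le> c"
  shows "\<exists>l r. l \<in> span B \<and> strict_mono r \<and> (u \<circ> r) \<longlonglongrightarrow> l"
  using assms
proof (induction B arbitrary: u c rule: finite_induct)
  case empty
  then have "u = (\<lambda>_. 0)" by auto
  then show ?case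
    by (intro exI[of _ 0] exI[of _ id]) (auto simp: strict_mono_def)
next
  case (insert b B)
  show ?case
  proof (cases "b \<in> span B")
    case True
    then show ?thesis using insert.IH[of u c] insert.prems span_redundant[of b B] by auto
  next
    case False
    have "closed (span B)"
      by (rule closed_if_bounded_seq_subconverges) (rule insert.IH)
    then obtain d where d: "d > 0" "\<And>w. w \<in> span B \<Longrightarrow> d \<le> dist b w"
      using False span_zero[of B] infdist_pos_not_in_closed[of "span B" b] infdist_le[of _ "span B" b]
      by (metis empty_iff)
    have "\<exists>t. u n - t *\<^sub>R b \<in> span B" for n
      using insert.prems(1)[of n] span_breakdown_eq by blast
    then obtain t where t: "\<And>n. u n - t n *\<^sub>R b \<in> span B" by metis
    have tb: "\<bar>t n\<bar> * d \<le> c" for n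
    proof (cases "t n = 0")
      case True
      then show ?thesis using order_trans[OF norm_ge_zero insert.prems(2)[of n]] by simp
    next
      case False
      define w where "w = (- (1 / t n)) *\<^sub>R (u n - t n *\<^sub>R b)"
      have "w \<in> span B" unfolding w_def by (intro span_mul t)
      moreover have "b - w = (1 / t n) *\<^sub>R u n"
        using False by (simp add: w_def algebra_simps)
      ultimately have "d \<le> norm (u n) / \<bar>t n\<bar>"
        using d(2)[of w] by (simp add: dist_norm)
      then show ?thesis
        using False insert.prems(2)[of n] by (simp add: pos_le_divide_eq mult.commute)
    qed
    have tb': "t n \<in> cball 0 (c / d)" for n
      using tb[of n] d(1) by (simp add: pos_le_divide_eq)
    then obtain t0 r1 where r1: "strict_mono r1" "(t \<circ> r1) \<longlonglongrightarrow> t0"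
      using compact_cball[of "0::real" "c/d"] unfolding compact_def by meson
    define w where "w n = u (r1 n) - t (r1 n) *\<^sub>R b" for n
    have wb: "norm (w n) \<le> c + (c/d) * norm b" for n
    proof -
      have "norm (w n) \<le> norm (u (r1 n)) + norm (t (r1 n) *\<^sub>R b)"
        unfolding w_def by (rule norm_triangle_ineq4)
      also have "norm (t (r1 n) *\<^sub>R b) \<le> (c/d) * norm b"
        using mult_right_mono[OF _ norm_ge_zero, of "\<bar>t (r1 n)\<bar>" "c/d" b] tb'[of "r1 n"] by simp
      finally show ?thesis using insert.prems(2)[of "r1 n"] by linarith
    qed
    obtain l r2 where l: "l \<in> span B" "strict_mono r2" "(w \<circ> r2) \<longlonglongrightarrow> l"
      using insert.IH[of w, OF _ wb] t unfolding w_def by blast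
    have "(\<lambda>n. (w \<circ> r2) n + (t \<circ> r1 \<circ> r2) n *\<^sub>R b) \<longlonglongrightarrow> l + t0 *\<^sub>R b"
      by (intro tendsto_intros l LIMSEQ_subseq_LIMSEQ r1)
    then have "(u \<circ> (r1 \<circ> r2)) \<longlonglongrightarrow> l + t0 *\<^sub>R b"
      by (simp add: w_def o_def)
    moreover have "l + t0 *\<^sub>R b \<in> span (insert b B)"
      using l(1) by (metis add_diff_cancel_right' span_breakdown_eq)
    ultimately show ?thesis using r1(1) l(2) strict_mono_o by blast
  qed
qed

lemma closed_finite_span:
  fixes B :: "'a::real_normed_vector set"
  assumes "finite B"
  shows "closed (span B)"
  by (rule closed_if_bounded_seq_subconverges) (rule bounded_seq_in_finite_span[OF assms])

lemma span_eq_of_card_eq: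
  fixes S B :: "'a::real_vector set"
  assumes "finite B" "independent S" "S \<subseteq> span B" "card S = card B"
  shows "span S = span B"
proof (rule antisym)
  show "span S \<subseteq> span B" using assms(3) span_minimal by blast
  have fS: "finite S" using independent_span_bound[OF assms(1-3)] by simp
  have "B \<subseteq> span S"
  proof
    fix v assume "v \<in> B"
    show "v \<in> span S"
    proof (rule ccontr)
      assume v: "v \<notin> span S"
      then have "independent (insert v S)" "v \<notin> S" using assms(2) independent_insertI span_base by auto
      moreover have "insert v S \<subseteq> span B" using \<open>v \<in> B\<close> assms(3) by (simp add: span_base)
      ultimately have "card (insert v S) \<le> card B" using independent_span_bound[OF assms(1)] by blast
      with fS \<open>v \<notin> S\<close> assms(4) show False by simp
    qed
  qed
  then show "span B \<subseteq> span S" using span_minimal by blast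
qed

lemma k_dimensional_subspace: "k_dimensional k V \<Longrightarrow> subspace V"
  unfolding k_dimensional_def by auto

lemma k_dimensional_closed: "k_dimensional k V \<Longrightarrow> closed V"
  for V :: "'a::real_normed_vector set"
  unfolding k_dimensional_def using closed_finite_span by auto

lemma k_dimensional_compact_sphere:
  fixes V :: "'a::real_normed_vector set"
  assumes "k_dimensional k V"
  shows "compact (V \<inter> sphere 0 1)"
  unfolding compact_def
proof (intro allI impI)
  fix f :: "nat \<Rightarrow> 'a" assume f: "\<forall>n. f n \<in> V \<inter> sphere 0 1"
  obtain B where B: "finite B" "span B = V" using assms unfolding k_dimensional_def by auto
  obtain l r where l: "l \<in> V" "strict_mono r" "(f \<circ> r) \<longlonglongrightarrow> l"
    using bounded_seq_in_finite_span[OF B(1), of f 1] f B(2) by auto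
  have "(\<lambda>n. norm ((f \<circ> r) n)) \<longlonglongrightarrow> norm l" by (intro tendsto_intros l)
  then have "(\<lambda>_. 1) \<longlonglongrightarrow> norm l" using f by (simp add: o_def)
  then have "norm l = 1" by (metis LIMSEQ_unique tendsto_const)
  then show "\<exists>l\<in>V \<inter> sphere 0 1. \<exists>r. strict_mono r \<and> (f \<circ> r) \<longlonglongrightarrow> l"
    using l by auto
qed

lemma k_dimensional_mono:
  assumes "k_dimensional k V" "k_dimensional m W" "V \<subseteq> W"
  shows "k \<le> m"
proof -
  obtain A where A: "finite A" "card A = k" "independent A" "span A = V"
    using assms(1) unfolding k_dimensional_def by blast
  obtain B where B: "finite B" "card B = m" "independent B" "span B = W"
    using assms(2) unfolding k_dimensional_def by blast
  show ?thesis
    using independent_span_bound[of B A] A B assms(3) by (metis span_superset subset_trans)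
qed

lemma k_dimensional_unique:
  "k_dimensional k V \<Longrightarrow> k_dimensional m V \<Longrightarrow> k = m"
  by (meson antisym order_refl k_dimensional_mono)

lemma k_dimensional_eqI:
  assumes "k_dimensional k V" "k_dimensional k W" "V \<subseteq> W"
  shows "V = W"
proof -
  obtain A where A: "finite A" "card A = k" "independent A" "span A = V"
    using assms(1) unfolding k_dimensional_def by blast
  obtain B where B: "finite B" "card B = k" "independent B" "span B = W"
    using assms(2) unfolding k_dimensional_def by blast
  show ?thesis
    using span_eq_of_card_eq[of B A] A B assms(3) by (metis span_superset subset_trans)
qed

lemma k_dimensional_subset:
  assumes "k_dimensional k W" "subspace V" "V \<subseteq> W"
  shows "\<exists>m\<le>k. k_dimensional m V"
proof -
  obtain B where B: "finite B" "card B = k" "independent B" "span B = W"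
    using assms(1) unfolding k_dimensional_def by blast
  obtain A where A: "A \<subseteq> V" "independent A" "V \<subseteq> span A"
    using maximal_independent_subset by blast
  have "finite A \<and> card A \<le> k"
    using independent_span_bound[of B A] A B assms(3) by blast
  moreover have "span A = V" using A assms(2) span_minimal by blast
  ultimately show ?thesis using A(2) unfolding k_dimensional_def by blast
qed

lemma k_dimensional_linear_image:
  assumes "k_dimensional k V" "linear f" "\<And>v. v \<in> V \<Longrightarrow> f v = 0 \<Longrightarrow> v = 0"
  shows "k_dimensional k (f ` V)"
proof -
  obtain B where B: "finite B" "card B = k" "independent B" "span B = V"
    using assms(1) unfolding k_dimensional_def by blast
  have inj: "inj_on f (span B)"
  proof (rule inj_onI)
    fix x y assume xy: "x \<in> span B" "y \<in> span B" "f x = f y"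
    have "x - y \<in> V" using xy B(4) span_diff by blast
    moreover have "f (x - y) = 0" using xy(3) assms(2) by (simp add: linear_diff)
    ultimately show "x = y" using assms(3) by fastforce
  qed
  then have "independent (f ` B)"
    using linear_independent_injective_image[OF assms(2) B(3)] by blast
  moreover have "card (f ` B) = k"
    using card_image[OF inj_on_subset[OF inj span_superset]] B(2) by simp
  moreover have "span (f ` B) = f ` V"
    using B(4) linear_span_image[OF assms(2)] by blast
  ultimately show ?thesis using B(1) unfolding k_dimensional_def by blast
qed

lemma k_dimensional_sum:
  assumes "k_dimensional a U" "k_dimensional b V" "U \<inter> V = {0}"
  shows "k_dimensional (a + b) {u + v |u v. u \<in> U \<and> v \<in> V}"
proof -
  obtain A where A: "finite A" "card A = a" "independent A" "span A = U"
    using assms(1) unfolding k_dimensional_def by blast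
  obtain B where B: "finite B" "card B = b" "independent B" "span B = V"
    using assms(2) unfolding k_dimensional_def by blast
  have dis: "A \<inter> B = {}"
  proof (rule ccontr)
    assume "A \<inter> B \<noteq> {}"
    then obtain x where x: "x \<in> A" "x \<in> B" by blast
    then have "x \<in> U \<inter> V" using A(4) B(4) span_base by blast
    then have "x = 0" using assms(3) by blast
    then show False using x A(3) dependent_zero by blast
  qed
  have "independent (A \<union> B)"
  proof -
    have "u v = 0" if eq: "(\<Sum>v\<in>A\<union>B. u v *\<^sub>R v) = 0" and "v \<in> A \<union> B" for u v
    proof -
      let ?s = "\<lambda>X. \<Sum>v\<in>X. u v *\<^sub>R v"
      have "?s A + ?s B = 0" using eq dis A(1) B(1) by (simp add: sum.union_disjoint)
      then have e: "?s A = - ?s B" by (simp add: eq_neg_iff_add_eq_0)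
      have sA: "?s A \<in> U" unfolding A(4)[symmetric] by (intro span_sum span_scale span_base)
      have sB: "?s B \<in> V" unfolding B(4)[symmetric] by (intro span_sum span_scale span_base)
      have "?s A \<in> V" unfolding e using sB B(4) span_neg by blast
      then have "?s A = 0" using sA assms(3) by blast
      moreover have "?s B = 0" using e \<open>?s A = 0\<close> by simp
      ultimately show ?thesis
        using independentD[OF A(3) A(1) subset_refl, of u v] independentD[OF B(3) B(1) subset_refl, of u v] that(2)
        by auto
    qed
    moreover have "finite (A \<union> B)" using A B by simp
    ultimately show ?thesis using dependent_finite[of "A \<union> B"] by metis
  qed
  moreover have "span (A \<union> B) = {u + v |u v. u \<in> U \<and> v \<in> V}"
    using A(4) B(4) span_Un[of A B] by auto
  ultimately show ?thesis
    unfolding k_dimensional_def using A B dis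
    by (intro exI[of _ "A \<union> B"]) (simp add: card_Un_disjoint)
qed

lemma k_dimensional_0: "k_dimensional 0 V \<longleftrightarrow> V = {0}"
  unfolding k_dimensional_def by (auto simp: independent_empty intro!: exI[of _ "{}"])

lemma finite_dim_linear_bij:
  assumes "k_dimensional k V" "linear f" "\<And>v. v \<in> V \<Longrightarrow> f v \<in> V"
    "\<And>v. v \<in> V \<Longrightarrow> f v = 0 \<Longrightarrow> v = 0"
  shows "f ` V = V"
  using k_dimensional_eqI[OF k_dimensional_linear_image[OF assms(1,2,4)] assms(1)] assms(3) by blast

subsection \<open>Continuous families of operators\<close>

text \<open>On the finite-dimensional \<open>H\<close> the lower bound makes \<open>A\<close>
  injective, hence bijective, and it bounds the solution operator by \<open>norm R / c\<close>. The
  pullback of a projection \<open>s\<close> is the case where \<open>A\<close> and \<open>R\<close>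
  both are \<open>s\<close> after an iterate of the cocycle.\<close>

lemma solve_on_finite_dim:
  fixes A R :: "'a::real_normed_vector \<Rightarrow>\<^sub>L 'a"
  assumes H: "k_dimensional k H" and AH: "\<And>h. h \<in> H \<Longrightarrow> A h \<in> H" and c: "c > 0"
    and low: "\<And>h. h \<in> H \<Longrightarrow> c * norm h \<le> norm (A h)" and R: "\<And>u. R u \<in> H"
  shows "\<exists>Z :: 'a \<Rightarrow>\<^sub>L 'a. \<forall>u. Z u \<in> H \<and> A (Z u) = R u"
proof -
  have sub: "subspace H" using H by (rule k_dimensional_subspace)
  have zero: "h = 0" if "h \<in> H" "A h = 0" for h
    using low[OF that(1)] that(2) c by (simp add: mult_le_0_iff)
  have "blinfun_apply A ` H = H"
    by (rule finite_dim_linear_bij[OF H _ AH zero])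
      (auto intro: bounded_linear.linear blinfun.bounded_linear_right)
  then have "\<forall>u. \<exists>h. h \<in> H \<and> A h = R u" using R by (metis imageE)
  from choice[OF this] obtain z where z: "\<And>u. z u \<in> H" "\<And>u. A (z u) = R u" by auto
  have uniq: "h = h'" if "h \<in> H" "h' \<in> H" "A h = A h'" for h h'
  proof -
    have "A (h - h') = 0" using that by (simp add: blinfun.diff_right)
    then show ?thesis using zero[OF subspace_diff[OF sub that(1,2)]] by simp
  qed
  have "bounded_linear z"
  proof (rule bounded_linear_intro[where K = "norm R / c"])
    show "z (u + v) = z u + z v" for u v
      by (rule uniq) (simp_all add: z sub subspace_add blinfun.add_right)
    show "z (r *\<^sub>R u) = r *\<^sub>R z u" for r u
      by (rule uniq) (simp_all add: z sub subspace_scale blinfun.scaleR_right)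
    show "norm (z u) \<le> norm u * (norm R / c)" for u
      using order_trans[OF low[OF z(1)[of u]], of "norm R * norm u"] norm_blinfun[of R u] c z(2)
      by (simp add: field_simps)
  qed
  then show ?thesis using z by (intro exI[of _ "Blinfun z"]) (simp add: bounded_linear_Blinfun_apply)
qed

text \<open>The difference of two solutions satisfies
  \<open>A x ((Z x - Z y) u) = (R x - R y) u - (A x - A y) (Z y u)\<close>, so a lower bound
  \<open>c\<close> that is uniform in \<open>x\<close> carries continuity of the data over to the
  solution, in operator norm.\<close>

lemma solution_continuous:
  fixes A R Z :: "'x::topological_space \<Rightarrow> 'a::real_normed_vector \<Rightarrow>\<^sub>L 'a"
  assumes contA: "continuous_on K A" and contR: "continuous_on K R" and c: "c > 0" and H: "subspace H"
    and low: "\<And>x h. x \<in> K \<Longrightarrow> h \<in> H \<Longrightarrow> c * norm h \<le> norm (A x h)"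
    and Z: "\<And>x u. x \<in> K \<Longrightarrow> Z x u \<in> H" "\<And>x u. x \<in> K \<Longrightarrow> A x (Z x u) = R x u"
  shows "continuous_on K Z"
  unfolding continuous_on_def
proof
  fix y assume y: "y \<in> K"
  define e where "e x = (norm (R x - R y) + norm (A x - A y) * norm (Z y)) / c" for x
  have e0: "e x \<ge> 0" for x unfolding e_def using c by (simp add: add_nonneg_nonneg)
  have "(e \<longlongrightarrow> (norm (R y - R y) + norm (A y - A y) * norm (Z y)) / c) (at y within K)"
    unfolding e_def using contA contR y c
    by (intro tendsto_intros) (auto simp: continuous_on_def)
  then have lim: "(e \<longlongrightarrow> 0) (at y within K)" by simp
  have "norm (Z x - Z y) \<le> e x" if x: "x \<in> K" for x
  proof (rule norm_blinfun_bound[OF e0])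
    fix u
    have "c * norm ((Z x - Z y) u) \<le> norm (A x ((Z x - Z y) u))"
      using Z(1)[OF x] Z(1)[OF y] H low[OF x] by (simp add: blinfun.diff_left subspace_diff)
    also have "A x ((Z x - Z y) u) = (R x - R y) u - (A x - A y) (Z y u)"
      using Z(2)[OF x, of u] Z(2)[OF y, of u] by (simp add: blinfun.diff_left blinfun.diff_right)
    also have "norm \<dots> \<le> norm ((R x - R y) u) + norm ((A x - A y) (Z y u))"
      by (rule norm_triangle_ineq4)
    also have "\<dots> \<le> norm (R x - R y) * norm u + norm (A x - A y) * (norm (Z y) * norm u)"
      by (intro add_mono norm_blinfun order_trans[OF norm_blinfun[of "A x - A y"]] mult_left_mono) auto
    also have "\<dots> = c * (e x * norm u)" unfolding e_def using c by (simp add: field_simps)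
    finally show "norm ((Z x - Z y) u) \<le> e x * norm u" using c by simp
  qed
  then have "\<forall>\<^sub>F x in at y within K. norm (Z x - Z y) \<le> e x"
    by (auto simp: eventually_at_filter)
  then show "(Z \<longlongrightarrow> Z y) (at y within K)"
    by (subst tendsto_dist_iff) (auto intro: Lim_null_comparison[OF _ lim] simp: dist_norm)
qed

lemma geometric_limit:
  fixes f :: "nat \<Rightarrow> 'x::topological_space \<Rightarrow> 'b::banach"
  assumes cont: "\<And>n. continuous_on K (f n)" and g: "0 < g" "g < 1"
    and est: "\<And>x n j. x \<in> K \<Longrightarrow> norm (f (n + j) x - f n x) \<le> Q * g ^ n"
  shows "\<exists>l. continuous_on K l \<and> (\<forall>x\<in>K. (\<lambda>n. f n x) \<longlonglongrightarrow> l x)"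
proof -
  have lim: "(\<lambda>n. Q * g ^ n) \<longlonglongrightarrow> 0"
    using g by (intro tendsto_mult_right_zero LIMSEQ_realpow_zero) auto
  have "uniformly_Cauchy_on K f"
    unfolding uniformly_Cauchy_on_def
  proof (intro allI impI)
    fix e :: real assume "e > 0"
    then obtain n0 where n0: "\<And>n. n \<ge> n0 \<Longrightarrow> norm (Q * g ^ n) < e"
      using LIMSEQ_D[OF lim, of e] by auto
    have "dist (f m x) (f n x) < e" if "x \<in> K" "n \<ge> n0" "n \<le> m" for x m n
      using est[OF that(1), of n "m - n"] n0[OF that(2)] that(3) by (simp add: dist_norm)
    then show "\<exists>M. \<forall>x\<in>K. \<forall>m\<ge>M. \<forall>n\<ge>M. dist (f m x) (f n x) < e"
      by (metis dist_commute nat_le_linear)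
  qed
  then obtain l where l: "uniform_limit K f l sequentially"
    using Cauchy_uniformly_convergent uniformly_convergent_on_def by blast
  then have "continuous_on K l"
    by (intro uniform_limit_theorem[OF _ l]) (auto simp: cont)
  moreover have "(\<lambda>n. f n x) \<longlonglongrightarrow> l x" if "x \<in> K" for x
    using tendsto_uniform_limitI[OF l that] .
  ultimately show ?thesis by auto
qed

lemma cocycle_iter_add:
  "cocycle_iter F T (n + m) x = cocycle_iter F T n ((F ^^ m) x) o\<^sub>L cocycle_iter F T m x"
  by (induction n) (auto simp: funpow_add intro!: blinfun_eqI)

lemma cocycle_iter_Suc_apply:
  "cocycle_iter F T (Suc n) x v = cocycle_iter F T n (F x) (T x v)"
  using cocycle_iter_add[of F T n 1 x] by simp

subsection \<open>A cocycle mapping a solid cone into its interior\<close>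

text \<open>The given complement of the cone enters only through the kernel of \<open>proj0\<close>.
  \<open>T_interior\<close> also demands \<open>T x v \<noteq> 0\<close>: this differs from strong
  invariance only when \<open>0\<close> is interior to \<open>C\<close>, which for a cone means that
  \<open>C\<close> is the whole space.\<close>

locale cone_cocycle =
  fixes K :: "'x::metric_space set"
    and F G :: "'x \<Rightarrow> 'x"
    and T :: "'x \<Rightarrow> 'a::banach \<Rightarrow>\<^sub>L 'a"
    and C H :: "'a set"
    and k :: nat
    and proj0 :: "'a \<Rightarrow>\<^sub>L 'a"
  assumes compact_K: "compact K"
    and homeo: "homeomorphism K K F G"
    and cont_T: "continuous_on K T"
    and compact_T: "x \<in> K \<Longrightarrow> compact_operator (T x)"
    and closed_C: "closed C"
    and scale_C: "v \<in> C \<Longrightarrow> r *\<^sub>R v \<in> C"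
    and zero_C: "0 \<in> C"
    and dim_H: "k_dimensional k H"
    and H_interior: "H - {0} \<subseteq> interior C"
    and T_interior: "x \<in> K \<Longrightarrow> v \<in> C \<Longrightarrow> v \<noteq> 0 \<Longrightarrow> T x v \<in> interior C - {0}"
    and proj0_range: "proj0 u \<in> H"
    and proj0_id: "h \<in> H \<Longrightarrow> proj0 h = h"
    and proj0_ker: "v \<in> C \<Longrightarrow> proj0 v = 0 \<Longrightarrow> v = 0"
begin

abbreviation Tn where "Tn n x \<equiv> cocycle_iter F T n x"

text \<open>Admissible projections encode the complements \<open>ker s\<close> of \<open>H\<close> that avoid \<open>C - {0}\<close>.\<close>

definition adm :: "('a \<Rightarrow>\<^sub>L 'a) \<Rightarrow> bool" where
  "adm s \<longleftrightarrow> (\<forall>u. s u \<in> H) \<and> (\<forall>h\<in>H. s h = h) \<and> (\<forall>v\<in>C. s v = 0 \<longrightarrow> v = 0)"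

lemma adm_proj0: "adm proj0"
  unfolding adm_def using proj0_range proj0_id proj0_ker by blast

lemma adm_range: "adm s \<Longrightarrow> s u \<in> H"
  and adm_id: "adm s \<Longrightarrow> h \<in> H \<Longrightarrow> s h = h"
  and adm_ker: "adm s \<Longrightarrow> v \<in> C \<Longrightarrow> s v = 0 \<Longrightarrow> v = 0"
  unfolding adm_def by auto

lemma subspace_H: "subspace H"
  using dim_H by (rule k_dimensional_subspace)

lemma H_subset_C: "h \<in> H \<Longrightarrow> h \<in> C"
  using H_interior interior_subset zero_C by blast

lemma F_in: "x \<in> K \<Longrightarrow> F x \<in> K" and G_in: "x \<in> K \<Longrightarrow> G x \<in> K"
  and FG: "x \<in> K \<Longrightarrow> F (G x) = x" and GF: "x \<in> K \<Longrightarrow> G (F x) = x"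
  and cont_F: "continuous_on K F" and cont_G: "continuous_on K G"
  using homeo unfolding homeomorphism_def by auto

lemma Fn_in: "x \<in> K \<Longrightarrow> (F ^^ n) x \<in> K"
  by (induction n) (auto simp: F_in)

lemma Gn_in: "x \<in> K \<Longrightarrow> (G ^^ n) x \<in> K"
  by (induction n) (auto simp: G_in)

lemma Fn_Gn: "x \<in> K \<Longrightarrow> (F ^^ n) ((G ^^ n) x) = x"
proof (induction n)
  case (Suc n)
  have "(F ^^ Suc n) ((G ^^ Suc n) x) = (F ^^ n) (F (G ((G ^^ n) x)))"
    by (simp add: funpow_swap1)
  then show ?case using Suc FG[OF Gn_in[OF Suc.prems]] by simp
qed simp

lemma cont_funpow:
  assumes "continuous_on K f" "\<And>x. x \<in> K \<Longrightarrow> f x \<in> K"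
  shows "continuous_on K (f ^^ n)"
proof (induction n)
  case (Suc n)
  have "(f ^^ n) ` K \<subseteq> K" using assms(2) by (induction n) auto
  with Suc show ?case
    using continuous_on_compose2[OF assms(1) Suc] by (simp add: o_def)
qed (simp add: continuous_on_id id_def)

lemma Tn_cont: "continuous_on K (Tn n)"
proof (induction n)
  case (Suc n)
  have "continuous_on K (\<lambda>x. T ((F ^^ n) x))"
    by (rule continuous_on_compose2[OF cont_T cont_funpow[OF cont_F F_in]]) (auto simp: Fn_in)
  with Suc show ?case by (auto intro: continuous_intros)
qed simp

lemma T_cone: "x \<in> K \<Longrightarrow> v \<in> C - {0} \<Longrightarrow> T x v \<in> C - {0}"
  using T_interior interior_subset by blast

lemma Tn_cone: "x \<in> K \<Longrightarrow> v \<in> C - {0} \<Longrightarrow> Tn n x v \<in> C - {0}"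
proof (induction n)
  case (Suc n)
  then show ?case using T_cone[OF Fn_in[OF Suc.prems(1)]] by simp
qed simp

lemma Tn_C: "x \<in> K \<Longrightarrow> v \<in> C \<Longrightarrow> Tn n x v \<in> C"
  using Tn_cone[of x v n] zero_C by (cases "v = 0") auto

section \<open>Admissible complements: uniform transversality to \<open>H\<close> and
  pullback\<close>

lemma cone_neighbourhood: "\<exists>d>0. d \<le> 1 \<and> (\<forall>h\<in>H. \<forall>u. norm (u - h) \<le> d * norm h \<longrightarrow> u \<in> C)"
proof -
  have "H \<inter> sphere 0 1 \<subseteq> interior C" using H_interior by auto
  then obtain e where e: "e > 0" "(\<Union>x\<in>H \<inter> sphere 0 1. ball x e) \<subseteq> interior C"
    using compact_subset_open_imp_ball_epsilon_subset[OF k_dimensional_compact_sphere[OF dim_H] open_interior] by metis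
  \<comment> \<open>Halving turns the non-strict bound into membership in the open ball; the cap
    \<open>1\<close> serves later, where \<open>norm f \<le> d * norm h\<close> has to give
    \<open>norm f \<le> norm h\<close>.\<close>
  define d where "d = min 1 (e / 2)"
  have "u \<in> C" if h: "h \<in> H" and u: "norm (u - h) \<le> d * norm h" for h u
  proof (cases "h = 0")
    case True
    then show ?thesis using u zero_C by simp
  next
    case False
    define a where "a = 1 / norm h"
    have "a *\<^sub>R h \<in> H \<inter> sphere 0 1"
      using h subspace_H False by (simp add: a_def subspace_scale)
    moreover have "norm (a *\<^sub>R u - a *\<^sub>R h) = a * norm (u - h)"
      unfolding scaleR_diff_right[symmetric] by (simp add: a_def)
    then have "norm (a *\<^sub>R u - a *\<^sub>R h) \<le> d"
      using u False by (simp add: a_def divide_le_eq)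
    then have "a *\<^sub>R u \<in> ball (a *\<^sub>R h) e"
      using e(1) by (simp add: d_def dist_norm norm_minus_commute)
    ultimately have "a *\<^sub>R u \<in> C" using e(2) interior_subset by blast
    then have "(norm h) *\<^sub>R (a *\<^sub>R u) \<in> C" by (rule scale_C)
    then show ?thesis using False by (simp add: a_def)
  qed
  then show ?thesis using e(1) by (intro exI[of _ d]) (auto simp: d_def)
qed

text \<open>If \<open>s u\<close> were much longer than \<open>u\<close>, then
  \<open>s u - u\<close> would be so close to \<open>s u \<in> H\<close> up to size that it lies in
  \<open>C\<close>; but \<open>s\<close> annihilates it. The bound depends only on the neighbourhood
  of \<open>H\<close> inside \<open>C\<close>, hence is the same for every admissible
  \<open>s\<close>.\<close>

lemma adm_bound: "\<exists>B\<ge>1. \<forall>s u. adm s \<longrightarrow> norm (s u) \<le> B * norm u"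
proof -
  obtain d where d: "d > 0" "d \<le> 1" and C: "\<And>h u. h \<in> H \<Longrightarrow> norm (u - h) \<le> d * norm h \<Longrightarrow> u \<in> C"
    using cone_neighbourhood by blast
  have "norm (s u) \<le> (1 / d) * norm u" if s: "adm s" for s u
  proof (rule ccontr)
    assume neg: "\<not> ?thesis"
    then have lt: "norm u < d * norm (s u)" using d by (simp add: field_simps)
    have "s u - u \<in> C"
      by (rule C[OF adm_range[OF s, of u]]) (use lt in simp)
    moreover have "s (s u - u) = 0" using adm_id[OF s adm_range[OF s, of u]] by (simp add: blinfun.diff_right)
    ultimately have "s u = u" using adm_ker[OF s, of "s u - u"] by simp
    with lt d(2) mult_right_mono[of d 1 "norm u"] show False by simp
  qed
  then show ?thesis using d by (intro exI[of _ "1/d"]) auto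
qed

text \<open>The images \<open>T x h\<close> of unit vectors of \<open>H\<close> form a compact
  subset of \<open>interior C - {0}\<close>. If \<open>s (T x h)\<close> were shorter than the
  margin \<open>e\<close>, then \<open>T x h - s (T x h)\<close> would still be in
  \<open>interior C - {0}\<close>, although it lies in the kernel of \<open>s\<close>.\<close>

lemma adm_T_lower:
  "\<exists>c>0. \<forall>x\<in>K. \<forall>s. adm s \<longrightarrow> (\<forall>h\<in>H. c * norm h \<le> norm (s (T x h)))"
proof -
  let ?Z = "(\<lambda>(x, h). T x h) ` (K \<times> (H \<inter> sphere 0 1))"
  have "compact ?Z"
  proof (rule compact_continuous_image)
    show "continuous_on (K \<times> (H \<inter> sphere 0 1)) (\<lambda>(x, h). T x h)"
      unfolding case_prod_beta
      by (intro blinfun.continuous_on continuous_on_compose2[OF cont_T] continuous_intros) auto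
    show "compact (K \<times> (H \<inter> sphere 0 1))"
      by (intro compact_Times compact_K k_dimensional_compact_sphere[OF dim_H])
  qed
  moreover have "open (interior C - {0})" by auto
  moreover have "?Z \<subseteq> interior C - {0}"
    using T_interior H_subset_C by fastforce
  ultimately obtain e where e: "e > 0" "(\<Union>z\<in>?Z. ball z e) \<subseteq> interior C - {0}"
    using compact_subset_open_imp_ball_epsilon_subset by metis
  have unit: "e \<le> norm (s (T x h))" if x: "x \<in> K" and s: "adm s" and h: "h \<in> H" "norm h = 1" for x s h
  proof (rule ccontr)
    assume "\<not> ?thesis"
    then have "T x h - s (T x h) \<in> ball (T x h) e" by (simp add: dist_norm)
    then have "T x h - s (T x h) \<in> interior C - {0}"
      using e(2) x h by force
    moreover have "s (T x h - s (T x h)) = 0"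
      using adm_id[OF s adm_range[OF s]] by (simp add: blinfun.diff_right)
    ultimately show False using adm_ker[OF s] interior_subset by blast
  qed
  have "e * norm h \<le> norm (s (T x h))" if x: "x \<in> K" and s: "adm s" and h: "h \<in> H" for x s h
  proof (cases "h = 0")
    case False
    have "e \<le> norm (s (T x ((1 / norm h) *\<^sub>R h)))"
      using False h subspace_H by (intro unit x s) (auto simp: subspace_scale)
    then show ?thesis using False by (simp add: blinfun.scaleR_right pos_le_divide_eq)
  qed simp
  with e(1) show ?thesis by blast
qed

text \<open>The kernel of \<open>s'\<close> is the preimage of the kernel of \<open>s\<close> under
  the iterate; it meets \<open>C\<close> only in \<open>0\<close> because the iterate maps
  \<open>C - {0}\<close> into itself. The lower bound is an assumption here since its proof for
  \<open>n + 1\<close> steps itself pulls \<open>s\<close> back through \<open>n\<close>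
  steps.\<close>

lemma pullback_aux:
  assumes x: "x \<in> K" and s: "adm s" and c: "c > 0"
    and low: "\<And>h. h \<in> H \<Longrightarrow> c * norm h \<le> norm (s (Tn n x h))"
  shows "\<exists>s'. adm s' \<and> (\<forall>u. s (Tn n x (s' u)) = s (Tn n x u))"
proof -
  obtain Z :: "'a \<Rightarrow>\<^sub>L 'a" where Z: "\<And>u. Z u \<in> H" "\<And>u. s (Tn n x (Z u)) = s (Tn n x u)"
    using solve_on_finite_dim[of k H "s o\<^sub>L Tn n x" c "s o\<^sub>L Tn n x"] dim_H low c adm_range[OF s] by auto
  have "adm Z"
    unfolding adm_def
  proof (intro conjI allI ballI impI)
    fix h assume h: "h \<in> H"
    have "c * norm (Z h - h) \<le> norm (s (Tn n x (Z h - h)))"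
      by (rule low) (use Z h subspace_H in \<open>simp add: subspace_diff\<close>)
    then show "Z h = h" using Z(2)[of h] c by (simp add: blinfun.diff_right mult_le_0_iff)
  next
    fix v assume v: "v \<in> C" "Z v = 0"
    then have "s (Tn n x v) = 0" using Z(2)[of v] by simp
    then have "Tn n x v = 0" using adm_ker[OF s] Tn_C[OF x v(1)] by blast
    then show "v = 0" using Tn_cone[OF x] v(1) by blast
  qed (rule Z)
  with Z show ?thesis by blast
qed

lemma adm_Tn_lower:
  "\<exists>c>0. \<forall>n. \<forall>x\<in>K. \<forall>s. adm s \<longrightarrow> (\<forall>h\<in>H. c ^ n * norm h \<le> norm (s (Tn n x h)))"
proof -
  obtain c where c: "c > 0" and low: "\<And>x s h. x \<in> K \<Longrightarrow> adm s \<Longrightarrow> h \<in> H \<Longrightarrow> c * norm h \<le> norm (s (T x h))"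
    using adm_T_lower by blast
  have "c ^ n * norm h \<le> norm (s (Tn n x h))" if "x \<in> K" "adm s" "h \<in> H" for n x s h
    using that
  proof (induction n arbitrary: x h)
    case 0
    then show ?case using adm_id[of s h] by simp
  next
    case (Suc n)
    have cn: "c ^ n > 0" using c by simp
    \<comment> \<open>Seen from \<open>F x\<close>, the last \<open>n\<close> steps together with
      \<open>s\<close> act as the admissible projection \<open>s'\<close>, so one more step costs
      one more factor \<open>c\<close>, always the same since it serves all admissible
      projections.\<close>
    obtain s' where s': "adm s'" "\<And>u. s (Tn n (F x) (s' u)) = s (Tn n (F x) u)"
      using pullback_aux[OF F_in[OF Suc.prems(1)] Suc.prems(2) cn] Suc.IH[OF F_in[OF Suc.prems(1)] Suc.prems(2)]
      by blast
    have "c ^ Suc n * norm h \<le> c ^ n * norm (s' (T x h))"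
      using low[OF Suc.prems(1) s'(1) Suc.prems(3)] cn by simp
    also have "\<dots> \<le> norm (s (Tn n (F x) (s' (T x h))))"
      using Suc.IH[OF F_in[OF Suc.prems(1)] Suc.prems(2) adm_range[OF s'(1)]] .
    finally show ?case unfolding cocycle_iter_Suc_apply s'(2) .
  qed
  with c show ?thesis by blast
qed

lemma Tn_inj_H:
  assumes "x \<in> K" "adm s" "h \<in> H" "h' \<in> H" "s (Tn n x h) = s (Tn n x h')"
  shows "h = h'"
proof -
  obtain c where "c > 0" "c ^ n * norm (h - h') \<le> norm (s (Tn n x (h - h')))"
    using adm_Tn_lower assms subspace_H by (meson subspace_diff)
  moreover have "\<not> c ^ n \<le> 0" using zero_less_power[OF \<open>c > 0\<close>, of n] by linarith
  ultimately show ?thesis using assms(5) by (simp add: blinfun.diff_right mult_le_0_iff)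
qed

lemma pullback:
  assumes x: "x \<in> K" and s: "adm s"
  shows "\<exists>s'. adm s' \<and> (\<forall>u. s (Tn n x (s' u)) = s (Tn n x u))"
proof -
  obtain c where c: "c > 0" "\<And>h. h \<in> H \<Longrightarrow> c ^ n * norm h \<le> norm (s (Tn n x h))"
    using adm_Tn_lower x s by blast
  then show ?thesis using pullback_aux[OF x s, of "c ^ n"] by simp
qed

lemma pullback_ker:
  assumes "x \<in> K" "adm s" "adm s'" "\<And>u. s (Tn n x (s' u)) = s (Tn n x u)" "s (Tn n x u) = 0"
  shows "s' u = 0"
  by (rule Tn_inj_H[OF assms(1,2) adm_range[OF assms(3)], of _ n])
    (use assms subspace_H in \<open>auto simp: subspace_0\<close>)

section \<open>Compactness of the operators and exponential domination\<close>

lemma T_bound: "\<exists>t>0. \<forall>x\<in>K. \<forall>u. norm (T x u) \<le> t * norm u"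
proof -
  have "bounded (T ` K)"
    using compact_continuous_image[OF cont_T compact_K] compact_imp_bounded by blast
  then obtain t where t: "t > 0" "\<And>x. x \<in> K \<Longrightarrow> norm (T x) \<le> t"
    unfolding bounded_pos by auto
  then have "norm (T x u) \<le> t * norm u" if "x \<in> K" for x u
    using norm_blinfun[of "T x" u] mult_right_mono[OF t(2)[OF that] norm_ge_zero[of u]] by linarith
  with t(1) show ?thesis by blast
qed

text \<open>Each \<open>T x\<close> alone is compact, but the base points vary: a subsequence of
  them converges by compactness of \<open>K\<close>, and norm continuity of \<open>T\<close> makes
  it harmless to replace \<open>T (xs n)\<close> by the limit operator on bounded vectors.\<close>

lemma collective_compactness:
  assumes xs: "\<And>n::nat. xs n \<in> K" and us: "\<And>n. norm (us n) \<le> \<rho>"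
  shows "\<exists>r x y. strict_mono r \<and> x \<in> K \<and> (xs \<circ> r) \<longlonglongrightarrow> x \<and> (\<lambda>n. T (xs (r n)) (us (r n))) \<longlonglongrightarrow> y"
proof -
  obtain x r1 where x: "x \<in> K" "strict_mono r1" "(xs \<circ> r1) \<longlonglongrightarrow> x"
    using compact_K[unfolded compact_def, rule_format, of xs] xs by blast
  define b where "b = max \<rho> 1"
  have b: "b > 0" "norm (us n) \<le> b" for n using us[of n] by (auto simp: b_def)
  have cl: "\<forall>n. T x ((1 / b) *\<^sub>R us (r1 n)) \<in> closure (T x ` cball 0 1)"
    using b by (intro allI subsetD[OF closure_subset] imageI) simp
  have "compact (closure (T x ` cball 0 1))"
    using compact_T[OF x(1)] unfolding compact_operator_def .
  from this[unfolded compact_def, rule_format, of "\<lambda>n. T x ((1 / b) *\<^sub>R us (r1 n))"] cl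
  obtain y r2 where y: "strict_mono r2" "(\<lambda>n. T x ((1 / b) *\<^sub>R us (r1 (r2 n)))) \<longlonglongrightarrow> y"
    unfolding o_def by blast
  define r where "r = r1 \<circ> r2"
  have "(\<lambda>n. b *\<^sub>R T x ((1 / b) *\<^sub>R us (r1 (r2 n)))) \<longlonglongrightarrow> b *\<^sub>R y"
    by (intro tendsto_intros y)
  then have y': "(\<lambda>n. T x (us (r n))) \<longlonglongrightarrow> b *\<^sub>R y"
    using b by (simp add: r_def blinfun.scaleR_right)
  have xr: "(\<lambda>n. xs (r n)) \<longlonglongrightarrow> x"
    using LIMSEQ_subseq_LIMSEQ[OF x(3) y(1)] by (simp add: r_def o_def)
  have "(\<lambda>n. T (xs (r n))) \<longlonglongrightarrow> T x"
    by (rule continuous_on_tendsto_compose[OF cont_T xr x(1)]) (simp add: xs)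
  then have lim0: "(\<lambda>n. norm (T (xs (r n)) - T x) * b) \<longlonglongrightarrow> 0"
    using tendsto_mult_left_zero[OF tendsto_norm_zero[OF LIM_zero]] by blast
  have est: "norm (T (xs (r n)) (us (r n)) - T x (us (r n))) \<le> norm (T (xs (r n)) - T x) * b" for n
  proof -
    have "norm ((T (xs (r n)) - T x) (us (r n))) \<le> norm (T (xs (r n)) - T x) * norm (us (r n))"
      by (rule norm_blinfun)
    also have "\<dots> \<le> norm (T (xs (r n)) - T x) * b" by (intro mult_left_mono b) simp
    finally show ?thesis by (simp add: blinfun.diff_left)
  qed
  have "(\<lambda>n. T (xs (r n)) (us (r n)) - T x (us (r n))) \<longlonglongrightarrow> 0"
    by (intro Lim_null_comparison[OF _ lim0] always_eventually allI est)
  from tendsto_add[OF this y'] have "(\<lambda>n. T (xs (r n)) (us (r n))) \<longlonglongrightarrow> b *\<^sub>R y" by simp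
  moreover have "strict_mono r" unfolding r_def using x(2) y(1) by (rule strict_mono_o)
  ultimately show ?thesis using x(1) xr by (auto simp: o_def)
qed

text \<open>The cone need not be uniformly transverse to the kernel of an admissible projection:
  a vector of \<open>C\<close> can have an arbitrarily large kernel component. If this component \<open>g\<close> dominates,
  then by compactness \<open>T x g\<close> almost lies in \<open>C\<close>, and its image under one more step would lie
  in \<open>interior C\<close> unless \<open>T x g\<close> is small.\<close>

lemma kernel_component_step:
  assumes e: "e > 0"
  shows "\<exists>M\<ge>0. \<forall>x\<in>K. \<forall>b g. b + g \<in> C \<longrightarrow> T (F x) (T x g) \<notin> C - {0} \<longrightarrow>
    norm (T x g) \<le> e * norm g + M * norm b"
proof (rule ccontr)
  assume neg: "\<not> ?thesis"
  obtain t where t: "t > 0" "\<And>x u. x \<in> K \<Longrightarrow> norm (T x u) \<le> t * norm u"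
    using T_bound by blast
  have "\<exists>x b g. x \<in> K \<and> b + g \<in> C \<and> T (F x) (T x g) \<notin> C - {0} \<and>
      e * norm g + real n * norm b < norm (T x g)" for n :: nat
    using neg not_le by (metis of_nat_0_le_iff)
  then obtain x b g where xbg: "\<And>n::nat. x n \<in> K" "\<And>n::nat. b n + g n \<in> C"
      "\<And>n::nat. T (F (x n)) (T (x n) (g n)) \<notin> C - {0}"
      "\<And>n::nat. e * norm (g n) + real n * norm (b n) < norm (T (x n) (g n))"
    by metis
  have gn: "norm (g n) > 0" for n
  proof -
    have "0 \<le> e * norm (g n) + real n * norm (b n)" using e by simp
    then have "T (x n) (g n) \<noteq> 0" using xbg(4)[of n] by auto
    then show ?thesis by (auto simp: blinfun.zero_right)
  qed
  \<comment> \<open>After scaling to \<open>norm g = 1\<close>, the failing constant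
    \<open>M = n\<close> forces \<open>norm b\<close> below \<open>t / n\<close>. So the limit of
    \<open>T x g\<close> is also the limit of \<open>T x (b + g)\<close>, hence in \<open>C\<close>,
    and the margin \<open>e\<close> keeps it nonzero; one more step takes it into the interior,
    against \<open>T (F x) (T x g) \<notin> C - {0}\<close>.\<close>
  define a where "a n = 1 / norm (g n)" for n
  have a: "a n > 0" "a n * norm (g n) = 1" for n using gn[of n] by (auto simp: a_def)
  define g' where "g' n = a n *\<^sub>R g n" for n
  define b' where "b' n = a n *\<^sub>R b n" for n
  have g'1: "norm (g' n) = 1" for n using a[of n] by (simp add: g'_def)
  have C1: "b' n + g' n \<in> C" for n
    using scale_C[OF xbg(2)[of n], of "a n"] by (simp add: b'_def g'_def scaleR_add_right)
  have C2: "T (F (x n)) (T (x n) (g' n)) \<notin> C - {0}" for n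
  proof
    assume "T (F (x n)) (T (x n) (g' n)) \<in> C - {0}"
    then have "norm (g n) *\<^sub>R T (F (x n)) (T (x n) (g' n)) \<in> C - {0}" using scale_C gn[of n] by auto
    then show False using xbg(3)[of n] a[of n] gn[of n]
      by (simp add: g'_def blinfun.scaleR_right mult.commute)
  qed
  have est: "e + real n * norm (b' n) < norm (T (x n) (g' n))" for n
    using mult_strict_left_mono[OF xbg(4)[of n] a(1)[of n]] a[of n]
    by (simp add: g'_def b'_def blinfun.scaleR_right algebra_simps)
  have b't: "real n * norm (b' n) \<le> t" for n
    using est[of n] t(2)[OF xbg(1), of n "g' n"] g'1[of n] e by simp
  have b'lim: "b' \<longlonglongrightarrow> 0"
  proof (rule Lim_null_comparison)
    show "(\<lambda>n. t * (1 / real n)) \<longlonglongrightarrow> 0" by (intro tendsto_mult_right_zero lim_1_over_n)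
    have "norm (b' n) \<le> t * (1 / real n)" if "n > 0" for n
      using b't[of n] that by (simp add: field_simps)
    then show "\<forall>\<^sub>F n in sequentially. norm (b' n) \<le> t * (1 / real n)"
      using eventually_gt_at_top[of "0::nat"] by (rule eventually_mono[rotated])
  qed
  obtain r z y where r: "strict_mono r" "z \<in> K" "(x \<circ> r) \<longlonglongrightarrow> z" "(\<lambda>n. T (x (r n)) (g' (r n))) \<longlonglongrightarrow> y"
    using collective_compactness[of x g' 1] xbg(1) g'1 by auto
  have Tx: "(\<lambda>n. T (x (r n))) \<longlonglongrightarrow> T z"
    by (rule continuous_on_tendsto_compose[OF cont_T _ r(2)]) (use r(3) xbg(1) in \<open>auto simp: o_def\<close>)
  have Fx: "(\<lambda>n. F (x (r n))) \<longlonglongrightarrow> F z"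
    by (rule continuous_on_tendsto_compose[OF cont_F _ r(2)]) (use r(3) xbg(1) in \<open>auto simp: o_def\<close>)
  have TFx: "(\<lambda>n. T (F (x (r n)))) \<longlonglongrightarrow> T (F z)"
    by (rule continuous_on_tendsto_compose[OF cont_T Fx F_in[OF r(2)]]) (use F_in xbg(1) in auto)
  have b'r: "(\<lambda>n. b' (r n)) \<longlonglongrightarrow> 0"
    using LIMSEQ_subseq_LIMSEQ[OF b'lim r(1)] by (simp add: o_def)
  have "(\<lambda>n. T (x (r n)) (b' (r n)) + T (x (r n)) (g' (r n))) \<longlonglongrightarrow> T z 0 + y"
    by (intro tendsto_intros Tx b'r r(4))
  then have lim: "(\<lambda>n. T (x (r n)) (b' (r n)) + T (x (r n)) (g' (r n))) \<longlonglongrightarrow> y"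
    by (simp add: blinfun.zero_right)
  have "T (x (r n)) (b' (r n)) + T (x (r n)) (g' (r n)) \<in> C" for n
    using Tn_C[OF xbg(1)[of "r n"] C1[of "r n"], of 1] by (simp add: blinfun.add_right)
  then have "y \<in> C" by (intro closed_sequentially[OF closed_C _ lim])
  have "e \<le> norm y"
  proof (rule LIMSEQ_le_const[OF tendsto_norm[OF r(4)]], intro exI allI impI)
    fix n show "e \<le> norm (T (x (r n)) (g' (r n)))"
      using est[of "r n"] mult_nonneg_nonneg[OF of_nat_0_le_iff norm_ge_zero, of "r n" "b' (r n)"] by linarith
  qed
  then have "y \<noteq> 0" using e by auto
  then have "T (F z) y \<in> interior C - {0}"
    using T_interior[OF F_in[OF r(2)]] \<open>y \<in> C\<close> by blast
  moreover have "open (interior C - {0})" by auto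
  moreover have "(\<lambda>n. T (F (x (r n))) (T (x (r n)) (g' (r n)))) \<longlonglongrightarrow> T (F z) y"
    by (intro tendsto_intros TFx r(4))
  ultimately have "\<forall>\<^sub>F n in sequentially. T (F (x (r n))) (T (x (r n)) (g' (r n))) \<in> interior C - {0}"
    using topological_tendstoD by blast
  then obtain n where "T (F (x (r n))) (T (x (r n)) (g' (r n))) \<in> interior C - {0}"
    by (auto simp: eventually_sequentially)
  then show False using C2[of "r n"] interior_subset by blast
qed

text \<open>By contradiction, with factors \<open>lam\<close> tending to \<open>1\<close>.
  Compactness makes the points \<open>T y u + s *\<^sub>R T y u'\<close> subconverge; the limit is
  in \<open>C\<close>, and the bound \<open>\<beta>\<close> keeps it from \<open>0\<close>, so its
  next image is interior to \<open>C\<close> and a slightly longer segment fits as well. This margin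
  appears only after the next step, which is why the conclusion concerns
  \<open>T (F y)\<close>.\<close>

lemma segment_expansion:
  assumes b: "\<beta> > 0"
  shows "\<exists>lam>1. lam \<le> 2 \<and> (\<forall>y\<in>K. \<forall>u u'. norm u \<le> \<rho> \<longrightarrow> norm u' \<le> \<rho> \<longrightarrow>
    (\<forall>s. \<bar>s\<bar> \<le> 1 \<longrightarrow> T y (u + s *\<^sub>R u') \<in> C \<and> \<beta> \<le> norm (T y (u + s *\<^sub>R u'))) \<longrightarrow>
    (\<forall>s. \<bar>s\<bar> \<le> 1 \<longrightarrow> T (F y) (T y (u + (s * lam) *\<^sub>R u')) \<in> C))"
proof (rule ccontr)
  assume neg: "\<not> ?thesis"
  define lam where "lam n = 1 + 1 / real (Suc n)" for n
  have lam: "1 < lam n" "lam n \<le> 2" for n unfolding lam_def by (auto simp: field_simps)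
  have "\<exists>y u u' s. y \<in> K \<and> norm u \<le> \<rho> \<and> norm u' \<le> \<rho> \<and>
    (\<forall>s. \<bar>s\<bar> \<le> 1 \<longrightarrow> T y (u + s *\<^sub>R u') \<in> C \<and> \<beta> \<le> norm (T y (u + s *\<^sub>R u'))) \<and>
    \<bar>s\<bar> \<le> 1 \<and> T (F y) (T y (u + (s * lam n) *\<^sub>R u')) \<notin> C" for n
    using neg lam[of n] by blast
  then obtain y u u' s where y: "\<And>n. y n \<in> K" "\<And>n. norm (u n) \<le> \<rho>" "\<And>n. norm (u' n) \<le> \<rho>"
      "\<And>n s. \<bar>s\<bar> \<le> 1 \<Longrightarrow> T (y n) (u n + s *\<^sub>R u' n) \<in> C"
      "\<And>n s. \<bar>s\<bar> \<le> 1 \<Longrightarrow> \<beta> \<le> norm (T (y n) (u n + s *\<^sub>R u' n))"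
      "\<And>n. \<bar>s n\<bar> \<le> 1" "\<And>n. T (F (y n)) (T (y n) (u n + (s n * lam n) *\<^sub>R u' n)) \<notin> C"
    by metis
  obtain r1 z1 v where r1: "strict_mono r1" "(\<lambda>n. T (y (r1 n)) (u (r1 n))) \<longlonglongrightarrow> v"
    using collective_compactness[of y u \<rho>] y(1,2) by auto
  obtain r2 z v' where r2: "strict_mono r2" "z \<in> K" "(\<lambda>n. y (r1 (r2 n))) \<longlonglongrightarrow> z"
      "(\<lambda>n. T (y (r1 (r2 n))) (u' (r1 (r2 n)))) \<longlonglongrightarrow> v'"
    using collective_compactness[of "y \<circ> r1" "u' \<circ> r1" \<rho>] y(1,3) by (auto simp: o_def)
  have "\<forall>n. s (r1 (r2 n)) \<in> cball 0 1" using y(6) by simp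
  with compact_cball[of "0::real" 1, unfolded compact_def, rule_format, of "\<lambda>n. s (r1 (r2 n))"]
  obtain r3 s0 where r3: "strict_mono r3" "\<bar>s0\<bar> \<le> 1" "(\<lambda>n. s (r1 (r2 (r3 n)))) \<longlonglongrightarrow> s0"
    by (auto simp: o_def)
  define r where "r n = r1 (r2 (r3 n))" for n
  have r: "strict_mono r"
    using r1(1) r2(1) r3(1) by (simp add: r_def strict_mono_def)
  have lims: "(\<lambda>n. y (r n)) \<longlonglongrightarrow> z" "(\<lambda>n. T (y (r n)) (u (r n))) \<longlonglongrightarrow> v"
      "(\<lambda>n. T (y (r n)) (u' (r n))) \<longlonglongrightarrow> v'" "(\<lambda>n. s (r n)) \<longlonglongrightarrow> s0"
    using LIMSEQ_subseq_LIMSEQ[OF LIMSEQ_subseq_LIMSEQ[OF r1(2) r2(1)] r3(1)]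
      LIMSEQ_subseq_LIMSEQ[OF r2(3) r3(1)] LIMSEQ_subseq_LIMSEQ[OF r2(4) r3(1)] r3(3)
    by (auto simp: r_def o_def)
  have "lam \<longlonglongrightarrow> 1 + 0" unfolding lam_def by (intro tendsto_intros LIMSEQ_Suc lim_1_over_n)
  then have laml: "(\<lambda>n. lam (r n)) \<longlonglongrightarrow> 1" using LIMSEQ_subseq_LIMSEQ[OF _ r] by (fastforce simp: o_def)
  have "(\<lambda>n. T (y (r n)) (u (r n)) + s (r n) *\<^sub>R T (y (r n)) (u' (r n))) \<longlonglongrightarrow> v + s0 *\<^sub>R v'"
    by (intro tendsto_intros lims)
  then have lim: "(\<lambda>n. T (y (r n)) (u (r n) + s (r n) *\<^sub>R u' (r n))) \<longlonglongrightarrow> v + s0 *\<^sub>R v'"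
    by (simp add: blinfun.add_right blinfun.scaleR_right)
  have "v + s0 *\<^sub>R v' \<in> C"
    using closed_sequentially[OF closed_C _ lim] y(4)[OF y(6)] by blast
  moreover have "\<beta> \<le> norm (v + s0 *\<^sub>R v')"
    by (rule LIMSEQ_le_const[OF tendsto_norm[OF lim]]) (use y(5)[OF y(6)] in blast)
  ultimately have "T (F z) (v + s0 *\<^sub>R v') \<in> interior C"
    using T_interior[OF F_in[OF r2(2)]] b by force
  moreover have Fy: "(\<lambda>n. F (y (r n))) \<longlonglongrightarrow> F z"
    by (rule continuous_on_tendsto_compose[OF cont_F lims(1) r2(2)]) (use y(1) in auto)
  have "(\<lambda>n. T (F (y (r n)))) \<longlonglongrightarrow> T (F z)"
    by (rule continuous_on_tendsto_compose[OF cont_T Fy F_in[OF r2(2)]]) (use F_in y(1) in auto)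
  then have "(\<lambda>n. T (F (y (r n))) (T (y (r n)) (u (r n)) + (s (r n) * lam (r n)) *\<^sub>R T (y (r n)) (u' (r n))))
      \<longlonglongrightarrow> T (F z) (v + (s0 * 1) *\<^sub>R v')"
    by (intro tendsto_intros lims laml)
  ultimately have "\<forall>\<^sub>F n in sequentially. T (F (y (r n))) (T (y (r n)) (u (r n)) + (s (r n) * lam (r n)) *\<^sub>R T (y (r n)) (u' (r n))) \<in> interior C"
    using topological_tendstoD[OF _ open_interior] by force
  then obtain n where "T (F (y (r n))) (T (y (r n)) (u (r n)) + (s (r n) * lam (r n)) *\<^sub>R T (y (r n)) (u' (r n))) \<in> interior C"
    by (auto simp: eventually_sequentially)
  then show False using y(7)[of "r n"] interior_subset[of C] by (auto simp: blinfun.add_right blinfun.scaleR_right)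
qed

text \<open>Along an orbit, \<open>b\<close> and \<open>w = T y u'\<close> control a segment of vectors \<open>T y u + r w\<close>,
  \<open>\<bar>r\<bar> \<le> 1\<close>, inside \<open>C\<close>: \<open>b\<close> is the component in \<open>H\<close>, common to all of them. Each step maps the
  segment into \<open>interior C\<close>, so that it can be lengthened by the factor \<open>lam\<close>, while \<open>w\<close> stays
  bounded by a fixed multiple of \<open>b\<close>. Hence \<open>w\<close> decays exponentially relative to \<open>b\<close>.\<close>

lemma domination:
  "\<exists>R\<ge>1. \<exists>g. 0 < g \<and> g < 1 \<and> (\<forall>n. \<forall>x\<in>K. \<forall>s. adm s \<longrightarrow> (\<forall>h\<in>H.
     norm (Tn n x h) \<le> R * norm (s (Tn n x h)) \<and>
     (\<forall>f. s (Tn n x f) = 0 \<longrightarrow>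
        norm (Tn n x f) * norm h \<le> R * g ^ n * norm f * norm (s (Tn n x h)))))"
proof -
  obtain t where t: "t > 0" and T: "\<And>x u. x \<in> K \<Longrightarrow> norm (T x u) \<le> t * norm u"
    using T_bound by blast
  obtain B where B: "B \<ge> 1" and adm_le: "\<And>s u. adm s \<Longrightarrow> norm (s u) \<le> B * norm u"
    using adm_bound by blast
  obtain c where c: "c > 0"
    and low: "\<And>x s h. x \<in> K \<Longrightarrow> adm s \<Longrightarrow> h \<in> H \<Longrightarrow> c * norm h \<le> norm (s (T x h))"
    using adm_T_lower by blast
  obtain M where M: "M \<ge> 0" and step: "\<And>x b g. x \<in> K \<Longrightarrow> b + g \<in> C \<Longrightarrow> T (F x) (T x g) \<notin> C - {0} \<Longrightarrow>
      norm (T x g) \<le> (c / 8) * norm g + M * norm b"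
    using kernel_component_step[of "c/8"] c by auto
  \<comment> \<open>\<open>P\<close> bounds the kernel part of \<open>T x b\<close>.
    \<open>A\<close> is a slope that reproduces itself: by \<open>step\<close>, a kernel part of
    size at most \<open>2 * A * norm b\<close> is mapped to one of size at most
    \<open>(A * c / 4 + M) * norm b\<close>, and with the drift \<open>P\<close> this stays below
    \<open>A * c * norm b\<close>, while the part in \<open>H\<close> is multiplied by at least
    \<open>c\<close>. \<open>\<rho>\<close> bounds the preceding vectors by the new part in
    \<open>H\<close>, and \<open>R\<close> is chosen for runs of zero and one step.\<close>
  define P where "P = t * (1 + B)"
  define A where "A = 1 + 4 * (M + P) / c"
  define \<rho> where "\<rho> = 2 * (1 + A) / c"
  define R where "R = (1 + A) * (1 + 2 * t / c)"
  have P0: "P \<ge> t" using t B by (simp add: P_def)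
  have A1: "A \<ge> 1" using M P0 t c by (simp add: A_def)
  have Ac: "A * c = c + 4 * (M + P)" using c by (simp add: A_def field_simps)
  have rho0: "\<rho> > 0" using A1 c by (simp add: \<rho>_def)
  have rhoc: "\<rho> * c = 2 * (1 + A)" using c by (simp add: \<rho>_def)
  have R1: "1 + A \<le> R"
  proof -
    have "(1 + A) * 1 \<le> (1 + A) * (1 + 2 * t / c)" using A1 t c by (intro mult_left_mono) auto
    then show ?thesis by (simp add: R_def)
  qed
  have R2: "2 * t * (1 + A) \<le> R * c"
  proof -
    have "R * c = (1 + A) * c + 2 * t * (1 + A)" using c by (simp add: R_def field_simps)
    then show ?thesis using A1 c by simp
  qed
  have beta: "1 / B > 0" using B by simp
  obtain lam where lam: "1 < lam" "lam \<le> 2" and expand: "\<And>y u u' s. y \<in> K \<Longrightarrow> norm u \<le> \<rho> \<Longrightarrow> norm u' \<le> \<rho> \<Longrightarrow>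
      (\<And>s. \<bar>s\<bar> \<le> 1 \<Longrightarrow> T y (u + s *\<^sub>R u') \<in> C \<and> 1 / B \<le> norm (T y (u + s *\<^sub>R u'))) \<Longrightarrow>
      \<bar>s\<bar> \<le> 1 \<Longrightarrow> T (F y) (T y (u + (s * lam) *\<^sub>R u')) \<in> C"
    using segment_expansion[OF beta, of \<rho>] by blast
  have drift: "norm (T x b - s (T x b)) \<le> P * norm b" if "x \<in> K" "adm s" for x s b
  proof -
    have "norm (T x b - s (T x b)) \<le> norm (T x b) + B * norm (T x b)"
      using norm_triangle_ineq4[of "T x b" "s (T x b)"] adm_le[OF that(2), of "T x b"] by linarith
    also have "\<dots> = (1 + B) * norm (T x b)" by (simp add: algebra_simps)
    also have "\<dots> \<le> (1 + B) * (t * norm b)" using T[OF that(1)] B by (intro mult_left_mono) auto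
    finally show ?thesis by (simp add: P_def algebra_simps)
  qed
  \<comment> \<open>Vectors are recorded one step late, as \<open>T y u\<close> and
    \<open>T y u'\<close> with \<open>u\<close>, \<open>u'\<close> bounded by \<open>b\<close>,
    because compactness acts only on such images. The last four bounds are reproduced by each step
    of the induction.\<close>
  have track: "norm (Tn n (F y) (T y u)) \<le> R * norm (s (Tn n (F y) b)) \<and>
      lam ^ n * norm (Tn n (F y) (T y u')) \<le> R * norm (s (Tn n (F y) b))"
    if "y \<in> K" "adm s" "b \<in> H" "s (Tn n (F y) (T y u - b)) = 0" "s (Tn n (F y) (T y u')) = 0"
      "\<And>r. \<bar>r\<bar> \<le> 1 \<Longrightarrow> T y (u + r *\<^sub>R u') \<in> C"
      "norm (T y u - b) \<le> A * norm b" "norm (T y u') \<le> A * norm b"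
      "norm u \<le> \<rho> * norm b" "norm u' \<le> \<rho> * norm b" for n y s b u u'
    using that
  \<comment> \<open>Two base cases, because \<open>step\<close> must know that the kernel component
    is outside \<open>C - {0}\<close> after two further applications of \<open>T\<close>, which
    takes two remaining steps; shorter runs are estimated by norms alone.\<close>
  proof (induction n arbitrary: y b u u' rule: induct_nat_012)
    case 0
    have "norm (T y u) \<le> (1 + A) * norm b"
      using norm_triangle_ineq[of "T y u - b" b] 0(7) by (simp add: algebra_simps)
    moreover have "(1 + A) * norm b \<le> R * norm b" using R1 by (intro mult_right_mono) auto
    moreover have "A * norm b \<le> (1 + A) * norm b" by (intro mult_right_mono) auto
    ultimately show ?case using 0(8) adm_id[OF 0(2,3)] by simp
  next
    case 1
    have "norm (T y u) \<le> (1 + A) * norm b"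
      using norm_triangle_ineq[of "T y u - b" b] 1(7) by (simp add: algebra_simps)
    from mult_left_mono[OF this, of t] have "norm (T (F y) (T y u)) \<le> t * ((1 + A) * norm b)"
      using T[OF F_in[OF 1(1)], of "T y u"] t by linarith
    moreover have "norm (T (F y) (T y u')) \<le> t * (A * norm b)"
      using T[OF F_in[OF 1(1)], of "T y u'"] mult_left_mono[OF 1(8), of t] t by linarith
    then have "lam * norm (T (F y) (T y u')) \<le> 2 * (t * (A * norm b))"
      using lam by (intro mult_mono) auto
    moreover have "t * ((1 + A) * norm b) \<le> 2 * t * (1 + A) * norm b"
      "2 * (t * (A * norm b)) \<le> 2 * t * (1 + A) * norm b"
      using t A1 by (auto simp: algebra_simps)
    moreover have "2 * t * (1 + A) * norm b \<le> R * norm (s (T (F y) b))"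
    proof -
      have "2 * t * (1 + A) * norm b \<le> R * c * norm b" using R2 by (intro mult_right_mono) auto
      also have "\<dots> \<le> R * norm (s (T (F y) b))"
        using low[OF F_in[OF 1(1)] 1(2,3)] R1 A1 by simp
      finally show ?thesis .
    qed
    ultimately have "norm (T (F y) (T y u)) \<le> R * norm (s (T (F y) b)) \<and>
        lam * norm (T (F y) (T y u')) \<le> R * norm (s (T (F y) b))" by linarith
    then show ?case by simp
  next
    case (ge2 n)
    show ?case
    proof (cases "b = 0")
      case True
      then have "u = 0" "u' = 0" using ge2.prems(9,10) by auto
      then show ?thesis by (simp add: blinfun.zero_right True)
    next
      case False
      define x where "x = F y"
      have x: "x \<in> K" using F_in[OF ge2.prems(1)] by (simp add: x_def)
      have Fx: "F x \<in> K" using F_in[OF x] .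
      obtain s0 where s0: "adm s0" "\<And>v. s (Tn (Suc (Suc n)) x (s0 v)) = s (Tn (Suc (Suc n)) x v)"
        using pullback[OF x ge2.prems(2)] by metis
      obtain s1 where s1: "adm s1" "\<And>v. s (Tn (Suc n) (F x) (s1 v)) = s (Tn (Suc n) (F x) v)"
        using pullback[OF Fx ge2.prems(2)] by metis
      \<comment> \<open>The component, in the kernel of \<open>s0\<close>, of the segment point with
        parameter \<open>r\<close>; the point itself is \<open>b + gg r\<close>.\<close>
      define gg where "gg r = T y (u + r *\<^sub>R u') - b" for r
      have gg_alt: "gg r = (T y u - b) + r *\<^sub>R T y u'" for r
        by (simp add: gg_def blinfun.add_right blinfun.scaleR_right)
      have gker: "s (Tn (Suc (Suc n)) x (gg r)) = 0" for r
        using ge2.prems(4,5) unfolding gg_alt x_def[symmetric] blinfun.add_right blinfun.scaleR_right by simp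
      \<comment> \<open>The projection \<open>s0\<close> maps the whole segment to \<open>b\<close>,
        so no point of it is shorter than \<open>norm b / B\<close>; after division by
        \<open>norm b\<close> this is the lower bound \<open>1 / B\<close> with which
        \<open>segment_expansion\<close> was instantiated.\<close>
      have Vlow: "norm b / B \<le> norm (T y (u + r *\<^sub>R u'))" for r
      proof -
        have "s0 (gg r) = 0" by (rule pullback_ker[OF x ge2.prems(2) s0 gker])
        then have "s0 (T y (u + r *\<^sub>R u')) = b"
          using adm_id[OF s0(1) ge2.prems(3)] by (simp add: gg_def blinfun.diff_right)
        then show ?thesis using adm_le[OF s0(1), of "T y (u + r *\<^sub>R u')"] B by (simp add: divide_le_eq mult.commute)
      qed
      have gstep: "norm (T x (gg r)) \<le> (c / 8) * norm (gg r) + M * norm b" if r: "\<bar>r\<bar> \<le> 1" for r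
      proof (rule step[OF x])
        show "b + gg r \<in> C" using ge2.prems(6)[OF r] by (simp add: gg_def)
        show "T (F x) (T x (gg r)) \<notin> C - {0}"
        proof
          assume "T (F x) (T x (gg r)) \<in> C - {0}"
          then have "Tn n (F (F x)) (T (F x) (T x (gg r))) \<in> C - {0}"
            by (rule Tn_cone[OF F_in[OF Fx]])
          then show False
            using gker[of r] adm_ker[OF ge2.prems(2)] unfolding cocycle_iter_Suc_apply by blast
        qed
      qed
      have gg_le: "norm (gg r) \<le> 2 * A * norm b" if "\<bar>r\<bar> \<le> 1" for r
      proof -
        have "norm (r *\<^sub>R T y u') \<le> 1 * (A * norm b)"
          unfolding norm_scaleR by (intro mult_mono that ge2.prems(8)) auto
        then show ?thesis
          using norm_triangle_ineq[of "T y u - b" "r *\<^sub>R T y u'"] ge2.prems(7) unfolding gg_alt by simp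
      qed
      \<comment> \<open>The remainder \<open>T x b - b1\<close> lies in the kernel of
        \<open>s1\<close>; it joins the kernel component and is paid for by
        \<open>P\<close>.\<close>
      define b1 where "b1 = s1 (T x b)"
      have b1: "b1 \<in> H" "c * norm b \<le> norm b1"
        using adm_range[OF s1(1)] low[OF x s1(1) ge2.prems(3)] by (auto simp: b1_def)
      define u1 where "u1 = T y u"
      \<comment> \<open>Here the segment is lengthened: the factor put into \<open>u1'\<close> turns
        the \<open>lam ^ Suc n\<close> of the induction hypothesis into
        \<open>lam ^ Suc (Suc n)\<close>.\<close>
      define u1' where "u1' = lam *\<^sub>R T y u'"
      have "norm (Tn (Suc n) (F x) (T x u1)) \<le> R * norm (s (Tn (Suc n) (F x) b1)) \<and>
          lam ^ Suc n * norm (Tn (Suc n) (F x) (T x u1')) \<le> R * norm (s (Tn (Suc n) (F x) b1))"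
      proof (rule ge2.IH(2)[OF x ge2.prems(2) b1(1)])
        have "s (Tn (Suc (Suc n)) x (u1 - b)) = 0"
          using ge2.prems(4) by (simp only: x_def u1_def)
        then show "s (Tn (Suc n) (F x) (T x u1 - b1)) = 0"
          unfolding b1_def blinfun.diff_right s1(2) cocycle_iter_Suc_apply[of F T "Suc n"] by simp
        have "s (Tn (Suc (Suc n)) x (T y u')) = 0"
          using ge2.prems(5) by (simp only: x_def)
        then show "s (Tn (Suc n) (F x) (T x u1')) = 0"
          unfolding u1'_def blinfun.scaleR_right cocycle_iter_Suc_apply[of F T "Suc n"] by simp
        show "T x (u1 + r *\<^sub>R u1') \<in> C" if r: "\<bar>r\<bar> \<le> 1" for r
        proof -
          define a where "a = 1 / norm b"
          have a: "a > 0" "a * norm b = 1" using False by (auto simp: a_def)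
          have "T (F y) (T y (a *\<^sub>R u + (r * lam) *\<^sub>R (a *\<^sub>R u'))) \<in> C"
          proof (rule expand[OF ge2.prems(1) _ _ _ r])
            show "norm (a *\<^sub>R u) \<le> \<rho>" "norm (a *\<^sub>R u') \<le> \<rho>"
              using ge2.prems(9,10) False by (auto simp: a_def divide_le_eq)
            fix q :: real assume q: "\<bar>q\<bar> \<le> 1"
            have eq: "T y (a *\<^sub>R u + q *\<^sub>R (a *\<^sub>R u')) = a *\<^sub>R T y (u + q *\<^sub>R u')"
              by (simp add: blinfun.add_right blinfun.scaleR_right algebra_simps)
            have "1 / B = a * (norm b / B)" using a(2) by simp
            also have "\<dots> \<le> a * norm (T y (u + q *\<^sub>R u'))"
              using Vlow[of q] a(1) by (intro mult_left_mono) auto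
            finally show "T y (a *\<^sub>R u + q *\<^sub>R (a *\<^sub>R u')) \<in> C \<and> 1 / B \<le> norm (T y (a *\<^sub>R u + q *\<^sub>R (a *\<^sub>R u')))"
              unfolding eq using scale_C[OF ge2.prems(6)[OF q]] a(1) by simp
          qed
          then have "norm b *\<^sub>R T (F y) (T y (a *\<^sub>R u + (r * lam) *\<^sub>R (a *\<^sub>R u'))) \<in> C"
            by (rule scale_C)
          moreover have "norm b *\<^sub>R T (F y) (T y (a *\<^sub>R u + (r * lam) *\<^sub>R (a *\<^sub>R u'))) = T x (u1 + r *\<^sub>R u1')"
            using a(2) by (simp add: u1_def u1'_def x_def blinfun.add_right blinfun.scaleR_right algebra_simps)
          ultimately show ?thesis by simp
        qed
        have Ab: "(A * c) * norm b \<le> A * norm b1"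
          using b1(2) A1 by (simp add: mult.assoc)
        have "norm (T x u1 - b1) \<le> norm (T x (gg 0)) + norm (T x b - b1)"
          using norm_triangle_ineq[of "T x (gg 0)" "T x b - b1"]
          by (simp add: gg_def u1_def blinfun.diff_right)
        also have "\<dots> \<le> (c / 8) * norm (gg 0) + M * norm b + P * norm b"
          using gstep[of 0] drift[OF x s1(1), of b] by (simp add: b1_def)
        also have "\<dots> \<le> (c / 8) * (2 * A * norm b) + M * norm b + P * norm b"
          using gg_le[of 0] c by (intro add_mono mult_left_mono order_refl) auto
        also have "\<dots> = (A * c / 4 + (M + P)) * norm b" by (simp add: algebra_simps)
        also have "\<dots> \<le> (A * c) * norm b"
          using Ac c M P0 t by (intro mult_right_mono) auto
        finally show "norm (T x u1 - b1) \<le> A * norm b1" using Ab by linarith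
        \<comment> \<open>\<open>T y u'\<close> is half the difference of the kernel components at
          the two ends of the segment, so \<open>step\<close> controls its image too. The factor 2
          on the left later absorbs \<open>lam \<le> 2\<close>.\<close>
        have "2 *\<^sub>R T x (T y u') = T x (gg 1) - T x (gg (- 1))"
          by (simp add: gg_alt blinfun.add_right blinfun.diff_right blinfun.minus_right scaleR_2)
        then have "2 * norm (T x (T y u')) \<le> norm (T x (gg 1)) + norm (T x (gg (- 1)))"
          using norm_triangle_ineq4[of "T x (gg 1)" "T x (gg (- 1))"] by (metis norm_scaleR abs_numeral)
        also have "\<dots> \<le> ((c / 8) * norm (gg 1) + M * norm b) + ((c / 8) * norm (gg (- 1)) + M * norm b)"
          by (intro add_mono gstep) auto
        also have "\<dots> \<le> ((c / 8) * (2 * A * norm b) + M * norm b) + ((c / 8) * (2 * A * norm b) + M * norm b)"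
          using c by (intro add_mono mult_left_mono gg_le order_refl) auto
        also have "\<dots> = (A * c / 2 + 2 * M) * norm b" by (simp add: algebra_simps)
        also have "\<dots> \<le> (A * c) * norm b"
          using Ac c M P0 t by (intro mult_right_mono) auto
        finally have w: "2 * norm (T x (T y u')) \<le> A * norm b1" using Ab by linarith
        have "norm (T x u1') = lam * norm (T x (T y u'))"
          using lam by (simp add: u1'_def blinfun.scaleR_right)
        also have "\<dots> \<le> 2 * norm (T x (T y u'))" using lam by (intro mult_right_mono) auto
        finally show "norm (T x u1') \<le> A * norm b1" using w by linarith
        have rb: "2 * (1 + A) * norm b \<le> \<rho> * norm b1"
          using mult_left_mono[OF b1(2), of \<rho>] rho0 rhoc by (simp flip: mult.assoc)
        have Ab0: "A * norm b \<ge> 0" using A1 by simp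
        have rb': "2 * norm b + 2 * (A * norm b) \<le> \<rho> * norm b1"
          using rb by (simp add: algebra_simps)
        have "norm (T y u) \<le> norm (T y u - b) + norm b"
          using norm_triangle_ineq[of "T y u - b" b] by simp
        then show "norm u1 \<le> \<rho> * norm b1"
          unfolding u1_def using ge2.prems(7) rb' Ab0 norm_ge_zero[of b] by linarith
        have "norm u1' \<le> 2 * (A * norm b)"
          unfolding u1'_def norm_scaleR using lam ge2.prems(8) by (intro mult_mono) auto
        then show "norm u1' \<le> \<rho> * norm b1" using rb' norm_ge_zero[of b] by linarith
      qed
      moreover have "s (Tn (Suc n) (F x) b1) = s (Tn (Suc (Suc n)) x b)"
        unfolding b1_def s1(2) cocycle_iter_Suc_apply[of F T "Suc n"] ..
      ultimately show ?thesis
        using lam unfolding u1_def u1'_def x_def[symmetric] cocycle_iter_Suc_apply[of F T "Suc n"]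
        by (simp add: blinfun.scaleR_right mult.commute mult.left_commute del: cocycle_iter.simps)
    qed
  qed
  obtain d where d: "d > 0" "d \<le> 1" and nbh: "\<And>h u. h \<in> H \<Longrightarrow> norm (u - h) \<le> d * norm h \<Longrightarrow> u \<in> C"
    using cone_neighbourhood by blast
  \<comment> \<open>The initial segment: for \<open>norm f \<le> d * norm h\<close> all
    \<open>h + r *\<^sub>R f\<close> with \<open>\<bar>r\<bar> \<le> 1\<close> are in
    \<open>C\<close>. The first application of \<open>T\<close> supplies the step by which
    \<open>track\<close> runs late, so only \<open>lam ^ m\<close> is gained and the bound
    \<open>lam \<le> 2\<close> makes up the difference.\<close>
  have small: "norm (Tn n x h) \<le> R * norm (s (Tn n x h)) \<and>
      lam ^ n * norm (Tn n x f) \<le> 2 * R * norm (s (Tn n x h))"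
    if x: "x \<in> K" and s: "adm s" and h: "h \<in> H" and f: "s (Tn n x f) = 0" "norm f \<le> d * norm h" for n x s h f
  proof -
    have fh: "norm f \<le> norm h" using f(2) d mult_right_mono[of d 1 "norm h"] by simp
    show ?thesis
    proof (cases n)
      case 0
      then show ?thesis using fh adm_id[OF s h] R1 A1 mult_right_mono[of 1 "2 * R" "norm h"] mult_right_mono[of 1 R "norm h"]
        by auto
    next
      case (Suc m)
      obtain s1 where s1: "adm s1" "\<And>v. s (Tn m (F x) (s1 v)) = s (Tn m (F x) v)"
        using pullback[OF F_in[OF x] s] by metis
      define b where "b = s1 (T x h)"
      have b: "b \<in> H" "c * norm h \<le> norm b"
        using adm_range[OF s1(1)] low[OF x s1(1) h] by (auto simp: b_def)
      have Ab: "(A * c) * norm h \<le> A * norm b"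
        using b(2) A1 by (simp add: mult.assoc)
      have rb: "2 * (1 + A) * norm h \<le> \<rho> * norm b"
        using mult_left_mono[OF b(2), of \<rho>] rho0 rhoc by (simp flip: mult.assoc)
      have hr: "norm h \<le> \<rho> * norm b"
        using rb mult_right_mono[of 1 "2 * (1 + A)" "norm h"] A1 by simp
      have "norm (Tn m (F x) (T x h)) \<le> R * norm (s (Tn m (F x) b)) \<and>
          lam ^ m * norm (Tn m (F x) (T x f)) \<le> R * norm (s (Tn m (F x) b))"
      proof (rule track[OF x s b(1)])
        show "s (Tn m (F x) (T x h - b)) = 0" by (simp add: b_def blinfun.diff_right s1(2))
        show "s (Tn m (F x) (T x f)) = 0" using f(1) by (simp only: Suc cocycle_iter_Suc_apply)
        show "T x (h + r *\<^sub>R f) \<in> C" if "\<bar>r\<bar> \<le> 1" for r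
        proof -
          have "norm (r *\<^sub>R f) \<le> 1 * (d * norm h)"
            unfolding norm_scaleR by (intro mult_mono that f(2)) auto
          then have "h + r *\<^sub>R f \<in> C" by (intro nbh[OF h]) simp
          then show ?thesis using Tn_C[OF x, of "h + r *\<^sub>R f" 1] by simp
        qed
        have "norm (T x h - b) \<le> P * norm h" unfolding b_def by (rule drift[OF x s1(1)])
        also have "\<dots> \<le> (A * c) * norm h" using Ac c M P0 t by (intro mult_right_mono) auto
        finally show "norm (T x h - b) \<le> A * norm b" using Ab by linarith
        have "norm (T x f) \<le> t * norm h"
          using T[OF x, of f] mult_left_mono[OF fh, of t] t by linarith
        also have "\<dots> \<le> (A * c) * norm h" using Ac c M P0 t by (intro mult_right_mono) auto
        finally show "norm (T x f) \<le> A * norm b" using Ab by linarith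
        show "norm h \<le> \<rho> * norm b" "norm f \<le> \<rho> * norm b" using hr fh by auto
      qed
      then have 1: "norm (Tn n x h) \<le> R * norm (s (Tn n x h))" "lam ^ m * norm (Tn n x f) \<le> R * norm (s (Tn n x h))"
        unfolding b_def s1(2) Suc cocycle_iter_Suc_apply by blast+
      have "lam ^ n * norm (Tn n x f) = lam * (lam ^ m * norm (Tn n x f))" by (simp add: Suc)
      also have "\<dots> \<le> 2 * (R * norm (s (Tn n x h)))"
        by (rule mult_mono[OF lam(2) 1(2)]) (use lam in simp_all)
      finally show ?thesis using 1(1) by simp
    qed
  qed
  have "norm (Tn n x f) * norm h \<le> (2 * R / d) * (1 / lam) ^ n * norm f * norm (s (Tn n x h))"
    if x: "x \<in> K" and s: "adm s" and h: "h \<in> H" and f: "s (Tn n x f) = 0" for n x s h f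
  proof (cases "f = 0")
    case False
    \<comment> \<open>The kernel vector is rescaled to length \<open>d * norm h\<close>, the longest
      that \<open>small\<close> allows.\<close>
    define a where "a = d * norm h / norm f"
    have a0: "a \<ge> 0" using d by (simp add: a_def)
    have "lam ^ n * norm (Tn n x (a *\<^sub>R f)) \<le> 2 * R * norm (s (Tn n x h))"
      using small[OF x s h, of n "a *\<^sub>R f"] f False d by (simp add: a_def blinfun.scaleR_right)
    then show ?thesis
      using False d lam a0 by (simp add: a_def blinfun.scaleR_right field_simps power_divide)
  qed (simp add: blinfun.zero_right)
  moreover have "norm (Tn n x h) \<le> (2 * R / d) * norm (s (Tn n x h))"
    if x: "x \<in> K" and s: "adm s" and h: "h \<in> H" for n x s h
  proof -
    have "norm (Tn n x h) \<le> R * norm (s (Tn n x h))"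
      using small[OF x s h, of n 0] d by (simp add: blinfun.zero_right)
    moreover have "R * 1 \<le> R * (2 / d)" using R1 A1 d by (intro mult_left_mono) (auto simp: field_simps)
    then have "R * norm (s (Tn n x h)) \<le> (2 * R / d) * norm (s (Tn n x h))"
      by (intro mult_right_mono) (auto simp: mult.commute)
    ultimately show ?thesis by linarith
  qed
  moreover have "2 * R / d \<ge> 1" using R1 A1 d by (simp add: field_simps)
  moreover have "0 < 1 / lam" "1 / lam < 1" using lam by auto
  ultimately show ?thesis by (intro exI[of _ "2 * R / d"] exI[of _ "1 / lam"] conjI) blast+
qed

end

text \<open>Splittings \<open>range (p x) \<oplus> ker (p x)\<close> of the fibres, encoded by the projections \<open>p x\<close>.\<close>

definition dominated_splitting ::
  "'x::topological_space set \<Rightarrow> ('x \<Rightarrow> 'x) \<Rightarrow> ('x \<Rightarrow> 'a::real_normed_vector \<Rightarrow>\<^sub>L 'a) \<Rightarrow> nat \<Rightarrow>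
   ('x \<Rightarrow> 'a \<Rightarrow>\<^sub>L 'a) \<Rightarrow> bool" where
  "dominated_splitting K F T k p \<longleftrightarrow>
     continuous_on K p \<and>
     (\<forall>x\<in>K. k_dimensional k (range (p x)) \<and> (\<forall>u. p x (p x u) = p x u) \<and>
        (\<forall>u. p (F x) (T x u) = T x (p x u)) \<and> range (p (F x)) \<subseteq> T x ` range (p x) \<and>
        (\<forall>v. p x v = v \<longrightarrow> T x v = 0 \<longrightarrow> v = 0)) \<and>
     (\<exists>R>0. \<exists>g. 0 < g \<and> g < 1 \<and> (\<forall>x\<in>K. \<forall>n v w. p x v = v \<longrightarrow> p x w = 0 \<longrightarrow>
        norm (cocycle_iter F T n x w) * norm v \<le> R * g ^ n * norm w * norm (cocycle_iter F T n x v)))"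

section \<open>Limits of the pulled-back complements and of the images of \<open>H\<close>\<close>

context cone_cocycle
begin

text \<open>\<open>pb n x\<close> projects along the preimage of the kernel of \<open>proj0\<close>
  under \<open>n\<close> steps. For \<open>f\<close> in the kernel of \<open>pb (n + j) x\<close>
  and \<open>h = pb n x f\<close>, domination bounds \<open>norm (Tn n x f) * norm h\<close> by a
  multiple of \<open>g ^ n * norm f * norm (Tn n x h)\<close>. As \<open>proj0\<close> agrees on the
  two images, \<open>norm (Tn n x h)\<close> is at most a multiple of
  \<open>norm (Tn n x f)\<close>. Multiplying, \<open>norm h\<close> is of order
  \<open>g ^ n * norm f\<close>, so the pullbacks are Cauchy in operator norm.\<close>

lemma stable_projection:
  "\<exists>\<rho>. continuous_on K \<rho> \<and> (\<forall>x\<in>K. adm (\<rho> x)) \<and>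
     (\<forall>x\<in>K. \<forall>u. \<rho> (F x) (T x (\<rho> x u)) = \<rho> (F x) (T x u))"
proof -
  obtain R g where R: "R \<ge> 1" and g: "0 < g" "g < 1"
    and slope: "\<And>n x s h. x \<in> K \<Longrightarrow> adm s \<Longrightarrow> h \<in> H \<Longrightarrow> norm (Tn n x h) \<le> R * norm (s (Tn n x h))"
    and dom: "\<And>n x s h f. x \<in> K \<Longrightarrow> adm s \<Longrightarrow> h \<in> H \<Longrightarrow> s (Tn n x f) = 0 \<Longrightarrow>
        norm (Tn n x f) * norm h \<le> R * g ^ n * norm f * norm (s (Tn n x h))"
    using domination by blast
  obtain B where B: "B \<ge> 1" and adm_le: "\<And>s u. adm s \<Longrightarrow> norm (s u) \<le> B * norm u"
    using adm_bound by blast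
  obtain c where c: "c > 0"
    and low: "\<And>n x s h. x \<in> K \<Longrightarrow> adm s \<Longrightarrow> h \<in> H \<Longrightarrow> c ^ n * norm h \<le> norm (s (Tn n x h))"
    using adm_Tn_lower by blast
  have "\<forall>n x. \<exists>s'. x \<in> K \<longrightarrow> adm s' \<and> (\<forall>u. proj0 (Tn n x (s' u)) = proj0 (Tn n x u))"
    using pullback[OF _ adm_proj0] by blast
  then obtain pb where pb: "\<And>n x. x \<in> K \<Longrightarrow> adm (pb n x)"
      "\<And>n x u. x \<in> K \<Longrightarrow> proj0 (Tn n x (pb n x u)) = proj0 (Tn n x u)"
    by metis
  have pbker: "pb n x f = 0" if "x \<in> K" "proj0 (Tn n x f) = 0" for n x f
    by (rule pullback_ker[OF that(1) adm_proj0 pb(1)[OF that(1)] pb(2)[OF that(1)] that(2)])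
  have cont: "continuous_on K (pb n)" for n
  proof (rule solution_continuous[where A = "\<lambda>x. proj0 o\<^sub>L Tn n x" and R = "\<lambda>x. proj0 o\<^sub>L Tn n x"])
    show "continuous_on K (\<lambda>x. proj0 o\<^sub>L Tn n x)" "continuous_on K (\<lambda>x. proj0 o\<^sub>L Tn n x)"
      by (intro bounded_bilinear.continuous_on[OF bounded_bilinear_blinfun_compose] continuous_intros Tn_cont)+
    show "c ^ n > 0" using c by simp
  qed (use subspace_H low[OF _ adm_proj0] adm_range pb in auto)
  \<comment> \<open>A vector in the kernel of \<open>pb (Suc n) x\<close> is sent by
    \<open>T x\<close> into the kernel of \<open>pb n (F x)\<close>; in the limit this becomes the
    invariance of the kernels.\<close>
  have rel0: "pb n (F x) (T x (pb (Suc n) x u)) = pb n (F x) (T x u)" if x: "x \<in> K" for n x u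
  proof -
    have "proj0 (Tn (Suc n) x (u - pb (Suc n) x u)) = 0"
      using pb(2)[OF x, of "Suc n" u] unfolding blinfun.diff_right by simp
    then have "pb n (F x) (T x (u - pb (Suc n) x u)) = 0"
      unfolding cocycle_iter_Suc_apply by (rule pbker[OF F_in[OF x]])
    then show ?thesis by (simp add: blinfun.diff_right)
  qed
  define Q where "Q = R * B * R * B * (1 + B)"
  have Q0: "Q \<ge> 0" using R B by (simp add: Q_def)
  have est: "norm (pb (n + j) x - pb n x) \<le> Q * g ^ n" if x: "x \<in> K" for x n j
  proof (rule norm_blinfun_bound)
    show "0 \<le> Q * g ^ n" using Q0 g by simp
    fix u
    define f where "f = u - pb (n + j) x u"
    define h where "h = pb n x f"
    have h: "h \<in> H" unfolding h_def by (rule adm_range[OF pb(1)[OF x]])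
    have eq: "(pb (n + j) x - pb n x) u = - h"
      using adm_id[OF pb(1)[OF x, of n] adm_range[OF pb(1)[OF x, of "n + j"], of u]]
      by (simp add: h_def f_def blinfun.diff_left blinfun.diff_right)
    have "norm f \<le> norm u + B * norm u"
      using norm_triangle_ineq4[of u "pb (n + j) x u"] adm_le[OF pb(1)[OF x, of "n + j"], of u] by (simp add: f_def)
    then have f: "norm f \<le> (1 + B) * norm u" by (simp add: algebra_simps)
    let ?xn = "(F ^^ n) x"
    have xn: "?xn \<in> K" by (rule Fn_in[OF x])
    have "proj0 (Tn (j + n) x f) = 0"
      using pb(2)[OF x, of "j + n" u] by (simp add: f_def blinfun.diff_right add.commute)
    then have ker: "pb j ?xn (Tn n x f) = 0"
      unfolding cocycle_iter_add by (intro pbker[OF xn]) simp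
    have "norm h \<le> Q * g ^ n * norm u"
    proof (cases "h = 0")
      case True
      then show ?thesis using Q0 g by simp
    next
      case False
      have pos: "norm (Tn n x h) > 0" using Tn_cone[OF x, of h n] H_subset_C[OF h] False by simp
      have "norm (Tn n x h) \<le> R * norm (proj0 (Tn n x f))"
        using slope[OF x adm_proj0 h, of n] pb(2)[OF x, of n f] by (simp add: h_def)
      also have "\<dots> \<le> R * (B * norm (Tn n x f))"
        using R by (intro mult_left_mono adm_le[OF adm_proj0]) auto
      finally have 1: "norm (Tn n x h) \<le> R * B * norm (Tn n x f)" by simp
      have "norm (Tn n x f) * norm h \<le> R * g ^ n * norm f * norm (pb j ?xn (Tn n x h))"
        by (rule dom[OF x pb(1)[OF xn] h ker])
      also have "\<dots> \<le> R * g ^ n * norm f * (B * norm (Tn n x h))"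
        using R g by (intro mult_left_mono adm_le[OF pb(1)[OF xn]]) auto
      finally have 2: "norm (Tn n x f) * norm h \<le> R * g ^ n * norm f * (B * norm (Tn n x h))" .
      have "norm (Tn n x h) * norm h \<le> R * B * (norm (Tn n x f) * norm h)"
        using mult_right_mono[OF 1, of "norm h"] by (simp add: mult.assoc)
      also have "\<dots> \<le> R * B * (R * g ^ n * norm f * (B * norm (Tn n x h)))"
        using R B by (intro mult_left_mono 2) auto
      also have "\<dots> = norm (Tn n x h) * (R * B * R * B * g ^ n * norm f)" by (simp add: algebra_simps)
      finally have "norm h \<le> R * B * R * B * g ^ n * norm f" using pos by simp
      also have "\<dots> \<le> R * B * R * B * g ^ n * ((1 + B) * norm u)"
        using R B g f by (intro mult_left_mono) auto
      also have "\<dots> = Q * g ^ n * norm u" by (simp add: Q_def algebra_simps)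
      finally show ?thesis .
    qed
    then show "norm ((pb (n + j) x - pb n x) u) \<le> Q * g ^ n * norm u" unfolding eq by simp
  qed
  obtain l where l: "continuous_on K l" and lim: "\<And>x. x \<in> K \<Longrightarrow> (\<lambda>n. pb n x) \<longlonglongrightarrow> l x"
    using geometric_limit[OF cont g est] by blast
  have rel: "l (F x) (T x (l x u)) = l (F x) (T x u)" if x: "x \<in> K" for x u
  proof -
    have "(\<lambda>n. pb n (F x) (T x (pb (Suc n) x u))) \<longlonglongrightarrow> l (F x) (T x (l x u))"
      by (intro tendsto_intros lim F_in x LIMSEQ_Suc)
    moreover have "(\<lambda>n. pb n (F x) (T x u)) \<longlonglongrightarrow> l (F x) (T x u)"
      by (intro tendsto_intros lim F_in x)
    ultimately show ?thesis unfolding rel0[OF x] by (rule LIMSEQ_unique)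
  qed
  have "adm (l x)" if x: "x \<in> K" for x
    unfolding adm_def
  proof (intro conjI allI ballI impI)
    have limu: "(\<lambda>n. pb n x u) \<longlonglongrightarrow> l x u" for u by (intro tendsto_intros lim x)
    show "l x u \<in> H" for u
      using closed_sequentially[OF k_dimensional_closed[OF dim_H] _ limu] adm_range[OF pb(1)[OF x]] by blast
    show "l x h = h" if "h \<in> H" for h
      using limu[of h] unfolding adm_id[OF pb(1)[OF x] that] by (metis LIMSEQ_unique tendsto_const)
    fix v assume v: "v \<in> C" "l x v = 0"
    show "v = 0"
    proof (rule ccontr)
      assume v0: "v \<noteq> 0"
      \<comment> \<open>A limit of complements that avoid \<open>C - {0}\<close> could still touch
        the boundary of \<open>C\<close>. One step moves \<open>v\<close> into the open set
        \<open>interior C - {0}\<close>, which would then contain a kernel vector of some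
        \<open>pb n (F x)\<close>.\<close>
      define w where "w = T x v"
      have w: "w \<in> interior C - {0}" unfolding w_def by (rule T_interior[OF x v(1) v0])
      have "l (F x) w = 0" using rel[OF x, of v] v(2) by (simp add: w_def blinfun.zero_right)
      moreover have "(\<lambda>n. w - pb n (F x) w) \<longlonglongrightarrow> w - l (F x) w"
        by (intro tendsto_intros lim F_in x)
      ultimately have "(\<lambda>n. w - pb n (F x) w) \<longlonglongrightarrow> w" by simp
      moreover have "open (interior C - {0})" by auto
      ultimately have "\<forall>\<^sub>F n in sequentially. w - pb n (F x) w \<in> interior C - {0}"
        using w topological_tendstoD by blast
      then obtain n where n: "w - pb n (F x) w \<in> interior C - {0}"
        by (auto simp: eventually_sequentially)
      have a: "adm (pb n (F x))" by (rule pb(1)[OF F_in[OF x]])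
      have "pb n (F x) (w - pb n (F x) w) = 0"
        using adm_id[OF a adm_range[OF a]] by (simp add: blinfun.diff_right)
      then show False using adm_ker[OF a] n interior_subset by blast
    qed
  qed
  with l rel show ?thesis by blast
qed

text \<open>\<open>q n x\<close> projects onto the image of \<open>H\<close> under \<open>n\<close>
  steps from \<open>(G ^^ n) x\<close>, along the kernel of \<open>\<rho> x\<close>, and
  \<open>z n x u\<close> is the preimage in \<open>H\<close> of the projected vector. Two such
  projections differ by the image of a vector \<open>f\<close> at the starting point whose image
  lies in the kernel of \<open>\<rho> x\<close>, so domination over \<open>n\<close> steps makes the
  difference of order \<open>g ^ n\<close>.\<close>

lemma splitting:
  "\<exists>p. dominated_splitting K F T k p \<and>
     (\<forall>x\<in>K. range (p x) - {0} \<subseteq> interior C \<and> (\<forall>v\<in>C. p x v = 0 \<longrightarrow> v = 0))"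
proof -
  obtain R g where R: "R \<ge> 1" and g: "0 < g" "g < 1"
    and slope: "\<And>n x s h. x \<in> K \<Longrightarrow> adm s \<Longrightarrow> h \<in> H \<Longrightarrow> norm (Tn n x h) \<le> R * norm (s (Tn n x h))"
    and dom: "\<And>n x s h f. x \<in> K \<Longrightarrow> adm s \<Longrightarrow> h \<in> H \<Longrightarrow> s (Tn n x f) = 0 \<Longrightarrow>
        norm (Tn n x f) * norm h \<le> R * g ^ n * norm f * norm (s (Tn n x h))"
    using domination by blast
  obtain B where B: "B \<ge> 1" and adm_le: "\<And>s u. adm s \<Longrightarrow> norm (s u) \<le> B * norm u"
    using adm_bound by blast
  obtain c where c: "c > 0"
    and low: "\<And>n x s h. x \<in> K \<Longrightarrow> adm s \<Longrightarrow> h \<in> H \<Longrightarrow> c ^ n * norm h \<le> norm (s (Tn n x h))"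
    using adm_Tn_lower by blast
  obtain \<rho> where cont_rho: "continuous_on K \<rho>" and adm_rho: "\<And>x. x \<in> K \<Longrightarrow> adm (\<rho> x)"
    and rel: "\<And>x u. x \<in> K \<Longrightarrow> \<rho> (F x) (T x (\<rho> x u)) = \<rho> (F x) (T x u)"
    using stable_projection by blast
  have reln: "\<rho> ((F ^^ n) y) (Tn n y (\<rho> y v)) = \<rho> ((F ^^ n) y) (Tn n y v)" if y: "y \<in> K" for n y v
  proof (induction n)
    case 0
    then show ?case using adm_id[OF adm_rho[OF y] adm_range[OF adm_rho[OF y]]] by simp
  next
    case (Suc n)
    let ?z = "(F ^^ n) y"
    have "\<rho> (F ?z) (T ?z (Tn n y (\<rho> y v))) = \<rho> (F ?z) (T ?z (\<rho> ?z (Tn n y (\<rho> y v))))"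
      by (rule rel[OF Fn_in[OF y], symmetric])
    also have "\<dots> = \<rho> (F ?z) (T ?z (Tn n y v))" unfolding Suc by (rule rel[OF Fn_in[OF y]])
    finally show ?case by simp
  qed
  have "\<forall>n. \<exists>Z :: 'x \<Rightarrow> 'a \<Rightarrow>\<^sub>L 'a. \<forall>x. x \<in> K \<longrightarrow> (\<forall>u. Z x u \<in> H \<and> \<rho> x (Tn n ((G ^^ n) x) (Z x u)) = \<rho> x u)"
  proof (intro allI choice)
    fix n x
    show "\<exists>Z :: 'a \<Rightarrow>\<^sub>L 'a. x \<in> K \<longrightarrow> (\<forall>u. Z u \<in> H \<and> \<rho> x (Tn n ((G ^^ n) x) (Z u)) = \<rho> x u)"
    proof (cases "x \<in> K")
      case x: True
      have "\<exists>Z :: 'a \<Rightarrow>\<^sub>L 'a. \<forall>u. Z u \<in> H \<and> (\<rho> x o\<^sub>L Tn n ((G ^^ n) x)) (Z u) = \<rho> x u"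
        by (rule solve_on_finite_dim[OF dim_H, where c = "c ^ n"])
          (use c low[OF Gn_in[OF x] adm_rho[OF x]] adm_range[OF adm_rho[OF x]] in auto)
      then show ?thesis by auto
    qed simp
  qed
  from choice[OF this] obtain z :: "nat \<Rightarrow> 'x \<Rightarrow> 'a \<Rightarrow>\<^sub>L 'a" where z: "\<And>n x u. x \<in> K \<Longrightarrow> z n x u \<in> H"
      "\<And>n x u. x \<in> K \<Longrightarrow> \<rho> x (Tn n ((G ^^ n) x) (z n x u)) = \<rho> x u"
    by blast
  have zuniq: "z n x u = h" if "x \<in> K" "h \<in> H" "\<rho> x (Tn n ((G ^^ n) x) h) = \<rho> x u" for n x u h
    by (rule Tn_inj_H[OF Gn_in[OF that(1)] adm_rho[OF that(1)] z(1)[OF that(1)] that(2), of n n])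
      (use z(2)[OF that(1)] that(3) in simp)
  have TG: "continuous_on K (\<lambda>x. Tn n ((G ^^ n) x))" for n
    by (rule continuous_on_compose2[OF Tn_cont cont_funpow[OF cont_G G_in]]) (auto simp: Gn_in)
  have contz: "continuous_on K (z n)" for n
  proof (rule solution_continuous[where A = "\<lambda>x. \<rho> x o\<^sub>L Tn n ((G ^^ n) x)" and R = \<rho>])
    show "continuous_on K (\<lambda>x. \<rho> x o\<^sub>L Tn n ((G ^^ n) x))"
      by (intro bounded_bilinear.continuous_on[OF bounded_bilinear_blinfun_compose] cont_rho TG)
    show "c ^ n > 0" using c by simp
  qed (use subspace_H cont_rho low[OF Gn_in adm_rho] z in auto)
  define q where "q n x = Tn n ((G ^^ n) x) o\<^sub>L z n x" for n x
  have contq: "continuous_on K (q n)" for n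
    unfolding q_def by (intro bounded_bilinear.continuous_on[OF bounded_bilinear_blinfun_compose] contz TG)
  have qC: "q n x u \<in> C" if "x \<in> K" for n x u
    using Tn_C[OF Gn_in[OF that] H_subset_C[OF z(1)[OF that]]] by (simp add: q_def)
  have rho_q: "\<rho> x (q n x u) = \<rho> x u" if "x \<in> K" for n x u
    using z(2)[OF that] by (simp add: q_def)
  have q_rho: "q n x (\<rho> x u) = q n x u" if "x \<in> K" for n x u
  proof -
    have "z n x (\<rho> x u) = z n x u"
      using zuniq[OF that z(1)[OF that], of n n u "\<rho> x u"] z(2)[OF that]
        adm_id[OF adm_rho[OF that] adm_range[OF adm_rho[OF that]]] by simp
    then show ?thesis by (simp add: q_def)
  qed
  have qT: "q (Suc n) (F x) (T x u) = T x (q n x u)" if x: "x \<in> K" for n x u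
  proof -
    let ?y = "(G ^^ n) x"
    have y: "(G ^^ Suc n) (F x) = ?y" unfolding funpow_Suc_right using GF[OF x] by simp
    have Ty: "Tn (Suc n) ?y v = T x (Tn n ?y v)" for v by (simp add: Fn_Gn[OF x])
    have "z (Suc n) (F x) (T x u) = z n x u"
    proof (rule zuniq[OF F_in[OF x] z(1)[OF x]])
      have "\<rho> (F x) (T x (Tn n ?y (z n x u))) = \<rho> (F x) (T x (\<rho> x (Tn n ?y (z n x u))))"
        by (rule rel[OF x, symmetric])
      also have "\<dots> = \<rho> (F x) (T x u)" unfolding z(2)[OF x] by (rule rel[OF x])
      finally show "\<rho> (F x) (Tn (Suc n) ((G ^^ Suc n) (F x)) (z n x u)) = \<rho> (F x) (T x u)"
        unfolding y Ty .
    qed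
    then show ?thesis unfolding q_def blinfun_apply_blinfun_compose y Ty by simp
  qed
  define Q where "Q = R * (R + 1) * B"
  have Q0: "Q \<ge> 0" using R B by (simp add: Q_def)
  have est: "norm (q (n + j) x - q n x) \<le> Q * g ^ n" if x: "x \<in> K" for x n j
  proof (rule norm_blinfun_bound)
    show "0 \<le> Q * g ^ n" using Q0 g by simp
    fix u
    define y where "y = (G ^^ n) x"
    define y' where "y' = (G ^^ j) y"
    have y: "y \<in> K" "y' \<in> K" using x by (auto simp: y_def y'_def Gn_in)
    have y'_alt: "(G ^^ (n + j)) x = y'" by (simp add: y'_def y_def funpow_add add.commute[of n])
    have Fny: "(F ^^ n) y = x" unfolding y_def by (rule Fn_Gn[OF x])
    have Fjy: "(F ^^ j) y' = y" unfolding y'_def by (rule Fn_Gn[OF y(1)])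
    define z0 where "z0 = z n x u"
    define z1 where "z1 = z (n + j) x u"
    define a where "a = Tn j y' z1"
    define f where "f = a - z0"
    have zH: "z0 \<in> H" "z1 \<in> H" using z(1)[OF x] by (auto simp: z0_def z1_def)
    have z0: "\<rho> x (Tn n y z0) = \<rho> x u" using z(2)[OF x, of n u] by (simp add: z0_def y_def)
    have Ta: "Tn (n + j) y' z1 = Tn n y a" unfolding cocycle_iter_add Fjy by (simp add: a_def)
    have ax: "\<rho> x (Tn n y a) = \<rho> x u"
      using z(2)[OF x, of "n + j" u] unfolding y'_alt z1_def[symmetric] Ta .
    have qe: "(q (n + j) x - q n x) u = Tn n y f"
      unfolding q_def y'_alt blinfun.diff_left f_def blinfun_apply_blinfun_compose Ta z1_def[symmetric]
      by (simp add: Ta y_def z0_def blinfun.diff_right)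
    have fk: "\<rho> x (Tn n y f) = 0" by (simp add: f_def blinfun.diff_right ax z0)
    \<comment> \<open>At \<open>y\<close> the component of \<open>a\<close> in \<open>H\<close> is
      \<open>z0\<close>, because the images of both have the same \<open>\<rho> x\<close> component.
      Together with \<open>slope\<close> this bounds \<open>f = a - z0\<close> by \<open>z0\<close>
      alone, uniformly in \<open>j\<close>.\<close>
    have ry: "\<rho> y a = z0"
    proof (rule Tn_inj_H[OF y(1) adm_rho[OF x] adm_range[OF adm_rho[OF y(1)]] zH(1)])
      show "\<rho> x (Tn n y (\<rho> y a)) = \<rho> x (Tn n y z0)"
        using reln[OF y(1), of n a] unfolding Fny ax z0 .
    qed
    have "norm a \<le> R * norm z0"
      using slope[OF y(2) adm_rho[OF y(1)] zH(2), of j] ry by (simp add: a_def)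
    then have f: "norm f \<le> (R + 1) * norm z0"
      using norm_triangle_ineq4[of a z0] by (simp add: f_def algebra_simps)
    have d: "norm (Tn n y f) * norm z0 \<le> R * g ^ n * norm f * norm (\<rho> x u)"
      using dom[OF y(1) adm_rho[OF x] zH(1) fk] unfolding z0 .
    have "norm (Tn n y f) \<le> Q * g ^ n * norm u"
    proof (cases "z0 = 0")
      case True
      then have "f = 0" using f by simp
      then show ?thesis using Q0 g by (simp add: blinfun.zero_right)
    next
      case False
      note d
      also have "R * g ^ n * norm f * norm (\<rho> x u) \<le> R * g ^ n * ((R + 1) * norm z0) * (B * norm u)"
        using R g B f by (intro mult_mono adm_le[OF adm_rho[OF x]]) auto
      also have "\<dots> = Q * g ^ n * norm u * norm z0" by (simp add: Q_def algebra_simps)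
      finally show ?thesis using False by simp
    qed
    then show "norm ((q (n + j) x - q n x) u) \<le> Q * g ^ n * norm u" unfolding qe .
  qed
  obtain p where p: "continuous_on K p" and lim: "\<And>x. x \<in> K \<Longrightarrow> (\<lambda>n. q n x) \<longlonglongrightarrow> p x"
    using geometric_limit[OF contq g est] by blast
  have limu: "(\<lambda>n. q n x u) \<longlonglongrightarrow> p x u" if "x \<in> K" for x u by (intro tendsto_intros lim that)
  have pC: "p x u \<in> C" if "x \<in> K" for x u
    using closed_sequentially[OF closed_C qC[OF that] limu[OF that]] .
  have rho_p: "\<rho> x (p x u) = \<rho> x u" if "x \<in> K" for x u
  proof -
    have "(\<lambda>n. \<rho> x (q n x u)) \<longlonglongrightarrow> \<rho> x (p x u)" by (intro tendsto_intros limu that)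
    then show ?thesis unfolding rho_q[OF that] by (metis LIMSEQ_unique tendsto_const)
  qed
  have p_rho: "p x (\<rho> x u) = p x u" if "x \<in> K" for x u
    using limu[OF that, of "\<rho> x u"] limu[OF that, of u] unfolding q_rho[OF that] by (rule LIMSEQ_unique)
  have pT: "p (F x) (T x u) = T x (p x u)" if "x \<in> K" for x u
  proof -
    have "(\<lambda>n. q (Suc n) (F x) (T x u)) \<longlonglongrightarrow> p (F x) (T x u)"
      by (rule LIMSEQ_Suc[OF limu[OF F_in[OF that]]])
    moreover have "(\<lambda>n. T x (q n x u)) \<longlonglongrightarrow> T x (p x u)"
      by (intro tendsto_intros limu that)
    ultimately show ?thesis unfolding qT[OF that] by (rule LIMSEQ_unique)
  qed
  have pp: "p x (p x u) = p x u" if "x \<in> K" for x u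
    using p_rho[OF that, of "p x u"] rho_p[OF that, of u] p_rho[OF that, of u] by simp
  have dim: "k_dimensional k (range (p x))" if x: "x \<in> K" for x
  proof -
    have "k_dimensional k (p x ` H)"
    proof (rule k_dimensional_linear_image[OF dim_H])
      show "linear (p x)" by (simp add: bounded_linear.linear blinfun.bounded_linear_right)
      show "h = 0" if "h \<in> H" "p x h = 0" for h
        using rho_p[OF x, of h] adm_id[OF adm_rho[OF x] that(1)] that(2) by (simp add: blinfun.zero_right)
    qed
    moreover have "p x ` H = range (p x)"
    proof
      show "range (p x) \<subseteq> p x ` H"
      proof
        fix v assume "v \<in> range (p x)"
        then obtain u where "v = p x u" by blast
        then have "v = p x (\<rho> x u)" using p_rho[OF x] by simp
        then show "v \<in> p x ` H" using adm_range[OF adm_rho[OF x]] by blast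
      qed
    qed blast
    ultimately show ?thesis by simp
  qed
  have surj: "range (p (F x)) \<subseteq> T x ` range (p x)" if x: "x \<in> K" for x
  proof
    fix v assume "v \<in> range (p (F x))"
    then obtain u where u: "v = p (F x) u" by blast
    \<comment> \<open>\<open>w\<close> is a vector of \<open>H\<close> whose image under
      \<open>T x\<close> has the same \<open>\<rho>\<close> component as \<open>u\<close>;
      \<open>p (F x)\<close> does not distinguish such vectors.\<close>
    define w where "w = z 1 (F x) u"
    have "\<rho> (F x) (T x w) = \<rho> (F x) u"
      using z(2)[OF F_in[OF x], of 1 u] GF[OF x] by (simp add: w_def)
    then have "v = p (F x) (T x w)" using u p_rho[OF F_in[OF x]] by metis
    then have "v = T x (p x w)" using pT[OF x] by simp
    then show "v \<in> T x ` range (p x)" by blast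
  qed
  \<comment> \<open>The limit only puts the range into the closed cone \<open>C\<close>; since every
    range vector at \<open>x\<close> is the image of one at \<open>G x\<close>, that last step makes
    it interior.\<close>
  have int: "range (p x) - {0} \<subseteq> interior C" if x: "x \<in> K" for x
  proof
    fix v assume v: "v \<in> range (p x) - {0}"
    then obtain w where w: "v = T (G x) (p (G x) w)"
      using surj[OF G_in[OF x]] unfolding FG[OF x] by blast
    then have "p (G x) w \<noteq> 0" using v by (auto simp: blinfun.zero_right)
    then show "v \<in> interior C" using T_interior[OF G_in[OF x] pC[OF G_in[OF x], of w]] w by simp
  qed
  have inj: "v = 0" if "x \<in> K" "p x v = v" "T x v = 0" for x v
    using T_interior[OF that(1), of v] pC[OF that(1), of v] that by auto
  obtain b where b: "b > 0" "\<And>x. x \<in> K \<Longrightarrow> norm (p x) \<le> b"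
    using compact_imp_bounded[OF compact_continuous_image[OF p compact_K]] unfolding bounded_pos by auto
  have ker: "v = 0" if "x \<in> K" "v \<in> C" "p x v = 0" for x v
    using adm_ker[OF adm_rho[OF that(1)] that(2)] rho_p[OF that(1), of v] that(3) by (simp add: blinfun.zero_right)
  \<comment> \<open>The estimate \<open>dom\<close> speaks of vectors of \<open>H\<close>. A range
    vector \<open>v\<close> is replaced by \<open>\<rho> x v\<close>, whose image has the same
    \<open>\<rho>\<close> component after \<open>n\<close> steps; \<open>b\<close> and
    \<open>B\<close> are the price of passing back.\<close>
  have domp: "norm (Tn n x w) * norm v \<le> (b * R * B) * g ^ n * norm w * norm (Tn n x v)"
    if x: "x \<in> K" and v: "p x v = v" and w: "p x w = 0" for x n v w
  proof -
    have Fn: "(F ^^ n) x \<in> K" by (rule Fn_in[OF x])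
    have "\<rho> x w = 0" using rho_p[OF x, of w] w by (simp add: blinfun.zero_right)
    then have "\<rho> ((F ^^ n) x) (Tn n x w) = 0" using reln[OF x, of n w] by (simp add: blinfun.zero_right)
    from dom[OF x adm_rho[OF Fn] adm_range[OF adm_rho[OF x]] this, of v]
    have "norm (Tn n x w) * norm (\<rho> x v) \<le> R * g ^ n * norm w * norm (\<rho> ((F ^^ n) x) (Tn n x v))"
      unfolding reln[OF x] .
    also have "\<dots> \<le> R * g ^ n * norm w * (B * norm (Tn n x v))"
      using R g by (intro mult_left_mono adm_le[OF adm_rho[OF Fn]]) auto
    finally have 1: "norm (Tn n x w) * norm (\<rho> x v) \<le> R * g ^ n * norm w * (B * norm (Tn n x v))" .
    have "norm v = norm (p x (\<rho> x v))" using p_rho[OF x] v by simp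
    also have "\<dots> \<le> norm (p x) * norm (\<rho> x v)" by (rule norm_blinfun)
    also have "\<dots> \<le> b * norm (\<rho> x v)" using b(2)[OF x] by (intro mult_right_mono) auto
    finally have "norm (Tn n x w) * norm v \<le> norm (Tn n x w) * (b * norm (\<rho> x v))"
      by (intro mult_left_mono) auto
    also have "\<dots> = b * (norm (Tn n x w) * norm (\<rho> x v))" by simp
    also have "\<dots> \<le> b * (R * g ^ n * norm w * (B * norm (Tn n x v)))"
      using b(1) by (intro mult_left_mono 1) auto
    finally show ?thesis by (simp add: algebra_simps)
  qed
  have "b * R * B > 0" using b R B by simp
  then have "dominated_splitting K F T k p"
    unfolding dominated_splitting_def using p dim pp pT surj inj domp g by blast
  with int ker show ?thesis by blast
qed

end

text \<open>The complement \<open>L\<close> provided by the codimension need not be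
  \<open>H\<close>, but the projection \<open>l\<close> onto \<open>L\<close> along \<open>W\<close>
  restricts to an isomorphism from \<open>H\<close> to \<open>L\<close> by dimension; inverting it
  gives the projection onto \<open>H\<close>. It is bounded because the compact unit sphere of
  \<open>H\<close> has positive distance to the closed \<open>W\<close>.\<close>

lemma projection_along_closed:
  fixes H W :: "'a::real_normed_vector set"
  assumes H: "k_dimensional k H" and W: "closed W" "k_codimensional k W" and HW: "H \<inter> W = {0}"
  shows "\<exists>p :: 'a \<Rightarrow>\<^sub>L 'a. (\<forall>u. p u \<in> H) \<and> (\<forall>h\<in>H. p h = h) \<and> (\<forall>u. p u = 0 \<longrightarrow> u \<in> W)"
proof -
  have subH: "subspace H" using H by (rule k_dimensional_subspace)
  obtain L where L: "k_dimensional k L" "L \<inter> W = {0}" "{u + v |u v. u \<in> L \<and> v \<in> W} = UNIV"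
    and subW: "subspace W"
    using W(2) unfolding k_codimensional_def by blast
  have subL: "subspace L" using L(1) by (rule k_dimensional_subspace)
  have "\<exists>l. l \<in> L \<and> u - l \<in> W" for u
  proof -
    have "u \<in> {u + v |u v. u \<in> L \<and> v \<in> W}" unfolding L(3) by simp
    then obtain a b where "u = a + b" "a \<in> L" "b \<in> W" by blast
    then show ?thesis by (intro exI[of _ a]) simp
  qed
  then obtain l where l: "\<And>u. l u \<in> L" "\<And>u. u - l u \<in> W" by metis
  have l_uniq: "l u = a" if "a \<in> L" "u - a \<in> W" for u a
  proof -
    have "l u - a \<in> L" by (rule subspace_diff[OF subL l(1) that(1)])
    moreover have "(u - a) - (u - l u) \<in> W" by (rule subspace_diff[OF subW that(2) l(2)])
    then have "l u - a \<in> W" by simp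
    ultimately have "l u - a \<in> L \<inter> W" by blast
    then show ?thesis unfolding L(2) by simp
  qed
  have "linear l"
  proof (rule linearI)
    fix u v and r :: real
    have "(u - l u) + (v - l v) \<in> W" by (rule subspace_add[OF subW l(2) l(2)])
    then have "(u + v) - (l u + l v) \<in> W" by (simp add: algebra_simps)
    then show "l (u + v) = l u + l v" by (rule l_uniq[OF subspace_add[OF subL l(1) l(1)]])
    have "r *\<^sub>R (u - l u) \<in> W" by (rule subspace_scale[OF subW l(2)])
    then have "r *\<^sub>R u - r *\<^sub>R l u \<in> W" by (simp add: algebra_simps)
    then show "l (r *\<^sub>R u) = r *\<^sub>R l u" by (rule l_uniq[OF subspace_scale[OF subL l(1)]])
  qed
  moreover have "h = 0" if "h \<in> H" "l h = 0" for h
  proof -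
    have "h \<in> H \<inter> W" using l(2)[of h] that by simp
    then show ?thesis unfolding HW by simp
  qed
  ultimately have "l ` H = L"
    by (intro k_dimensional_eqI[OF k_dimensional_linear_image[OF H] L(1)]) (auto simp: l)
  then have "\<forall>u. \<exists>h. h \<in> H \<and> l h = l u" using l(1) by (metis imageE)
  from choice[OF this] obtain p where p: "\<And>u. p u \<in> H" "\<And>u. l (p u) = l u" by blast
  have pW: "u - p u \<in> W" for u
    using subspace_diff[OF subW l(2)[of u] l(2)[of "p u"]] p(2)[of u] by simp
  have p_uniq: "p u = h" if "h \<in> H" "u - h \<in> W" for u h
  proof -
    have "p u - h \<in> H" by (rule subspace_diff[OF subH p(1) that(1)])
    moreover have "(u - h) - (u - p u) \<in> W" by (rule subspace_diff[OF subW that(2) pW])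
    then have "p u - h \<in> W" by simp
    ultimately have "p u - h \<in> H \<inter> W" by blast
    then show ?thesis unfolding HW by simp
  qed
  have "H \<inter> sphere 0 1 \<subseteq> - W"
  proof
    fix h assume h: "h \<in> H \<inter> sphere 0 1"
    have "h \<notin> H \<inter> W" unfolding HW using h by auto
    then show "h \<in> - W" using h by blast
  qed
  then obtain e where e: "e > 0" "(\<Union>x\<in>H \<inter> sphere 0 1. ball x e) \<subseteq> - W"
    by (rule compact_subset_open_imp_ball_epsilon_subset[OF k_dimensional_compact_sphere[OF H] open_Compl[OF W(1)]])
  have bound: "e * norm (p u) \<le> norm u" for u
  proof (cases "p u = 0")
    case False
    define a where "a = 1 / norm (p u)"
    have a: "a > 0" using False by (simp add: a_def)
    have "a *\<^sub>R p u \<in> H \<inter> sphere 0 1"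
      using p(1) subH False by (simp add: a_def subspace_scale)
    moreover have "a *\<^sub>R (p u - u) \<in> W"
      using subspace_scale[OF subW pW[of u], of "- a"] by (simp add: algebra_simps)
    ultimately have "a *\<^sub>R (p u - u) \<notin> ball (a *\<^sub>R p u) e" using e(2) by blast
    then have "e \<le> norm (a *\<^sub>R u)" by (simp add: dist_norm algebra_simps)
    then show ?thesis using False by (simp add: a_def pos_le_divide_eq)
  qed simp
  have "bounded_linear p"
  proof (rule bounded_linear_intro[where K = "1 / e"])
    fix u v and r :: real
    have "(u - p u) + (v - p v) \<in> W" by (rule subspace_add[OF subW pW pW])
    then have "(u + v) - (p u + p v) \<in> W" by (simp add: algebra_simps)
    then show "p (u + v) = p u + p v" by (rule p_uniq[OF subspace_add[OF subH p(1) p(1)]])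
    have "r *\<^sub>R (u - p u) \<in> W" by (rule subspace_scale[OF subW pW])
    then have "r *\<^sub>R u - r *\<^sub>R p u \<in> W" by (simp add: algebra_simps)
    then show "p (r *\<^sub>R u) = r *\<^sub>R p u" by (rule p_uniq[OF subspace_scale[OF subH p(1)]])
    show "norm (p u) \<le> norm u * (1 / e)" using bound[of u] e(1) by (simp add: field_simps)
  qed
  moreover have "p h = h" if "h \<in> H" for h using that subW by (intro p_uniq) (auto simp: subspace_0)
  moreover have "u \<in> W" if "p u = 0" for u using pW[of u] that by simp
  ultimately show ?thesis
    using p(1) by (intro exI[of _ "Blinfun p"]) (auto simp: bounded_linear_Blinfun_apply)
qed

lemma nonpos_of_geometric_bound:
  fixes a Q g :: real
  assumes "\<And>n. a \<le> Q * g ^ n" "0 < g" "g < 1"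
  shows "a \<le> 0"
proof (rule LIMSEQ_le_const)
  show "(\<lambda>n. Q * g ^ n) \<longlonglongrightarrow> 0"
    using assms by (intro tendsto_mult_right_zero LIMSEQ_realpow_zero) auto
qed (use assms in blast)

subsection \<open>Comparing splittings of different dimensions\<close>

lemma dominated_splittingD:
  assumes "dominated_splitting K F T k p"
  shows "continuous_on K p"
    and "x \<in> K \<Longrightarrow> k_dimensional k (range (p x))"
    and "x \<in> K \<Longrightarrow> p x (p x u) = p x u"
    and "x \<in> K \<Longrightarrow> p (F x) (T x u) = T x (p x u)"
    and "x \<in> K \<Longrightarrow> range (p (F x)) \<subseteq> T x ` range (p x)"
    and "x \<in> K \<Longrightarrow> p x v = v \<Longrightarrow> T x v = 0 \<Longrightarrow> v = 0"
  using assms unfolding dominated_splitting_def by simp_all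

lemma dominated_splittingE:
  assumes "dominated_splitting K F T k p"
  obtains R g where "R > 0" "0 < g" "g < 1"
    "\<And>x n v w. x \<in> K \<Longrightarrow> p x v = v \<Longrightarrow> p x w = 0 \<Longrightarrow>
       norm (cocycle_iter F T n x w) * norm v \<le> R * g ^ n * norm w * norm (cocycle_iter F T n x v)"
  using assms unfolding dominated_splitting_def by (elim conjE exE) simp

lemma dominated_splitting_nested:
  fixes K :: "'x::metric_space set" and T :: "'x \<Rightarrow> 'a::banach \<Rightarrow>\<^sub>L 'a"
  assumes K: "compact K" and homeo: "homeomorphism K K F G"
    and p: "dominated_splitting K F T k p" and p': "dominated_splitting K F T k' p'" and kk': "k < k'"
    and x: "x \<in> K"
  shows "p x (p' x u) = p x u" and "p' x (p x u) = p x u"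
proof -
  have F_in: "F y \<in> K" and G_in: "G y \<in> K" and FG: "F (G y) = y" if "y \<in> K" for y
    using homeo that unfolding homeomorphism_def by auto
  have Fn_in: "(F ^^ n) y \<in> K" if "y \<in> K" for n y using that by (induction n) (auto simp: F_in)
  have norm_p: "\<exists>b>0. \<forall>y\<in>K. \<forall>u. norm (q y u) \<le> b * norm u" if "dominated_splitting K F T m q" for m q
  proof -
    have "continuous_on K q" using that unfolding dominated_splitting_def by blast
    then have "bounded (q ` K)" by (intro compact_imp_bounded compact_continuous_image K)
    then obtain b where b: "b > 0" "\<And>y. y \<in> K \<Longrightarrow> norm (q y) \<le> b" unfolding bounded_pos by auto
    have "norm (q y u) \<le> b * norm u" if "y \<in> K" for y u
      using norm_blinfun[of "q y" u] mult_right_mono[OF b(2)[OF that] norm_ge_zero[of u]] by linarith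
    with b(1) show ?thesis by blast
  qed
  obtain b where b: "b > 0" "\<And>y u. y \<in> K \<Longrightarrow> norm (p y u) \<le> b * norm u" using norm_p[OF p] by blast
  obtain b' where b': "b' > 0" "\<And>y u. y \<in> K \<Longrightarrow> norm (p' y u) \<le> b' * norm u" using norm_p[OF p'] by blast
  note dim = dominated_splittingD(2)[OF p] and pp = dominated_splittingD(3)[OF p]
    and pT = dominated_splittingD(4)[OF p] and surj = dominated_splittingD(5)[OF p]
    and inj = dominated_splittingD(6)[OF p]
  note dim' = dominated_splittingD(2)[OF p'] and pp' = dominated_splittingD(3)[OF p']
    and pT' = dominated_splittingD(4)[OF p']
  let ?Tn = "cocycle_iter F T"
  obtain R g where R: "R > 0" and g: "0 < g" "g < 1" and dom: "\<And>y n v w. y \<in> K \<Longrightarrow> p y v = v \<Longrightarrow> p y w = 0 \<Longrightarrow>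
      norm (?Tn n y w) * norm v \<le> R * g ^ n * norm w * norm (?Tn n y v)"
    by (rule dominated_splittingE[OF p]) blast
  obtain R' g' where R': "R' > 0" and g': "0 < g'" "g' < 1" and dom': "\<And>y n v w. y \<in> K \<Longrightarrow> p' y v = v \<Longrightarrow> p' y w = 0 \<Longrightarrow>
      norm (?Tn n y w) * norm v \<le> R' * g' ^ n * norm w * norm (?Tn n y v)"
    by (rule dominated_splittingE[OF p']) blast
  have pTn: "p ((F ^^ n) y) (?Tn n y u) = ?Tn n y (p y u)" if "y \<in> K" for n y u
    by (induction n) (auto simp: pT[OF Fn_in[OF that]])
  have pTn': "p' ((F ^^ n) y) (?Tn n y u) = ?Tn n y (p' y u)" if "y \<in> K" for n y u
    by (induction n) (auto simp: pT'[OF Fn_in[OF that]])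
  have injn: "v = 0" if "y \<in> K" "p y v = v" "?Tn n y v = 0" for n y v
    using that(3)
  proof (induction n)
    case (Suc n)
    have "p ((F ^^ n) y) (?Tn n y v) = ?Tn n y v" using pTn[OF that(1), of n v] that(2) by simp
    then show ?case using inj[OF Fn_in[OF that(1)]] Suc by simp
  qed simp
  \<comment> \<open>Suppose \<open>f\<close> in the kernel of \<open>p'\<close> had
    \<open>v = p y f \<noteq> 0\<close>. As \<open>k < k'\<close>, some nonzero \<open>w\<close>
    lies in the range of \<open>p'\<close> and the kernel of \<open>p\<close>. The images of
    \<open>f\<close> are exponentially dominated by those of \<open>w\<close>, and these by those of
    \<open>v\<close>; but the images of \<open>v\<close> are projections of those of
    \<open>f\<close>.\<close>
  have ker: "p y f = 0" if y: "y \<in> K" and f: "p' y f = 0" for y f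
  proof (rule ccontr)
    assume "p y f \<noteq> 0"
    define v where "v = p y f"
    have v: "v \<noteq> 0" "p y v = v" using \<open>p y f \<noteq> 0\<close> pp[OF y] by (auto simp: v_def)
    have "\<exists>w. p' y w = w \<and> p y w = 0 \<and> w \<noteq> 0"
    proof (rule ccontr)
      assume neg: "\<not> ?thesis"
      have "k_dimensional k' (p y ` range (p' y))"
      proof (rule k_dimensional_linear_image[OF dim'[OF y]])
        show "linear (p y)" by (simp add: bounded_linear.linear blinfun.bounded_linear_right)
        show "w = 0" if "w \<in> range (p' y)" "p y w = 0" for w
          using neg that pp'[OF y] by blast
      qed
      then have "k' \<le> k" by (rule k_dimensional_mono[OF _ dim[OF y]]) blast
      with kk' show False by simp
    qed
    then obtain w where w: "p' y w = w" "p y w = 0" "w \<noteq> 0" by blast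
    have vn: "norm v \<le> (R' * R * b * norm f) * (g' * g) ^ n" for n
    proof -
      have "norm (?Tn n y v) \<le> b * norm (?Tn n y f)"
        using b(2)[OF Fn_in[OF y], of n "?Tn n y f"] unfolding pTn[OF y] v_def .
      moreover have "?Tn n y v \<noteq> 0" using injn[OF y v(2)] v(1) by blast
      ultimately have pos: "norm (?Tn n y f) > 0" using b(1) by (auto simp: zero_less_mult_iff)
      have "norm (?Tn n y f) * norm w * norm v \<le> R' * g' ^ n * norm f * norm (?Tn n y w) * norm v"
        using dom'[OF y w(1) f] by (intro mult_right_mono) auto
      also have "\<dots> = R' * g' ^ n * norm f * (norm (?Tn n y w) * norm v)" by simp
      also have "\<dots> \<le> R' * g' ^ n * norm f * (R * g ^ n * norm w * norm (?Tn n y v))"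
        using R' g' by (intro mult_left_mono dom[OF y v(2) w(2)]) auto
      also have "\<dots> \<le> R' * g' ^ n * norm f * (R * g ^ n * norm w * (b * norm (?Tn n y f)))"
        using R' g' R g \<open>norm (?Tn n y v) \<le> b * norm (?Tn n y f)\<close> by (intro mult_left_mono) auto
      also have "\<dots> = norm (?Tn n y f) * norm w * ((R' * R * b * norm f) * (g' * g) ^ n)"
        by (simp add: algebra_simps power_mult_distrib)
      finally show ?thesis using pos w(3) by (simp add: mult_le_cancel_left)
    qed
    have "g' * g < 1" using g g' mult_strict_mono[of g' 1 g 1] by simp
    then have "norm v \<le> 0" using g g' by (intro nonpos_of_geometric_bound[OF vn]) simp_all
    with v(1) show False by simp
  qed
  have "p x (u - p' x u) = 0" for u by (rule ker[OF x]) (simp add: blinfun.diff_right pp'[OF x])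
  then show "p x (p' x u) = p x u" for u by (simp add: blinfun.diff_right)
  have surjn: "\<exists>y v. y \<in> K \<and> (F ^^ n) y = z \<and> p y v = v \<and> ?Tn n y v = e" if "z \<in> K" "p z e = e" for n z e
    using that
  proof (induction n arbitrary: z e)
    case (Suc n)
    have "e \<in> range (p (F (G z)))" using Suc.prems FG by (metis rangeI)
    then obtain a where a: "e = T (G z) (p (G z) a)" using surj[OF G_in[OF Suc.prems(1)]] by blast
    then obtain y v where "y \<in> K" "(F ^^ n) y = G z" "p y v = v" "?Tn n y v = p (G z) a"
      using Suc.IH[OF G_in[OF Suc.prems(1)] pp[OF G_in[OF Suc.prems(1)]]] by blast
    then show ?case using a FG[OF Suc.prems(1)] by (intro exI[of _ y] exI[of _ v]) simp
  qed auto
  show "p' x (p x u) = p x u"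
  proof -
    define e where "e = p x u"
    have e: "p x e = e" by (simp add: e_def pp[OF x])
    \<comment> \<open>A range vector has a history: \<open>e\<close> is the image of some
      \<open>v\<close> in the range of \<open>p\<close> at a point \<open>n\<close> steps earlier.
      The part \<open>f\<close> of \<open>v\<close> in the kernel of \<open>p'\<close> is by the
      first half in the kernel of \<open>p\<close>, hence dominated by \<open>v\<close>, and its
      image is \<open>e - p' x e\<close> for every \<open>n\<close>.\<close>
    have "norm (e - p' x e) \<le> (R * (1 + b') * norm e) * g ^ n" for n
    proof (cases "e = 0")
      case False
      obtain y v where y: "y \<in> K" "(F ^^ n) y = x" "p y v = v" "?Tn n y v = e"
        using surjn[OF x e] by blast
      define f where "f = v - p' y v"
      have v0: "v \<noteq> 0" using y(4) False by (auto simp: blinfun.zero_right)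
      have "p' y f = 0" by (simp add: f_def blinfun.diff_right pp'[OF y(1)])
      then have pf: "p y f = 0" by (rule ker[OF y(1)])
      have Tf: "?Tn n y f = e - p' x e"
        using pTn'[OF y(1), of n v] by (simp add: f_def blinfun.diff_right y)
      have f: "norm f \<le> (1 + b') * norm v"
        using norm_triangle_ineq4[of v "p' y v"] b'(2)[OF y(1), of v] by (simp add: f_def algebra_simps)
      have "norm (e - p' x e) * norm v \<le> R * g ^ n * norm f * norm e"
        using dom[OF y(1,3) pf, of n] unfolding Tf y(4) .
      also have "\<dots> \<le> R * g ^ n * ((1 + b') * norm v) * norm e"
        using R g f by (intro mult_right_mono mult_left_mono) auto
      also have "\<dots> = (R * (1 + b') * norm e) * g ^ n * norm v" by (simp add: algebra_simps)
      finally show ?thesis using v0 by simp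
    qed (simp add: blinfun.zero_right)
    then have "norm (e - p' x e) \<le> 0" using g by (rule nonpos_of_geometric_bound)
    then show ?thesis by (simp add: e_def)
  qed
qed

subsection \<open>Bundles given by continuous families of projections\<close>

text \<open>Applying the other projection moves a unit vector by at most
  \<open>norm (p x - p y)\<close>, and normalising the result moves it at most as much again; hence
  the factor 2. \<open>k > 0\<close> keeps the unit spheres, over which \<open>gap\<close> takes
  suprema and infima, nonempty.\<close>

lemma continuous_bundle_range:
  fixes p :: "'x::topological_space \<Rightarrow> 'a::real_normed_vector \<Rightarrow>\<^sub>L 'a"
  assumes cont: "continuous_on K p" and k: "k > 0"
    and dim: "\<And>x. x \<in> K \<Longrightarrow> k_dimensional k (range (p x))"
    and pp: "\<And>x u. x \<in> K \<Longrightarrow> p x (p x u) = p x u"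
  shows "continuous_bundle K k (\<lambda>x. range (p x))"
proof -
  have ne: "range (p x) \<inter> sphere 0 1 \<noteq> {}" if x: "x \<in> K" for x
  proof -
    have "range (p x) \<noteq> {0}" using k_dimensional_unique[OF dim[OF x], of 0] k k_dimensional_0 by auto
    moreover have "p x 0 = 0" by (rule blinfun.zero_right)
    then have "0 \<in> range (p x)" by (metis rangeI)
    ultimately obtain u where "p x u \<noteq> 0" by blast
    then have "norm ((1 / norm (p x u)) *\<^sub>R p x u) = 1" by simp
    moreover have "(1 / norm (p x u)) *\<^sub>R p x u \<in> range (p x)"
      unfolding blinfun.scaleR_right[symmetric] by (rule rangeI)
    ultimately show ?thesis by (auto simp del: norm_scaleR)
  qed
  have near: "(INF u\<in>range (p y) \<inter> sphere 0 1. norm (v - u)) \<le> 2 * norm (p x - p y)"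
    if "x \<in> K" "y \<in> K" "norm (p x - p y) < 1" "v \<in> range (p x) \<inter> sphere 0 1" for x y v
  proof -
    define w where "w = p y v"
    have v: "norm v = 1" "p x v = v" using that(4) pp[OF that(1)] by auto
    have "v - w = (p x - p y) v" by (simp add: w_def blinfun.diff_left v)
    then have vw: "norm (v - w) \<le> norm (p x - p y)" using norm_blinfun[of "p x - p y" v] v(1) by simp
    then have "w \<noteq> 0" using that(3) v(1) by auto
    define u where "u = (1 / norm w) *\<^sub>R w"
    have "u = p y ((1 / norm w) *\<^sub>R v)" by (simp add: u_def w_def blinfun.scaleR_right)
    then have "u \<in> range (p y)" by simp
    moreover have "norm u = 1" using \<open>w \<noteq> 0\<close> by (simp add: u_def)
    ultimately have u: "u \<in> range (p y) \<inter> sphere 0 1" by simp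
    have "w - u = (1 - 1 / norm w) *\<^sub>R w" by (simp add: u_def algebra_simps)
    then have "norm (w - u) = \<bar>(1 - 1 / norm w) * norm w\<bar>" by (simp add: abs_mult)
    also have "\<dots> = \<bar>norm w - norm v\<bar>" using \<open>w \<noteq> 0\<close> v(1) by (simp add: algebra_simps)
    also have "\<dots> \<le> norm (v - w)" using norm_triangle_ineq3[of w v] by (simp add: norm_minus_commute)
    finally have "norm (v - u) \<le> 2 * norm (p x - p y)"
      using vw norm_triangle_ineq[of "v - w" "w - u"] by simp
    moreover have "(INF u\<in>range (p y) \<inter> sphere 0 1. norm (v - u)) \<le> norm (v - u)"
      by (intro cINF_lower bdd_belowI2[where m = 0] u) auto
    ultimately show ?thesis by linarith
  qed
  have gap_le: "\<bar>gap (range (p y)) (range (p x))\<bar> \<le> 2 * norm (p y - p x)"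
    if x: "x \<in> K" and y: "y \<in> K" and d: "norm (p y - p x) < 1" for x y
  proof -
    have d': "norm (p x - p y) < 1" "norm (p x - p y) = norm (p y - p x)"
      using d by (simp_all add: norm_minus_commute)
    have 1: "(SUP v\<in>range (p y) \<inter> sphere 0 1. INF u\<in>range (p x) \<inter> sphere 0 1. norm (v - u)) \<le> 2 * norm (p y - p x)"
      by (intro cSUP_least ne y near x d)
    have 2: "(SUP v\<in>range (p x) \<inter> sphere 0 1. INF u\<in>range (p y) \<inter> sphere 0 1. norm (v - u)) \<le> 2 * norm (p y - p x)"
      unfolding d'(2)[symmetric] by (intro cSUP_least ne y near x d')
    obtain v where v: "v \<in> range (p y) \<inter> sphere 0 1" using ne[OF y] by blast
    have "0 \<le> (INF u\<in>range (p x) \<inter> sphere 0 1. norm (v - u))"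
      by (intro cINF_greatest ne x) auto
    also have "\<dots> \<le> (SUP v\<in>range (p y) \<inter> sphere 0 1. INF u\<in>range (p x) \<inter> sphere 0 1. norm (v - u))"
      by (intro cSUP_upper v bdd_aboveI2[where M = "2 * norm (p y - p x)"] near x y d)
    finally show ?thesis using 1 2 unfolding gap_def by auto
  qed
  have "((\<lambda>y. gap (range (p y)) (range (p x))) \<longlongrightarrow> 0) (at x within K)" if x: "x \<in> K" for x
  proof (rule Lim_null_comparison)
    have lim: "((\<lambda>y. p y - p x) \<longlongrightarrow> 0) (at x within K)"
      using cont x unfolding continuous_on_def by (intro LIM_zero) blast
    show "((\<lambda>y. 2 * norm (p y - p x)) \<longlongrightarrow> 0) (at x within K)"
      by (intro tendsto_mult_right_zero tendsto_norm_zero lim)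
    have "\<forall>\<^sub>F y in at x within K. norm (p y - p x) < 1"
      using order_tendstoD(2)[OF tendsto_norm_zero[OF lim], of 1] by simp
    moreover have "\<forall>\<^sub>F y in at x within K. y \<in> K" by (simp add: eventually_at_filter)
    ultimately show "\<forall>\<^sub>F y in at x within K. norm (gap (range (p y)) (range (p x))) \<le> 2 * norm (p y - p x)"
      by eventually_elim (use gap_le x in auto)
  qed
  with dim show ?thesis unfolding continuous_bundle_def by blast
qed

text \<open>Composition with \<open>p\<close> is the adjoint of \<open>p\<close>, and its range is
  the annihilator of the kernel of \<open>p\<close>. A basis is given by the coordinates of
  \<open>p u\<close> in a basis of the range of \<open>p\<close>; they are bounded because each
  basis vector has positive distance to the closed span of the others.\<close>

lemma dual_of_projection:
  fixes p :: "'a::real_normed_vector \<Rightarrow>\<^sub>L 'a"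
  assumes dim: "k_dimensional k (range p)" and pp: "\<And>u. p (p u) = p u"
  shows "k_dimensional k (range (\<lambda>m :: 'a \<Rightarrow>\<^sub>L real. m o\<^sub>L p))"
    and "{v. \<forall>m\<in>range (\<lambda>m :: 'a \<Rightarrow>\<^sub>L real. m o\<^sub>L p). m v = 0} = {v. p v = 0}"
proof -
  obtain B where B: "finite B" "card B = k" "independent B" "span B = range p"
    using dim unfolding k_dimensional_def by blast
  have psp: "p u \<in> span B" for u using B(4) by blast
  have expand: "(\<Sum>b\<in>B. representation B (p u) b *\<^sub>R b) = p u" for u
    by (rule sum_representation_eq[OF B(3) psp B(1) order_refl])
  have "bounded_linear (\<lambda>u. representation B (p u) b)" if b: "b \<in> B" for b
  proof -
    have "b \<notin> span (B - {b})" using B(3) b dependent_def by blast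
    moreover have "closed (span (B - {b}))" using B(1) by (intro closed_finite_span) simp
    ultimately obtain d where d: "d > 0" "ball b d \<subseteq> - span (B - {b})"
      using open_contains_ball[of "- span (B - {b})"] by blast
    have est: "d * \<bar>representation B (p u) b\<bar> \<le> norm (p u)" for u
    proof (cases "representation B (p u) b = 0")
      case False
      define r where "r = representation B (p u) b"
      define w where "w = (\<Sum>c\<in>B - {b}. representation B (p u) c *\<^sub>R c)"
      have "w \<in> span (B - {b})" unfolding w_def by (intro span_sum span_scale span_base)
      then have "(- (1 / r)) *\<^sub>R w \<in> span (B - {b})" by (rule span_scale)
      then have "(- (1 / r)) *\<^sub>R w \<notin> ball b d" using d(2) by blast
      moreover have pu: "p u = r *\<^sub>R b + w"
        unfolding w_def r_def using expand[of u] B(1) b by (simp add: sum.remove)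
      have "b - (- (1 / r)) *\<^sub>R w = (1 / r) *\<^sub>R p u"
        unfolding pu using False by (simp add: r_def[symmetric] scaleR_add_right)
      ultimately have "d \<le> norm ((1 / r) *\<^sub>R p u)" by (simp only: mem_ball dist_norm not_less)
      then show ?thesis using False by (simp add: r_def pos_le_divide_eq)
    qed simp
    show ?thesis
    proof (rule bounded_linear_intro[where K = "norm p / d"])
      fix u v and r :: real
      show "representation B (p (u + v)) b = representation B (p u) b + representation B (p v) b"
        by (simp add: blinfun.add_right representation_add[OF B(3) psp psp])
      show "representation B (p (r *\<^sub>R u)) b = r *\<^sub>R representation B (p u) b"
        by (simp add: blinfun.scaleR_right representation_scale[OF B(3) psp])
      show "norm (representation B (p u) b) \<le> norm u * (norm p / d)"
        using order_trans[OF est[of u] norm_blinfun[of p u]] d(1) by (simp add: field_simps)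
    qed
  qed
  then have l_ex: "\<forall>b. \<exists>l :: 'a \<Rightarrow>\<^sub>L real. b \<in> B \<longrightarrow> (\<forall>u. l u = representation B (p u) b)"
    by (metis bounded_linear_Blinfun_apply)
  from choice[OF this] obtain l :: "'a \<Rightarrow> 'a \<Rightarrow>\<^sub>L real"
    where l: "\<And>b u. b \<in> B \<Longrightarrow> l b u = representation B (p u) b" by blast
  have pb: "p b = b" if "b \<in> B" for b
    using span_base[OF that] pp unfolding B(4) by auto
  have delta: "l b c = (if c = b then 1 else 0)" if "b \<in> B" "c \<in> B" for b c
    using l[OF that(1), of c] pb[OF that(2)] representation_basis[OF B(3) that(2)] by auto
  have inj: "inj_on l B"
    by (rule inj_onI) (metis delta zero_neq_one)
  have ind: "independent (l ` B)"
  proof (rule independent_if_scalars_zero)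
    fix f m assume sum: "(\<Sum>m\<in>l ` B. f m *\<^sub>R m) = 0" and "m \<in> l ` B"
    then obtain c where c: "c \<in> B" "m = l c" by blast
    have "(\<Sum>b\<in>B. f (l b) *\<^sub>R l b) c = 0" using sum by (simp add: sum.reindex[OF inj])
    then have "(\<Sum>b\<in>B. f (l b) * l b c) = 0" by (simp add: blinfun.sum_left blinfun.scaleR_left)
    moreover have "(\<Sum>b\<in>B. f (l b) * l b c) = (\<Sum>b\<in>B. if b = c then f (l b) else 0)"
      by (intro sum.cong) (auto simp: delta c)
    ultimately show "f m = 0" using c B(1) by simp
  qed (use B in simp)
  have lp: "l b o\<^sub>L p = l b" if "b \<in> B" for b
    by (rule blinfun_eqI) (simp add: l[OF that] pp)
  let ?A = "range (\<lambda>m :: 'a \<Rightarrow>\<^sub>L real. m o\<^sub>L p)"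
  have sub: "subspace ?A"
  proof (rule subspaceI)
    have "(0 :: 'a \<Rightarrow>\<^sub>L real) = 0 o\<^sub>L p" by simp
    then show "0 \<in> ?A" by (rule range_eqI)
    show "a + b \<in> ?A" if ab: "a \<in> ?A" "b \<in> ?A" for a b
    proof -
      obtain m m' :: "'a \<Rightarrow>\<^sub>L real" where "a = m o\<^sub>L p" "b = m' o\<^sub>L p" using ab by blast
      then have "a + b = (m + m') o\<^sub>L p" by (intro blinfun_eqI) (simp add: blinfun.add_left)
      then show ?thesis by blast
    qed
    show "c *\<^sub>R a \<in> ?A" if a: "a \<in> ?A" for a c
    proof -
      obtain m :: "'a \<Rightarrow>\<^sub>L real" where "a = m o\<^sub>L p" using a by blast
      then have "c *\<^sub>R a = (c *\<^sub>R m) o\<^sub>L p" by (intro blinfun_eqI) (simp add: blinfun.scaleR_left)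
      then show ?thesis by blast
    qed
  qed
  have "span (l ` B) = ?A"
  proof
    have "l b \<in> ?A" if "b \<in> B" for b using lp[OF that] by (metis rangeI)
    then show "span (l ` B) \<subseteq> ?A" by (intro span_minimal sub) blast
    show "?A \<subseteq> span (l ` B)"
    proof
      fix m assume "m \<in> ?A"
      then obtain m' :: "'a \<Rightarrow>\<^sub>L real" where m': "m = m' o\<^sub>L p" by blast
      have "m = (\<Sum>b\<in>B. m' b *\<^sub>R l b)"
      proof (rule blinfun_eqI)
        fix u
        have "m u = m' (\<Sum>b\<in>B. representation B (p u) b *\<^sub>R b)" unfolding expand by (simp add: m')
        also have "\<dots> = (\<Sum>b\<in>B. m' b * l b u)"
          by (simp add: blinfun.sum_right blinfun.scaleR_right l mult.commute)
        finally show "m u = (\<Sum>b\<in>B. m' b *\<^sub>R l b) u"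
          by (simp add: blinfun.sum_left blinfun.scaleR_left)
      qed
      also have "\<dots> \<in> span (l ` B)" by (intro span_sum span_scale span_base) blast
      finally show "m \<in> span (l ` B)" .
    qed
  qed
  then show "k_dimensional k ?A"
    unfolding k_dimensional_def using ind B(1,2) card_image[OF inj] by (intro exI[of _ "l ` B"]) simp
  show "{v. \<forall>m\<in>?A. m v = 0} = {v. p v = 0}"
  proof (rule set_eqI, unfold mem_Collect_eq)
    fix v
    show "(\<forall>m\<in>?A. m v = 0) \<longleftrightarrow> p v = 0"
    proof
      assume *: "\<forall>m\<in>?A. m v = 0"
      have "representation B (p v) b = 0" if "b \<in> B" for b
        using * lp[OF that] l[OF that] by (metis rangeI)
      then show "p v = 0" using expand[of v] by simp
    qed (auto simp: blinfun.zero_right)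
  qed
qed

text \<open>Passing to the adjoint is bounded linear and preserves idempotence, so the annihilators
  of the kernels form a continuous bundle by \<open>continuous_bundle_range\<close>, applied in the
  dual space.\<close>

lemma codim_continuous_bundle_ker:
  fixes p :: "'x::topological_space \<Rightarrow> 'a::real_normed_vector \<Rightarrow>\<^sub>L 'a"
  assumes cont: "continuous_on K p" and k: "k > 0"
    and dim: "\<And>x. x \<in> K \<Longrightarrow> k_dimensional k (range (p x))"
    and pp: "\<And>x u. x \<in> K \<Longrightarrow> p x (p x u) = p x u"
  shows "codim_continuous_bundle K k (\<lambda>x. {v. p x v = 0})"
proof -
  have "closed {v. p x v = 0}" for x
    by (intro closed_Collect_eq continuous_intros)
  moreover have "k_codimensional k {v. p x v = 0}" if x: "x \<in> K" for x
    unfolding k_codimensional_def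
  proof (intro conjI exI[of _ "range (p x)"])
    show "subspace {v. p x v = 0}"
      by (intro subspaceI) (auto simp: blinfun.zero_right blinfun.add_right blinfun.scaleR_right)
    show "range (p x) \<inter> {v. p x v = 0} = {0}"
      using pp[OF x] by (auto simp: blinfun.zero_right intro: image_eqI[of _ _ 0])
    have "u \<in> {u + v |u v. u \<in> range (p x) \<and> v \<in> {v. p x v = 0}}" for u
    proof -
      have "u = p x u + (u - p x u)" "p x (u - p x u) = 0" by (simp_all add: blinfun.diff_right pp[OF x])
      then show ?thesis by blast
    qed
    then show "{u + v |u v. u \<in> range (p x) \<and> v \<in> {v. p x v = 0}} = UNIV" by blast
  qed (rule dim[OF x])
  moreover
  define adj :: "('a \<Rightarrow>\<^sub>L 'a) \<Rightarrow> ('a \<Rightarrow>\<^sub>L real) \<Rightarrow>\<^sub>L ('a \<Rightarrow>\<^sub>L real)"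
    where "adj = bounded_bilinear.prod_left (o\<^sub>L)"
  have adj: "adj q m = m o\<^sub>L q" for q m
    unfolding adj_def by (simp add: bounded_bilinear.prod_left.rep_eq[OF bounded_bilinear_blinfun_compose])
  have "bounded_linear adj"
    unfolding adj_def by (rule bounded_bilinear.bounded_linear_prod_left[OF bounded_bilinear_blinfun_compose])
  then have "continuous_on K (\<lambda>x. adj (p x))" by (rule bounded_linear.continuous_on[OF _ cont])
  then have "continuous_bundle K k (\<lambda>x. range (adj (p x)))"
  proof (rule continuous_bundle_range[OF _ k])
    show "k_dimensional k (range (adj (p x)))" if x: "x \<in> K" for x
      using dual_of_projection(1)[OF dim[OF x] pp[OF x]] by (simp add: adj)
    show "adj (p x) (adj (p x) m) = adj (p x) m" if x: "x \<in> K" for x m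
      by (rule blinfun_eqI) (simp add: adj pp[OF x])
  qed
  moreover have "{v. \<forall>m\<in>range (adj (p x)). m v = 0} = {v. p x v = 0}" if x: "x \<in> K" for x
    using dual_of_projection(2)[OF dim[OF x] pp[OF x]] by (simp add: adj)
  ultimately show ?thesis unfolding codim_continuous_bundle_def by blast
qed

subsection \<open>Characteristic exponents\<close>

text \<open>One \<open>w\<close> is enough to bound the infimum for \<open>P' x\<close> from above,
  while all \<open>v\<close> enter the infimum for \<open>P x\<close>; so domination passes to the
  minimal expansions as \<open>m' n \<le> R * g ^ n * m n\<close>. After the logarithm and division
  by \<open>n\<close>, the constant \<open>R\<close> disappears in the limit.\<close>

lemma char_exponent_gap:
  fixes T :: "'x \<Rightarrow> 'a::real_normed_vector \<Rightarrow>\<^sub>L 'a"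
  assumes R: "R > 0" and g: "g > 0"
    and ne: "P x \<inter> sphere 0 1 \<noteq> {}" "P' x \<inter> sphere 0 1 \<noteq> {}"
    and dom: "\<And>n v w. v \<in> P x \<inter> sphere 0 1 \<Longrightarrow> w \<in> P' x \<inter> sphere 0 1 \<Longrightarrow>
      norm (cocycle_iter F T n x w) \<le> R * g ^ n * norm (cocycle_iter F T n x v)"
  shows "char_exponent F T P x + ereal (ln g) \<ge> char_exponent F T P' x"
proof -
  define m where "m n = min_expansion (cocycle_iter F T n x) (P x)" for n
  define m' where "m' n = min_expansion (cocycle_iter F T n x) (P' x)" for n
  have mm': "m' n \<le> R * g ^ n * m n" for n
  proof -
    obtain w where w: "w \<in> P' x \<inter> sphere 0 1" using ne(2) by blast
    have "m' n \<le> norm (cocycle_iter F T n x w)"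
      unfolding m'_def min_expansion_def by (intro cINF_lower bdd_belowI2[where m = 0] w) auto
    also have "\<dots> \<le> R * g ^ n * norm (cocycle_iter F T n x v)" if "v \<in> P x \<inter> sphere 0 1" for v
      by (rule dom[OF that w])
    finally have "m' n / (R * g ^ n) \<le> norm (cocycle_iter F T n x v)" if "v \<in> P x \<inter> sphere 0 1" for v
      using that R g by (simp add: divide_le_eq mult.commute)
    then have "m' n / (R * g ^ n) \<le> m n"
      unfolding m_def min_expansion_def by (intro cINF_greatest ne) auto
    then show ?thesis using R g by (simp add: divide_le_eq mult.commute)
  qed
  define e where "e n = ln R * (1 / real n) + ln g" for n
  \<comment> \<open>At \<open>n = 0\<close> the weight \<open>1 / real n\<close> is 0 and the
    inequality would claim \<open>0 \<le> ln g\<close>; the limsup does not see that index.\<close>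
  have le: "ereal (1 / real n) * log_ext (m' n) \<le> ereal (e n) + ereal (1 / real n) * log_ext (m n)" if n: "n > 0" for n
  proof (cases "m' n \<le> 0")
    case True
    then show ?thesis using n by (simp add: log_ext_def)
  next
    case False
    then have m'0: "m' n > 0" by simp
    then have m0: "m n > 0" using mm'[of n] R g by (smt (verit) mult_nonneg_nonpos mult_pos_pos zero_less_power)
    have "ln (m' n) \<le> ln (R * g ^ n * m n)" using m'0 mm'[of n] by simp
    also have "\<dots> = ln R + real n * ln g + ln (m n)"
      using R g m0 by (simp add: ln_mult ln_realpow)
    finally have "(1 / real n) * ln (m' n) \<le> (1 / real n) * (ln R + real n * ln g + ln (m n))"
      using n by (intro mult_left_mono) auto
    also have "\<dots> = e n + (1 / real n) * ln (m n)" using n by (simp add: e_def field_simps)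
    finally show ?thesis using m'0 m0 by (simp add: log_ext_def)
  qed
  have "e \<longlonglongrightarrow> ln R * 0 + ln g" unfolding e_def by (intro tendsto_intros lim_1_over_n)
  then have e: "(\<lambda>n. ereal (e n)) \<longlonglongrightarrow> ereal (ln g)" by simp
  have "char_exponent F T P' x \<le> limsup (\<lambda>n. ereal (e n) + ereal (1 / real n) * log_ext (m n))"
    unfolding char_exponent_def m'_def[symmetric]
    by (intro Limsup_mono eventually_mono[OF eventually_gt_at_top[of 0] le])
  also have "\<dots> = ereal (ln g) + char_exponent F T P x"
    unfolding char_exponent_def m_def by (rule ereal_limsup_lim_add[OF e]) simp
  finally show ?thesis by (simp add: add.commute)
qed

section \<open>From the cones to the decomposition\<close>

lemma complemented_cone_splitting:
  fixes K :: "'x::metric_space set" and T :: "'x \<Rightarrow> 'a::banach \<Rightarrow>\<^sub>L 'a"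
  assumes K: "compact K" "homeomorphism K K F G" "continuous_on K T" "\<And>x. x \<in> K \<Longrightarrow> compact_operator (T x)"
    and C: "complemented_cone k C" "k_solid_cone k C"
    and inv: "\<And>x v. x \<in> K \<Longrightarrow> v \<in> C \<Longrightarrow> v \<noteq> 0 \<Longrightarrow> T x v \<in> interior C - {0}"
  shows "\<exists>p. dominated_splitting K F T k p \<and>
     (\<forall>x\<in>K. range (p x) - {0} \<subseteq> interior C \<and> (\<forall>v\<in>C. p x v = 0 \<longrightarrow> v = 0))"
proof -
  have cone: "closed C" "\<And>r v. v \<in> C \<Longrightarrow> r *\<^sub>R v \<in> C"
    using C(1) unfolding complemented_cone_def k_cone_def by blast+
  obtain W where W: "closed W" "k_codimensional k W" "W - {0} \<subseteq> - C"
    using C(1) unfolding complemented_cone_def by blast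
  obtain H where H: "k_dimensional k H" "H - {0} \<subseteq> interior C"
    using C(2) unfolding k_solid_cone_def by blast
  have "0 \<in> C"
  proof -
    obtain L where "k_dimensional k L" "L \<subseteq> C"
      using C(1) unfolding complemented_cone_def k_cone_def by blast
    then show ?thesis using k_dimensional_subspace subspace_0 by blast
  qed
  have HW: "H \<inter> W = {0}"
  proof
    show "H \<inter> W \<subseteq> {0}" using H(2) W(3) interior_subset by blast
    show "{0} \<subseteq> H \<inter> W"
      using k_dimensional_subspace[OF H(1)] W(2) subspace_0 unfolding k_codimensional_def by blast
  qed
  from projection_along_closed[OF H(1) W(1,2) HW]
  obtain q :: "'a \<Rightarrow>\<^sub>L 'a" where q: "\<And>u. q u \<in> H" "\<And>h. h \<in> H \<Longrightarrow> q h = h" "\<And>u. q u = 0 \<Longrightarrow> u \<in> W"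
    by blast
  interpret cone_cocycle K F G T C H k q
  proof
    show "v = 0" if "v \<in> C" "q v = 0" for v using q(3)[OF that(2)] that(1) W(3) by blast
  qed (fact K cone \<open>0 \<in> C\<close> H q inv | rule K cone q inv; assumption)+
  show ?thesis by (rule splitting)
qed

lemma k_cone_interior_zero:
  fixes C :: "'a::real_normed_vector set"
  assumes "k_cone k C" "0 \<in> interior C"
  shows "C = UNIV"
proof -
  obtain e where e: "e > 0" "ball 0 e \<subseteq> C"
    using assms(2) unfolding mem_interior by blast
  have "v \<in> C" for v
  proof (cases "v = 0")
    case False
    define a where "a = e / (2 * norm v)"
    have a: "a > 0" "a * norm v < e" using e(1) False by (auto simp: a_def)
    then have "a *\<^sub>R v \<in> C" using e(2) by auto
    then have "(1 / a) *\<^sub>R (a *\<^sub>R v) \<in> C" using assms(1) unfolding k_cone_def by blast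
    then show ?thesis using a(1) by simp
  qed (use e in auto)
  then show ?thesis by blast
qed

text \<open>A cone with \<open>0\<close> in its interior is the whole space, whose dimension is then
  at most \<open>k\<close>, leaving no room for the \<open>k'\<close>-dimensional subspace of the
  other cone. So only the cone of largest rank in a family can be the whole space.\<close>

lemma cone_interior_nonzero:
  fixes C C' :: "'a::real_normed_vector set"
  assumes C: "k_cone k C" and C': "k_cone k' C'" and kk': "k < k'"
  shows "0 \<notin> interior C"
proof
  assume "0 \<in> interior C"
  then have "C = UNIV" using k_cone_interior_zero[OF C] by blast
  then obtain m where m: "m \<le> k" "k_dimensional m (UNIV :: 'a set)"
    using C subspace_UNIV unfolding k_cone_def by blast
  obtain H :: "'a set" where "k_dimensional k' H" using C' unfolding k_cone_def by blast
  then have "k' \<le> m" using k_dimensional_mono m(2) by blast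
  with m(1) kk' show False by simp
qed

text \<open>The last hypothesis concerns the case \<open>C N = UNIV\<close>. Then the space has
  dimension \<open>k N\<close>, strong invariance of \<open>C N\<close> says nothing, and
  \<open>Q x\<close> must be \<open>{0}\<close>; the asserted equality of images for all
  \<open>P i\<close> makes each \<open>T x\<close> surjective, hence injective.\<close>

theorem theoremA:
  fixes K :: "'a::banach set"
    and F :: "'a \<Rightarrow> 'a"
    and T :: "'a \<Rightarrow> ('a \<Rightarrow>\<^sub>L 'a)"
    and N :: nat
    and k j :: "nat \<Rightarrow> nat"
    and C :: "nat \<Rightarrow> 'a set"
  assumes "compact K" and "K \<noteq> {}"
    and "\<exists>G. homeomorphism K K F G"
    and "continuous_on K T"
    and "\<forall>x\<in>K. compact_operator (T x)"
    and "N \<ge> 1"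
    and "0 < k 0" and "\<forall>i<N. k i < k (Suc i)"
    and "j 0 = k 0" and "\<forall>i<N. j (Suc i) = k (Suc i) - k i"
    and "\<forall>i\<le>N. complemented_cone (k i) (C i) \<and> k_solid_cone (k i) (C i)"
    and "strongly_invariant K T N C"
    and "C N = UNIV \<longrightarrow> (\<forall>x\<in>K. inj (blinfun_apply (T x)))"
  shows "\<exists>P Q.
    quasi_all_invariant_decomposition K F T N j P Q \<and>
    (\<forall>i\<le>N. continuous_bundle K (j i) (P i)) \<and> codim_continuous_bundle K (k N) Q \<and>
    (\<forall>x\<in>K. direct_sum_decomp N (\<lambda>i. P i x) (Q x)) \<and>
    (\<forall>x\<in>K. (\<forall>i\<le>N. blinfun_apply (T x) ` P i x = P i (F x)) \<and>
            blinfun_apply (T x) ` Q x \<subseteq> Q (F x)) \<and>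
    (\<forall>x\<in>K. P 0 x - {0} \<subseteq> interior (C 0) \<and>
            (\<forall>i<N. P (Suc i) x - {0} \<subseteq> interior (C (Suc i)) - C i)) \<and>
    (\<forall>x\<in>K. Q x - {0} \<subseteq> - C N) \<and>
    (\<forall>i<N. \<exists>\<gamma>::real. 0 < \<gamma> \<and> \<gamma> < 1 \<and>
       (\<forall>x\<in>K. char_exponent F T (P i) x + ereal (ln \<gamma>) \<ge> char_exponent F T (P (Suc i)) x))"
proof -
  obtain G where G: "homeomorphism K K F G" using assms(3) by blast
  have F_in: "F x \<in> K" if "x \<in> K" for x using G that unfolding homeomorphism_def by auto
  have cone: "complemented_cone (k i) (C i)" "k_solid_cone (k i) (C i)" "k_cone (k i) (C i)" if "i \<le> N" for i
    using assms(11) that unfolding k_solid_cone_def by auto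
  have kmono: "i \<le> l \<Longrightarrow> k i < k (Suc l)" if "l < N" for i l
    using that
  proof (induction l)
    case (Suc l)
    then show ?case using assms(8) by (cases "i = Suc l") (auto intro: less_trans)
  qed (use assms(8) in auto)
  have kless: "k i < k l" if "i < l" "l \<le> N" for i l
    using kmono[of "l - 1" i] that by (cases l) auto
  have kpos: "k i > 0" if "i \<le> N" for i
    using kless[of 0 i] assms(7) that by (cases i) auto
  have inv: "T x v \<in> interior (C i) - {0}" if "i \<le> N" "x \<in> K" "v \<in> C i" "v \<noteq> 0" for i x v
  proof -
    have int: "T x v \<in> interior (C i)"
      using assms(12) that unfolding strongly_invariant_def by blast
    \<comment> \<open>A zero image would put \<open>0\<close> into the interior of
      \<open>C i\<close>, which makes \<open>C i\<close> the whole space: impossible below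
      \<open>N\<close> by dimension, and at \<open>N\<close> excluded by injectivity.\<close>
    have "T x v \<noteq> 0"
    proof
      assume T0: "T x v = 0"
      then have zero: "0 \<in> interior (C i)" using int by simp
      show False
      proof (cases "i = N")
        case True
        then have "inj (T x)" using k_cone_interior_zero[OF cone(3) zero] assms(13) that by blast
        then have "v = 0" using T0 injD[of "T x" v 0] by (simp add: blinfun.zero_right)
        then show False using that by simp
      next
        case False
        then have "i < N" using that by simp
        then show False using cone_interior_nonzero[OF cone(3) cone(3) kless, of i N] zero by simp
      qed
    qed
    with int show ?thesis by simp
  qed
  have split: "\<exists>p. dominated_splitting K F T (k i) p \<and>
      (\<forall>x\<in>K. range (p x) - {0} \<subseteq> interior (C i) \<and> (\<forall>v\<in>C i. p x v = 0 \<longrightarrow> v = 0))" if "i \<le> N" for i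
    by (rule complemented_cone_splitting[OF assms(1) G assms(4) _ cone(1)[OF that] cone(2)[OF that] inv[OF that]])
      (use assms(5) in auto)
  define p where "p i = (SOME p. dominated_splitting K F T (k i) p \<and>
      (\<forall>x\<in>K. range (p x) - {0} \<subseteq> interior (C i) \<and> (\<forall>v\<in>C i. p x v = 0 \<longrightarrow> v = 0)))" for i
  note p_some = someI_ex[OF split, folded p_def]
  have p: "dominated_splitting K F T (k i) (p i)" if "i \<le> N" for i
    using p_some[OF that] by (rule conjunct1)
  have p_int: "range (p i x) - {0} \<subseteq> interior (C i)" if "i \<le> N" "x \<in> K" for i x
    using bspec[OF conjunct2[OF p_some[OF that(1)]] that(2)] by (rule conjunct1)
  have p_ker: "v = 0" if "i \<le> N" "x \<in> K" "v \<in> C i" "p i x v = 0" for i x v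
    using bspec[OF conjunct2[OF p_some[OF that(1)]] that(2)] that(3,4) by simp
  note cont = dominated_splittingD(1)[OF p] and dim = dominated_splittingD(2)[OF p]
    and pp = dominated_splittingD(3)[OF p] and pT = dominated_splittingD(4)[OF p]
    and surj = dominated_splittingD(5)[OF p]
  \<comment> \<open>The projections form a commuting chain. This identity yields the whole algebra
    of the differences \<open>e i\<close>: they are mutually annihilating idempotents with sum
    \<open>p N\<close>.\<close>
  have pmin: "p i x (p l x u) = p (min i l) x u" if "i \<le> N" "l \<le> N" "x \<in> K" for i l x u
  proof -
    consider "i < l" | "i = l" | "l < i" by linarith
    then show ?thesis
    proof cases
      case 1
      then show ?thesis
        using dominated_splitting_nested(1)[OF assms(1) G p p kless, of i l] that by simp
    next
      case 2
      then show ?thesis using pp that by simp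
    next
      case 3
      then show ?thesis
        using dominated_splitting_nested(2)[OF assms(1) G p p kless, of l i] that by simp
    qed
  qed
  define e where "e i x = (case i of 0 \<Rightarrow> p 0 x | Suc l \<Rightarrow> p (Suc l) x - p l x)" for i x
  have e_0: "e 0 x = p 0 x" and e_Suc: "e (Suc i) x = p (Suc i) x - p i x" for i x
    by (simp_all add: e_def)
  have ee: "e i x (e l x u) = (if i = l then e i x u else 0)" if "i \<le> N" "l \<le> N" "x \<in> K" for i l x u
    using that by (cases i; cases l)
      (auto simp: e_0 e_Suc blinfun.diff_left blinfun.diff_right pmin min_def not_less_eq_eq)
  have pe: "p N x (e i x u) = e i x u" if "i \<le> N" "x \<in> K" for i x u
    using that by (cases i) (auto simp: e_0 e_Suc blinfun.diff_left blinfun.diff_right pmin min_def)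
  have ep: "e i x (p N x u) = e i x u" if "i \<le> N" "x \<in> K" for i x u
    using that by (cases i) (auto simp: e_0 e_Suc blinfun.diff_left blinfun.diff_right pmin min_def)
  have esum: "(\<Sum>i\<le>n. e i x u) = p n x u" for n x u
    by (induction n) (auto simp: e_0 e_Suc blinfun.diff_left)
  have eT: "e i (F x) (T x u) = T x (e i x u)" if "i \<le> N" "x \<in> K" for i x u
    using that by (cases i) (auto simp: e_0 e_Suc blinfun.diff_left blinfun.diff_right pT)
  have econt: "continuous_on K (e i)" if "i \<le> N" for i
    using that by (cases i) (auto simp: e_0[abs_def] e_Suc[abs_def] intro!: continuous_intros cont)
  have e_in_p: "p i x (e i x u) = e i x u" if "i \<le> N" "x \<in> K" for i x u
    using that by (cases i) (auto simp: e_0 e_Suc blinfun.diff_left blinfun.diff_right pmin min_def)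
  have e_ker: "p i x (e (Suc i) x u) = 0" if "i < N" "x \<in> K" for i x u
    using that by (simp add: e_Suc blinfun.diff_left blinfun.diff_right pmin min_def)
  have e_range: "e i x v = v" if "i \<le> N" "x \<in> K" "v \<in> range (e i x)" for i x v
    using that ee by auto
  have edim: "k_dimensional (j i) (range (e i x))" if i: "i \<le> N" and x: "x \<in> K" for i x
  proof (cases i)
    case 0
    then show ?thesis using dim[of 0] x assms(9) by (simp add: e_0)
  next
    case (Suc l)
    have sub: "subspace (range (e i x))"
      by (rule linear_subspace_image) (auto simp: bounded_linear.linear blinfun.bounded_linear_right)
    have "range (e i x) \<subseteq> range (p i x)" using e_in_p[OF i x] by (metis image_subsetI rangeI)
    then obtain m where m: "k_dimensional m (range (e i x))"
      using k_dimensional_subset[OF dim[OF i x] sub] by blast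
    \<comment> \<open>The dimension \<open>m\<close> is found by subtraction:
      \<open>range (p i x)\<close> is the direct sum of \<open>range (p l x)\<close> and
      \<open>range (e i x)\<close>.\<close>
    have "range (p l x) \<inter> range (e i x) = {0}"
    proof
      show "range (p l x) \<inter> range (e i x) \<subseteq> {0}"
      proof
        fix v assume v: "v \<in> range (p l x) \<inter> range (e i x)"
        then have "p l x v = v" using pp[of l x] i x Suc by auto
        moreover have "p l x v = 0" using v e_ker[of l x] i x Suc by auto
        ultimately show "v \<in> {0}" by simp
      qed
      show "{0} \<subseteq> range (p l x) \<inter> range (e i x)"
        using blinfun.zero_right by (metis IntI empty_subsetI insert_subset rangeI)
    qed
    then have "k_dimensional (k l + m) {u + v |u v. u \<in> range (p l x) \<and> v \<in> range (e i x)}"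
      using i Suc by (intro k_dimensional_sum dim x m) auto
    moreover have "{u + v |u v. u \<in> range (p l x) \<and> v \<in> range (e i x)} = range (p i x)"
    proof
      show "{u + v |u v. u \<in> range (p l x) \<and> v \<in> range (e i x)} \<subseteq> range (p i x)"
      proof clarify
        fix u v
        have "p l x u + e i x v = p i x (p l x u + e i x v)"
          using i x Suc by (simp add: blinfun.add_right pmin min_def e_in_p)
        then show "p l x u + e i x v \<in> range (p i x)" by (rule range_eqI)
      qed
      show "range (p i x) \<subseteq> {u + v |u v. u \<in> range (p l x) \<and> v \<in> range (e i x)}"
      proof clarify
        fix u
        have "p i x u = p l x u + e i x u" by (simp add: Suc e_Suc blinfun.diff_left)
        then show "\<exists>a b. p i x u = a + b \<and> a \<in> range (p l x) \<and> b \<in> range (e i x)" by blast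
      qed
    qed
    ultimately have "k l + m = k i" using k_dimensional_unique[OF _ dim[OF i x]] by simp
    then have "m = j i" using assms(10) i Suc by auto
    with m show ?thesis by simp
  qed
  have jpos: "j i > 0" if "i \<le> N" for i
    using that assms(7-10) by (cases i) auto
  have jsum: "(\<Sum>l\<le>n. j l) = k n" if "n \<le> N" for n
    using that
  proof (induction n)
    case (Suc n)
    then show ?case using assms(8,10) by (simp add: less_imp_le)
  qed (use assms(9) in simp)
  define P where "P i x = range (e i x)" for i x
  define Q where "Q x = {v. p N x v = 0}" for x
  have bundles: "\<forall>i\<le>N. continuous_bundle K (j i) (P i)"
    unfolding P_def using econt jpos edim ee by (intro allI impI continuous_bundle_range) auto
  have codim: "codim_continuous_bundle K (k N) Q"
    unfolding Q_def using cont kpos dim pp by (intro codim_continuous_bundle_ker) auto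
  have decomp: "\<forall>x\<in>K. direct_sum_decomp N (\<lambda>i. P i x) (Q x)"
  proof
    fix x assume x: "x \<in> K"
    have comps: "e i x ((\<Sum>l\<le>N. \<pi> l) + q) = \<pi> i"
      if \<pi>: "\<And>l. l \<le> N \<Longrightarrow> \<pi> l \<in> P l x" and q: "p N x q = 0" and i: "i \<le> N" for \<pi> q i
    proof -
      have "e i x q = 0" using ep[OF i x, of q] q by (simp add: blinfun.zero_right)
      moreover have "e i x (\<pi> l) = (if i = l then \<pi> l else 0)" if "l \<le> N" for l
      proof -
        have el: "e l x (\<pi> l) = \<pi> l" using e_range[OF that x] \<pi>[OF that] unfolding P_def by blast
        show ?thesis using ee[OF i that x, of "\<pi> l"] unfolding el by (auto simp: el)
      qed
      then have "(\<Sum>l\<le>N. e i x (\<pi> l)) = (\<Sum>l\<le>N. if i = l then \<pi> l else 0)" by (intro sum.cong) auto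
      ultimately show ?thesis using i by (simp add: blinfun.add_right blinfun.sum_right)
    qed
    show "direct_sum_decomp N (\<lambda>i. P i x) (Q x)"
      unfolding direct_sum_decomp_def
    proof (rule bij_betw_byWitness[where f' = "\<lambda>u. (restrict (\<lambda>i. e i x u) {..N}, u - p N x u)"])
      show "\<forall>a\<in>(\<Pi>\<^sub>E i\<in>{..N}. P i x) \<times> Q x. (\<lambda>u. (restrict (\<lambda>i. e i x u) {..N}, u - p N x u))
          ((\<lambda>(p, q). (\<Sum>i\<le>N. p i) + q) a) = a"
      proof
        fix a assume "a \<in> (\<Pi>\<^sub>E i\<in>{..N}. P i x) \<times> Q x"
        then obtain \<pi> q where a: "a = (\<pi>, q)" and \<pi>: "\<pi> \<in> (\<Pi>\<^sub>E i\<in>{..N}. P i x)" and q: "q \<in> Q x"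
          by blast
        let ?u = "(\<Sum>l\<le>N. \<pi> l) + q"
        have *: "e i x ?u = \<pi> i" if "i \<le> N" for i
          using comps[of \<pi> q i] \<pi> q that by (auto simp: Q_def PiE_iff)
        then have "restrict (\<lambda>i. e i x ?u) {..N} = \<pi>"
          using \<pi> by (intro ext) (auto simp: restrict_def PiE_iff extensional_def)
        moreover have "p N x ?u = (\<Sum>l\<le>N. \<pi> l)"
          unfolding esum[symmetric] using * by (intro sum.cong) auto
        ultimately show "(\<lambda>u. (restrict (\<lambda>i. e i x u) {..N}, u - p N x u)) ((\<lambda>(p, q). (\<Sum>i\<le>N. p i) + q) a) = a"
          by (simp add: a)
      qed
      show "\<forall>u\<in>UNIV. (\<lambda>(p, q). (\<Sum>i\<le>N. p i) + q) (restrict (\<lambda>i. e i x u) {..N}, u - p N x u) = u"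
        by (simp add: esum)
      show "(\<lambda>(p, q). (\<Sum>i\<le>N. p i) + q) ` ((\<Pi>\<^sub>E i\<in>{..N}. P i x) \<times> Q x) \<subseteq> UNIV" by simp
      show "(\<lambda>u. (restrict (\<lambda>i. e i x u) {..N}, u - p N x u)) ` UNIV \<subseteq> (\<Pi>\<^sub>E i\<in>{..N}. P i x) \<times> Q x"
        using pp[OF order_refl x] by (auto simp: P_def Q_def blinfun.diff_right split: if_splits)
    qed
  qed
  have invariance: "\<forall>x\<in>K. (\<forall>i\<le>N. blinfun_apply (T x) ` P i x = P i (F x)) \<and>
      blinfun_apply (T x) ` Q x \<subseteq> Q (F x)"
  proof (intro ballI conjI allI impI)
    fix x i assume x: "x \<in> K" and i: "i \<le> N"
    show "T x ` P i x = P i (F x)"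
    proof
      show "T x ` P i x \<subseteq> P i (F x)"
      proof
        fix v assume "v \<in> T x ` P i x"
        then obtain u where "v = T x (e i x u)" unfolding P_def by blast
        then have "v = e i (F x) (T x u)" using eT[OF i x] by simp
        then show "v \<in> P i (F x)" unfolding P_def by (rule range_eqI)
      qed
      show "P i (F x) \<subseteq> T x ` P i x"
      proof
        fix v assume v: "v \<in> P i (F x)"
        have ev: "e i (F x) v = v" by (rule e_range[OF i F_in[OF x] v[unfolded P_def]])
        have "v = p i (F x) v" using e_in_p[OF i F_in[OF x], of v] unfolding ev by (rule sym)
        then have "v \<in> range (p i (F x))" by (rule range_eqI)
        then have "v \<in> T x ` range (p i x)" by (rule subsetD[OF surj[OF i x]])
        \<comment> \<open>This \<open>w\<close> may have components in other bundles; its component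
          \<open>e i x w\<close> has the same image, since \<open>e i\<close> commutes with
          \<open>T\<close> and fixes \<open>v\<close>.\<close>
        then obtain w where "v = T x w" by blast
        then have "v = T x (e i x w)" using eT[OF i x, of w] ev by simp
        then show "v \<in> T x ` P i x" unfolding P_def by blast
      qed
    qed
  next
    fix x assume x: "x \<in> K"
    show "T x ` Q x \<subseteq> Q (F x)"
      unfolding Q_def using pT[OF order_refl x] by (auto simp: blinfun.zero_right)
  qed
  have cones: "\<forall>x\<in>K. P 0 x - {0} \<subseteq> interior (C 0) \<and>
      (\<forall>i<N. P (Suc i) x - {0} \<subseteq> interior (C (Suc i)) - C i)"
  proof (intro ballI conjI allI impI)
    fix x assume x: "x \<in> K"
    show "P 0 x - {0} \<subseteq> interior (C 0)" using p_int[of 0 x] x by (simp add: P_def e_0)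
    fix i assume i: "i < N"
    show "P (Suc i) x - {0} \<subseteq> interior (C (Suc i)) - C i"
    proof
      fix v assume v: "v \<in> P (Suc i) x - {0}"
      then obtain u where u: "v = e (Suc i) x u" unfolding P_def by blast
      then have "v = p (Suc i) x v" using e_in_p[of "Suc i" x u] i x by simp
      then have "v \<in> range (p (Suc i) x)" by (rule range_eqI)
      then have "v \<in> interior (C (Suc i))" using p_int[OF _ x, of "Suc i"] i v by auto
      moreover have "p i x v = 0" using e_ker[OF i x] u by simp
      then have "v \<notin> C i" using p_ker[of i x v] i x v by auto
      ultimately show "v \<in> interior (C (Suc i)) - C i" by blast
    qed
  qed
  have coneQ: "\<forall>x\<in>K. Q x - {0} \<subseteq> - C N"
    using p_ker[OF order_refl] unfolding Q_def by blast
  have exponents: "\<forall>i<N. \<exists>\<gamma>::real. 0 < \<gamma> \<and> \<gamma> < 1 \<and>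
      (\<forall>x\<in>K. char_exponent F T (P i) x + ereal (ln \<gamma>) \<ge> char_exponent F T (P (Suc i)) x)"
  proof (intro allI impI)
    fix i assume i: "i < N"
    \<comment> \<open>The splitting of \<open>C i\<close> separates the two bundles:
      \<open>P i x\<close> lies in the range of \<open>p i x\<close> and \<open>P (Suc i) x\<close>
      in its kernel, so its domination rate \<open>g\<close> serves as \<gamma> for all
      \<open>x\<close> at once.\<close>
    obtain R g where R: "R > 0" and g: "0 < g" "g < 1" and dom: "\<And>x n v w. x \<in> K \<Longrightarrow> p i x v = v \<Longrightarrow> p i x w = 0 \<Longrightarrow>
        norm (cocycle_iter F T n x w) * norm v \<le> R * g ^ n * norm w * norm (cocycle_iter F T n x v)"
      by (rule dominated_splittingE[OF p[OF less_imp_le[OF i]]]) blast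
    have ne: "P l x \<inter> sphere 0 1 \<noteq> {}" if l: "l \<le> N" and x: "x \<in> K" for l x
    proof -
      have d: "k_dimensional (j l) (P l x)" unfolding P_def by (rule edim[OF l x])
      have "P l x \<noteq> {0}" using d k_dimensional_unique[OF d, of 0] jpos[OF l] k_dimensional_0 by auto
      moreover have "0 \<in> P l x" by (rule subspace_0[OF k_dimensional_subspace[OF d]])
      ultimately obtain v where v: "v \<in> P l x" "v \<noteq> 0" by blast
      then have "(1 / norm v) *\<^sub>R v \<in> P l x \<inter> sphere 0 1"
        using subspace_scale[OF k_dimensional_subspace[OF d]] by simp
      then show ?thesis by blast
    qed
    have "char_exponent F T (P i) x + ereal (ln g) \<ge> char_exponent F T (P (Suc i)) x" if x: "x \<in> K" for x
    proof (rule char_exponent_gap[OF R g(1)])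
      show "P i x \<inter> sphere 0 1 \<noteq> {}" "P (Suc i) x \<inter> sphere 0 1 \<noteq> {}" using ne x i by auto
      fix n v w assume v: "v \<in> P i x \<inter> sphere 0 1" and w: "w \<in> P (Suc i) x \<inter> sphere 0 1"
      have "p i x v = v" using v e_in_p[of i x] i x by (auto simp: P_def)
      moreover have "p i x w = 0" using w e_ker[OF i x] by (auto simp: P_def)
      ultimately show "norm (cocycle_iter F T n x w) \<le> R * g ^ n * norm (cocycle_iter F T n x v)"
        using dom[OF x, of v w n] v w by simp
    qed
    with g show "\<exists>\<gamma>::real. 0 < \<gamma> \<and> \<gamma> < 1 \<and>
        (\<forall>x\<in>K. char_exponent F T (P i) x + ereal (ln \<gamma>) \<ge> char_exponent F T (P (Suc i)) x)" by blast
  qed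
  have "quasi_all_invariant_decomposition K F T N j P Q"
    unfolding quasi_all_invariant_decomposition_def bundles_invariant_def jsum[OF order_refl]
    using bundles codim decomp invariance by blast
  with bundles codim decomp invariance cones coneQ exponents show ?thesis
    by (intro exI[of _ P] exI[of _ Q] conjI)
qed

end
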